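(* Let $\mathfrak s$ be a solvable Lie algebra over $\mathbb K$ with nilradical $\mathfrak n$, let $r=\dim(\mathfrak s/\mathfrak n)$, and let $\mathfrak a$ be a vector subspace of a Cartan subalgebra of $\mathfrak s$ with $\mathfrak s=\mathfrak a\oplus\mathfrak n$ as vector spaces. Then there is an affine linear subspace $\mathcal A$ of $\operatorname{Hom}(\Lambda^2\mathfrak s,\mathfrak s)$ of dimension at least $r^2$ such that: (i) every point $\mu\in\mathcal A$ is a Lie bracket on the vector space $\mathfrak s$; (ii) $\mathcal A$ contains the bracket of $\mathfrak s$ and the bracket of the nilshadow of $\mathfrak s$ (constructed from $\mathfrak a$); (iii) all points of $\mathcal A$ have the same total cohomology, that is, $\dim TH^p(\mathfrak s,\mu)=\dim TH^p(\mathfrak s)$ for all $\mu\in\mathcal A$ and all $p=0,\dots,\dim\mathfrak s$, where $(\mathfrak s,\mu)$ denotes the vector space $\mathfrak s$ with Lie bracket $\mu$.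
   Context: $\mathbb K$ is an algebraically closed field of characteristic $0$; all Lie algebras and modules are finite dimensional over $\mathbb K$. $\Gamma_\circ^p(\mathfrak g)$ is the (finite) set of equivalence classes of irreducible finite dimensional $\mathfrak g$-modules $V$ with $H^p(\mathfrak g,V)\ne0$, and $TH^p(\mathfrak g)=\bigoplus_{V\in\Gamma_\circ^p(\mathfrak g)}H^p(\mathfrak g,V)$ is the total cohomology. For $X\in\mathfrak s$, $\operatorname{ad}(X)_s$ is the semisimple part of $\operatorname{ad}(X)$ in $\operatorname{End}(\mathfrak s)$ (a derivation of $\mathfrak s$ with image in $\mathfrak n$). Writing $X=X_{\mathfrak a}+X_{\mathfrak n}$ according to $\mathfrak s=\mathfrak a\oplus\mathfrak n$, the nilshadow of $\mathfrak s$ is the vector space $\mathfrak s$ with the (nilpotent) Lie bracket $[X,Y]_{\operatorname{nilsh}}=[X,Y]-\operatorname{ad}(X_{\mathfrak a})_s(Y)+\operatorname{ad}(Y_{\mathfrak a})_s(X)$. *)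

theory Defs
  imports
    "Jordan_Normal_Form.VS_Connect"
    "HOL-Library.Function_Algebras"
begin

text \<open>
  A vector space over \<open>'k\<close> is an abelian group type together with a scalar multiplication
  \<open>sc\<close> satisfying \<open>vector_space sc\<close>. Name clash: the record based theory of vector spaces
  (locale \<open>vectorspace\<close>, used below for quotients and direct sums, which are not subspaces of
  a fixed type) also has \<open>span\<close>, \<open>subspace\<close> and \<open>dim\<close>, hence the qualified names here.
\<close>

abbreviation subsp :: "('k::field \<Rightarrow> 'v::ab_group_add \<Rightarrow> 'v) \<Rightarrow> 'v set \<Rightarrow> bool" where
  "subsp sc \<equiv> Modules.module.subspace sc"

abbreviation lspan :: "('k::field \<Rightarrow> 'v::ab_group_add \<Rightarrow> 'v) \<Rightarrow> 'v set \<Rightarrow> 'v set" where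
  "lspan sc \<equiv> Modules.module.span sc"

abbreviation ldim :: "('k::field \<Rightarrow> 'v::ab_group_add \<Rightarrow> 'v) \<Rightarrow> 'v set \<Rightarrow> nat" where
  "ldim sc \<equiv> Vector_Spaces.vector_space.dim sc"

definition fscale :: "('k \<Rightarrow> 'v \<Rightarrow> 'v) \<Rightarrow> 'k \<Rightarrow> ('a \<Rightarrow> 'v) \<Rightarrow> 'a \<Rightarrow> 'v" where
  "fscale sc c f = (\<lambda>x. sc c (f x))"


subsection \<open>Quotients and direct sums\<close>

text \<open>The ring operations that the record type \<open>module\<close> inherits play no role for modules and
  are left unspecified.\<close>

definition quot_space ::
  "('k::field \<Rightarrow> 'v::ab_group_add \<Rightarrow> 'v) \<Rightarrow> 'v set \<Rightarrow> 'v set \<Rightarrow> ('k, 'v set) module" where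
  "quot_space sc Z B =
     \<lparr> carrier = {{z + b | b. b \<in> B} | z. z \<in> Z},
       mult = undefined, one = undefined,
       zero = B,
       add = (\<lambda>S T. {s + t | s t. s \<in> S \<and> t \<in> T}),
       smult = (\<lambda>c S. {sc c s + b | s b. s \<in> S \<and> b \<in> B}) \<rparr>"

definition direct_sum_space ::
  "'i set \<Rightarrow> ('i \<Rightarrow> ('k, 'c) module) \<Rightarrow> ('k, 'i \<Rightarrow> 'c) module" where
  "direct_sum_space I M =
     \<lparr> carrier = {F \<in> (\<Pi>\<^sub>E i\<in>I. carrier (M i)). finite {i \<in> I. F i \<noteq> \<zero>\<^bsub>M i\<^esub>}},
       mult = undefined, one = undefined,
       zero = (\<lambda>i\<in>I. \<zero>\<^bsub>M i\<^esub>),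
       add = (\<lambda>F G. \<lambda>i\<in>I. F i \<oplus>\<^bsub>M i\<^esub> G i),
       smult = (\<lambda>c F. \<lambda>i\<in>I. c \<odot>\<^bsub>M i\<^esub> F i) \<rparr>"

definition rdim :: "('k::field, 'c) module \<Rightarrow> nat" where
  "rdim M = vectorspace.dim class_ring M"


subsection \<open>Affine subspaces\<close>

definition affine_subspace :: "('k::field \<Rightarrow> 'v::ab_group_add \<Rightarrow> 'v) \<Rightarrow> 'v set \<Rightarrow> bool" where
  "affine_subspace sc A \<longleftrightarrow> (\<exists>a D. subsp sc D \<and> A = {a + d | d. d \<in> D})"

definition affine_dim :: "('k::field \<Rightarrow> 'v::ab_group_add \<Rightarrow> 'v) \<Rightarrow> 'v set \<Rightarrow> nat" where
  "affine_dim sc A = ldim sc {x - y | x y. x \<in> A \<and> y \<in> A}"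


subsection \<open>Lie algebras\<close>

text \<open>\<open>Hom(\<Lambda>\<^sup>2 s, s)\<close>, identified with the alternating bilinear maps \<open>s \<times> s \<rightarrow> s\<close>.\<close>

definition alt_bilinear ::
  "('k::field \<Rightarrow> 's::ab_group_add \<Rightarrow> 's) \<Rightarrow> ('s \<Rightarrow> 's \<Rightarrow> 's) set" where
  "alt_bilinear sc =
     {\<mu>. (\<forall>x. Vector_Spaces.linear sc sc (\<mu> x)) \<and>
         (\<forall>y. Vector_Spaces.linear sc sc (\<lambda>x. \<mu> x y)) \<and>
         (\<forall>x. \<mu> x x = 0)}"

definition lie_bracket ::
  "('k::field \<Rightarrow> 's::ab_group_add \<Rightarrow> 's) \<Rightarrow> ('s \<Rightarrow> 's \<Rightarrow> 's) \<Rightarrow> bool" where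
  "lie_bracket sc \<mu> \<longleftrightarrow> \<mu> \<in> alt_bilinear sc \<and>
     (\<forall>x y z. \<mu> x (\<mu> y z) + \<mu> y (\<mu> z x) + \<mu> z (\<mu> x y) = 0)"

definition fd_lie_algebra ::
  "('k::field \<Rightarrow> 's::ab_group_add \<Rightarrow> 's) \<Rightarrow> ('s \<Rightarrow> 's \<Rightarrow> 's) \<Rightarrow> bool" where
  "fd_lie_algebra sc \<mu> \<longleftrightarrow>
     (\<exists>Basis. finite_dimensional_vector_space sc Basis) \<and> lie_bracket sc \<mu>"

primrec derived_series ::
  "('k::field \<Rightarrow> 's::ab_group_add \<Rightarrow> 's) \<Rightarrow> ('s \<Rightarrow> 's \<Rightarrow> 's) \<Rightarrow> nat \<Rightarrow> 's set" where
  "derived_series sc \<mu> 0 = UNIV"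
| "derived_series sc \<mu> (Suc n) =
     lspan sc {\<mu> x y | x y. x \<in> derived_series sc \<mu> n \<and> y \<in> derived_series sc \<mu> n}"

definition lie_solvable ::
  "('k::field \<Rightarrow> 's::ab_group_add \<Rightarrow> 's) \<Rightarrow> ('s \<Rightarrow> 's \<Rightarrow> 's) \<Rightarrow> bool" where
  "lie_solvable sc \<mu> \<longleftrightarrow> (\<exists>n. derived_series sc \<mu> n = {0})"

definition lie_subalgebra ::
  "('k::field \<Rightarrow> 's::ab_group_add \<Rightarrow> 's) \<Rightarrow> ('s \<Rightarrow> 's \<Rightarrow> 's) \<Rightarrow> 's set \<Rightarrow> bool" where
  "lie_subalgebra sc \<mu> H \<longleftrightarrow> subsp sc H \<and> (\<forall>x\<in>H. \<forall>y\<in>H. \<mu> x y \<in> H)"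

definition lie_ideal ::
  "('k::field \<Rightarrow> 's::ab_group_add \<Rightarrow> 's) \<Rightarrow> ('s \<Rightarrow> 's \<Rightarrow> 's) \<Rightarrow> 's set \<Rightarrow> bool" where
  "lie_ideal sc \<mu> I \<longleftrightarrow> subsp sc I \<and> (\<forall>x. \<forall>y\<in>I. \<mu> x y \<in> I)"

primrec lower_central_series ::
  "('k::field \<Rightarrow> 's::ab_group_add \<Rightarrow> 's) \<Rightarrow> ('s \<Rightarrow> 's \<Rightarrow> 's) \<Rightarrow> 's set \<Rightarrow> nat \<Rightarrow> 's set" where
  "lower_central_series sc \<mu> H 0 = H"
| "lower_central_series sc \<mu> H (Suc n) =
     lspan sc {\<mu> x y | x y. x \<in> H \<and> y \<in> lower_central_series sc \<mu> H n}"

definition lie_nilpotent ::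
  "('k::field \<Rightarrow> 's::ab_group_add \<Rightarrow> 's) \<Rightarrow> ('s \<Rightarrow> 's \<Rightarrow> 's) \<Rightarrow> 's set \<Rightarrow> bool" where
  "lie_nilpotent sc \<mu> H \<longleftrightarrow> (\<exists>n. lower_central_series sc \<mu> H n = {0})"

definition is_nilradical ::
  "('k::field \<Rightarrow> 's::ab_group_add \<Rightarrow> 's) \<Rightarrow> ('s \<Rightarrow> 's \<Rightarrow> 's) \<Rightarrow> 's set \<Rightarrow> bool" where
  "is_nilradical sc \<mu> N \<longleftrightarrow> lie_ideal sc \<mu> N \<and> lie_nilpotent sc \<mu> N \<and>
     (\<forall>I. lie_ideal sc \<mu> I \<and> lie_nilpotent sc \<mu> I \<longrightarrow> I \<subseteq> N)"

definition lie_normalizer :: "('s \<Rightarrow> 's \<Rightarrow> 's) \<Rightarrow> 's set \<Rightarrow> 's set" where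
  "lie_normalizer \<mu> H = {x. \<forall>y\<in>H. \<mu> x y \<in> H}"

definition cartan_subalgebra ::
  "('k::field \<Rightarrow> 's::ab_group_add \<Rightarrow> 's) \<Rightarrow> ('s \<Rightarrow> 's \<Rightarrow> 's) \<Rightarrow> 's set \<Rightarrow> bool" where
  "cartan_subalgebra sc \<mu> H \<longleftrightarrow>
     lie_subalgebra sc \<mu> H \<and> lie_nilpotent sc \<mu> H \<and> lie_normalizer \<mu> H = H"

definition vs_complement ::
  "('k::field \<Rightarrow> 'v::ab_group_add \<Rightarrow> 'v) \<Rightarrow> 'v set \<Rightarrow> 'v set \<Rightarrow> bool" where
  "vs_complement sc U W \<longleftrightarrow> subsp sc U \<and> subsp sc W \<and> U \<inter> W = {0} \<and>
     {u + w | u w. u \<in> U \<and> w \<in> W} = UNIV"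


subsection \<open>Jordan decomposition and the nilshadow\<close>

definition semisimple_endo ::
  "('k::field \<Rightarrow> 'v::ab_group_add \<Rightarrow> 'v) \<Rightarrow> ('v \<Rightarrow> 'v) \<Rightarrow> bool" where
  "semisimple_endo sc f \<longleftrightarrow> Vector_Spaces.linear sc sc f \<and>
     (\<forall>U. subsp sc U \<and> f ` U \<subseteq> U \<longrightarrow> (\<exists>W. vs_complement sc U W \<and> f ` W \<subseteq> W))"

definition nilpotent_endo ::
  "('k::field \<Rightarrow> 'v::ab_group_add \<Rightarrow> 'v) \<Rightarrow> ('v \<Rightarrow> 'v) \<Rightarrow> bool" where
  "nilpotent_endo sc f \<longleftrightarrow> Vector_Spaces.linear sc sc f \<and> (\<exists>n. \<forall>x. (f ^^ n) x = 0)"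

definition semisimple_part ::
  "('k::field \<Rightarrow> 'v::ab_group_add \<Rightarrow> 'v) \<Rightarrow> ('v \<Rightarrow> 'v) \<Rightarrow> ('v \<Rightarrow> 'v)" where
  "semisimple_part sc f = (THE s. semisimple_endo sc s \<and>
     (\<exists>n. nilpotent_endo sc n \<and> s \<circ> n = n \<circ> s \<and> (\<forall>x. f x = s x + n x)))"

text \<open>The component of \<open>x\<close> in \<open>a\<close> along \<open>N\<close>, where the space is the direct sum of
  \<open>a\<close> and \<open>N\<close>.\<close>

definition comp_along :: "'v::ab_group_add set \<Rightarrow> 'v set \<Rightarrow> 'v \<Rightarrow> 'v" where
  "comp_along a N x = (THE y. y \<in> a \<and> x - y \<in> N)"

definition nilshadow ::
  "('k::field \<Rightarrow> 's::ab_group_add \<Rightarrow> 's) \<Rightarrow> ('s \<Rightarrow> 's \<Rightarrow> 's) \<Rightarrow> 's set \<Rightarrow> 's set \<Rightarrow> 's \<Rightarrow> 's \<Rightarrow> 's" where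
  "nilshadow sc \<mu> a N x y =
     \<mu> x y - semisimple_part sc (\<mu> (comp_along a N x)) y
           + semisimple_part sc (\<mu> (comp_along a N y)) x"


subsection \<open>Modules\<close>

text \<open>A module is a pair \<open>(V, \<rho>)\<close> of a subspace \<open>V\<close> of an ambient space and an action
  \<open>\<rho>\<close>; the values of \<open>\<rho>\<close> outside \<open>V\<close> are irrelevant.\<close>

definition linear_between ::
  "('k::field \<Rightarrow> 'v::ab_group_add \<Rightarrow> 'v) \<Rightarrow> ('k \<Rightarrow> 'w::ab_group_add \<Rightarrow> 'w) \<Rightarrow>
   'v set \<Rightarrow> 'w set \<Rightarrow> ('v \<Rightarrow> 'w) \<Rightarrow> bool" where
  "linear_between scV scW V W f \<longleftrightarrow>
     (\<forall>v\<in>V. f v \<in> W) \<and>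
     (\<forall>v\<in>V. \<forall>v'\<in>V. f (v + v') = f v + f v') \<and>
     (\<forall>c. \<forall>v\<in>V. f (scV c v) = scW c (f v))"

definition fd_lie_module ::
  "('k::field \<Rightarrow> 's::ab_group_add \<Rightarrow> 's) \<Rightarrow> ('s \<Rightarrow> 's \<Rightarrow> 's) \<Rightarrow> ('k \<Rightarrow> 'v::ab_group_add \<Rightarrow> 'v) \<Rightarrow>
   'v set \<times> ('s \<Rightarrow> 'v \<Rightarrow> 'v) \<Rightarrow> bool" where
  "fd_lie_module sc \<mu> scV = (\<lambda>(V, \<rho>).
     subsp scV V \<and> (\<exists>B. finite B \<and> lspan scV B = V) \<and>
     (\<forall>x. linear_between scV scV V V (\<rho> x)) \<and>
     (\<forall>v\<in>V. Vector_Spaces.linear sc scV (\<lambda>x. \<rho> x v)) \<and>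
     (\<forall>x y. \<forall>v\<in>V. \<rho> (\<mu> x y) v = \<rho> x (\<rho> y v) - \<rho> y (\<rho> x v)))"

definition irreducible_module ::
  "('k::field \<Rightarrow> 's::ab_group_add \<Rightarrow> 's) \<Rightarrow> ('s \<Rightarrow> 's \<Rightarrow> 's) \<Rightarrow> ('k \<Rightarrow> 'v::ab_group_add \<Rightarrow> 'v) \<Rightarrow>
   'v set \<times> ('s \<Rightarrow> 'v \<Rightarrow> 'v) \<Rightarrow> bool" where
  "irreducible_module sc \<mu> scV = (\<lambda>(V, \<rho>).
     fd_lie_module sc \<mu> scV (V, \<rho>) \<and> V \<noteq> {0} \<and>
     (\<forall>W. subsp scV W \<and> W \<subseteq> V \<and> (\<forall>x. \<rho> x ` W \<subseteq> W) \<longrightarrow> W = {0} \<or> W = V))"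

definition module_iso ::
  "('k::field \<Rightarrow> 'v::ab_group_add \<Rightarrow> 'v) \<Rightarrow> ('k \<Rightarrow> 'w::ab_group_add \<Rightarrow> 'w) \<Rightarrow>
   'v set \<times> ('s \<Rightarrow> 'v \<Rightarrow> 'v) \<Rightarrow> 'w set \<times> ('s \<Rightarrow> 'w \<Rightarrow> 'w) \<Rightarrow> bool" where
  "module_iso scV scW = (\<lambda>(V, \<rho>) (W, \<sigma>).
     \<exists>f. linear_between scV scW V W f \<and> bij_betw f V W \<and>
         (\<forall>x. \<forall>v\<in>V. f (\<rho> x v) = \<sigma> x (f v)))"


subsection \<open>Chevalley--Eilenberg cohomology\<close>

text \<open>\<open>Hom(\<Lambda>\<^sup>p s, V)\<close> as alternating multilinear functions of argument lists of length \<open>p\<close>,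
  extended by \<open>0\<close> to lists of any other length.\<close>

definition cochains ::
  "('k::field \<Rightarrow> 's::ab_group_add \<Rightarrow> 's) \<Rightarrow> ('k \<Rightarrow> 'v::ab_group_add \<Rightarrow> 'v) \<Rightarrow> 'v set \<Rightarrow> nat \<Rightarrow>
   ('s list \<Rightarrow> 'v) set" where
  "cochains sc scV V p =
     {f. (\<forall>xs. length xs = p \<longrightarrow> f xs \<in> V) \<and>
         (\<forall>xs. length xs \<noteq> p \<longrightarrow> f xs = 0) \<and>
         (\<forall>xs i. length xs = p \<and> i < p \<longrightarrow> Vector_Spaces.linear sc scV (\<lambda>x. f (xs[i := x]))) \<and>
         (\<forall>xs i j. length xs = p \<and> i < j \<and> j < p \<and> xs ! i = xs ! j \<longrightarrow> f xs = 0)}"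

text \<open>Arguments are numbered from \<open>0\<close>; \<open>nths xs (- {i})\<close> is \<open>xs\<close> with the \<open>i\<close>-th entry
  omitted.\<close>

definition ce_diff ::
  "('s \<Rightarrow> 's \<Rightarrow> 's) \<Rightarrow> ('k::field \<Rightarrow> 'v::ab_group_add \<Rightarrow> 'v) \<Rightarrow> ('s \<Rightarrow> 'v \<Rightarrow> 'v) \<Rightarrow> nat \<Rightarrow>
   ('s list \<Rightarrow> 'v) \<Rightarrow> 's list \<Rightarrow> 'v" where
  "ce_diff \<mu> scV \<rho> p f xs =
     (if length xs = Suc p then
        (\<Sum>i\<le>p. scV ((-1) ^ i) (\<rho> (xs ! i) (f (nths xs (- {i}))))) +
        (\<Sum>j\<le>p. \<Sum>i<j. scV ((-1) ^ (i + j)) (f (\<mu> (xs ! i) (xs ! j) # nths xs (- {i, j}))))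
      else 0)"

definition cocycles ::
  "('k::field \<Rightarrow> 's::ab_group_add \<Rightarrow> 's) \<Rightarrow> ('s \<Rightarrow> 's \<Rightarrow> 's) \<Rightarrow> ('k \<Rightarrow> 'v::ab_group_add \<Rightarrow> 'v) \<Rightarrow>
   'v set \<times> ('s \<Rightarrow> 'v \<Rightarrow> 'v) \<Rightarrow> nat \<Rightarrow> ('s list \<Rightarrow> 'v) set" where
  "cocycles sc \<mu> scV = (\<lambda>(V, \<rho>) p. {f \<in> cochains sc scV V p. ce_diff \<mu> scV \<rho> p f = 0})"

definition coboundaries ::
  "('k::field \<Rightarrow> 's::ab_group_add \<Rightarrow> 's) \<Rightarrow> ('s \<Rightarrow> 's \<Rightarrow> 's) \<Rightarrow> ('k \<Rightarrow> 'v::ab_group_add \<Rightarrow> 'v) \<Rightarrow>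
   'v set \<times> ('s \<Rightarrow> 'v \<Rightarrow> 'v) \<Rightarrow> nat \<Rightarrow> ('s list \<Rightarrow> 'v) set" where
  "coboundaries sc \<mu> scV = (\<lambda>(V, \<rho>) p.
     (case p of 0 \<Rightarrow> {0} | Suc q \<Rightarrow> ce_diff \<mu> scV \<rho> q ` cochains sc scV V q))"

definition cohomology ::
  "('k::field \<Rightarrow> 's::ab_group_add \<Rightarrow> 's) \<Rightarrow> ('s \<Rightarrow> 's \<Rightarrow> 's) \<Rightarrow> ('k \<Rightarrow> 'v::ab_group_add \<Rightarrow> 'v) \<Rightarrow>
   'v set \<times> ('s \<Rightarrow> 'v \<Rightarrow> 'v) \<Rightarrow> nat \<Rightarrow> ('k, ('s list \<Rightarrow> 'v) set) module" where
  "cohomology sc \<mu> scV M p =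
     quot_space (fscale scV) (cocycles sc \<mu> scV M p) (coboundaries sc \<mu> scV M p)"


subsection \<open>Total cohomology\<close>

text \<open>The ambient space \<open>nat \<Rightarrow> 'k\<close> has subspaces of every finite dimension, so every finite
  dimensional module is isomorphic to one realized in it, and the isomorphism classes below
  are those of all irreducible finite dimensional modules.\<close>

type_synonym ('k, 's) std_module = "(nat \<Rightarrow> 'k) set \<times> ('s \<Rightarrow> (nat \<Rightarrow> 'k) \<Rightarrow> (nat \<Rightarrow> 'k))"

abbreviation std_scale :: "'k::field \<Rightarrow> (nat \<Rightarrow> 'k) \<Rightarrow> (nat \<Rightarrow> 'k)" where
  "std_scale \<equiv> fscale (*)"

definition irreps ::
  "('k::field \<Rightarrow> 's::ab_group_add \<Rightarrow> 's) \<Rightarrow> ('s \<Rightarrow> 's \<Rightarrow> 's) \<Rightarrow> ('k, 's) std_module set" where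
  "irreps sc \<mu> = {M. irreducible_module sc \<mu> std_scale M}"

definition irrep_equiv ::
  "('k::field \<Rightarrow> 's::ab_group_add \<Rightarrow> 's) \<Rightarrow> ('s \<Rightarrow> 's \<Rightarrow> 's) \<Rightarrow> ('k, 's) std_module rel" where
  "irrep_equiv sc \<mu> =
     {(M, N). M \<in> irreps sc \<mu> \<and> N \<in> irreps sc \<mu> \<and> module_iso std_scale std_scale M N}"

definition cohomology_irreps ::
  "('k::field \<Rightarrow> 's::ab_group_add \<Rightarrow> 's) \<Rightarrow> ('s \<Rightarrow> 's \<Rightarrow> 's) \<Rightarrow> nat \<Rightarrow>
   ('k, 's) std_module set set" where
  "cohomology_irreps sc \<mu> p =
     {C \<in> irreps sc \<mu> // irrep_equiv sc \<mu>.
        \<exists>M\<in>C. carrier (cohomology sc \<mu> std_scale M p) \<noteq> {\<zero>\<^bsub>cohomology sc \<mu> std_scale M p\<^esub>}}"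

definition total_cohomology ::
  "('k::field \<Rightarrow> 's::ab_group_add \<Rightarrow> 's) \<Rightarrow> ('s \<Rightarrow> 's \<Rightarrow> 's) \<Rightarrow> nat \<Rightarrow>
   ('k, ('k, 's) std_module set \<Rightarrow> ('s list \<Rightarrow> nat \<Rightarrow> 'k) set) module" where
  "total_cohomology sc \<mu> p =
     direct_sum_space (cohomology_irreps sc \<mu> p)
       (\<lambda>C. cohomology sc \<mu> std_scale (SOME M. M \<in> C) p)"

end

theory Submission
  imports Defs
begin

text \<open>
  Let \<open>D A\<close> be the semisimple part of \<open>ad A\<close> for \<open>A\<close> in \<open>\<aa>\<close>. These are commuting diagonalizable
  derivations, linear in \<open>A\<close>, that kill \<open>\<aa>\<close> and map into \<open>N\<close>. Hence for every linear map
  \<open>g : \<aa> \<rightarrow> \<aa>\<close>, extended by \<open>0\<close> to \<open>N\<close>, the formula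
  \<open>\<mu> x y = [x, y] + D (g x) y - D (g y) x\<close> defines a Lie bracket. The \<open>r\<^sup>2\<close>-dimensional space of
      such
  \<open>g\<close> parametrizes the family faithfully, since \<open>D A = 0\<close> makes \<open>ad A\<close> nilpotent and so puts \<open>A\<close>
      into
  \<open>\<aa> \<inter> N\<close>; \<open>g = 0\<close> is the given bracket and \<open>g = - id\<close> the nilshadow \<open>\<nu>\<close>.

  Every \<open>\<mu>\<close> is of the form \<open>\<nu> x y + E x y - E y x\<close> with \<open>E\<close> a torus of derivations, and its
      irreducible
  modules are characters \<open>l\<close>. By Cartan's homotopy formula the cohomology with coefficients in \<open>l\<close>
  vanishes unless \<open>l\<close> vanishes on \<open>N\<close>, and is then carried by the weight-\<open>l\<close> part of the
      alternating forms;
  on this part the twist by \<open>l\<close> cancels the twist by \<open>E\<close>, so that the differential is that of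
      \<open>\<nu>\<close> with
  trivial coefficients. Summing over \<open>l\<close>, the total cohomology of \<open>\<mu>\<close> is the cohomology of the
      complex of
  \<open>\<nu>\<close>, which does not depend on \<open>\<mu>\<close>.
\<close>


subsection \<open>Eigenvectors\<close>

text \<open>Linearity of \<open>D\<close> is the delicate point, since semisimple parts are not
  additive in general. It comes from nilpotency of the Cartan subalgebra \<open>H\<close>: each
  generalized eigenspace of \<open>ad A\<close>, \<open>A\<close> in \<open>H\<close>, is then
  stable under all of \<open>H\<close>, so a common basis of generalized weight vectors exists, and
  a true eigenvector supplied by Lie's theorem shows that every weight is linear in
  \<open>A\<close>. In that basis each \<open>D A\<close> is diagonal with eigenvalues linear in
  \<open>A\<close>.

  Undoing the nilshadow adds the projection \<open>pr\<close> to the parameter, so relative to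
  \<open>\<nu>\<close> the torus belonging to \<open>g\<close> is
  \<open>E x = D (pr x + g x)\<close>. Weights of \<open>p\<close>-forms are sums of
  \<open>p\<close> basis weights; this bounds the set of coefficients that contribute.

  Cohomology is built from record-based quotients and direct sums. Dimensions are compared without
  choosing bases of cohomology: for every bracket of the family the total cohomology is the image of
  one and the same space, the closed forms of \<open>\<nu>\<close>, under a linear map whose fibres
  are the cosets of the exact forms of \<open>\<nu>\<close>.\<close>

lemma linear_betweenD:
  assumes "linear_between scV scW V W f"
  shows "v \<in> V \<Longrightarrow> f v \<in> W"
    and "v \<in> V \<Longrightarrow> w \<in> V \<Longrightarrow> f (v + w) = f v + f w"
    and "v \<in> V \<Longrightarrow> f (scV c v) = scW c (f v)"
  using assms by (auto simp: linear_between_def)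

locale alg_closed_vector_space = vector_space scale
  for scale :: "'k::{alg_closed_field, field_char_0} \<Rightarrow> 'v::ab_group_add \<Rightarrow> 'v" (infixr "*s" 75)
begin

lemma linear_between_0:
  assumes "linear_between scale scale V V f" "subspace V"
  shows "f 0 = 0"
  using linear_betweenD(3)[OF assms(1), of 0 0] subspace_0[OF assms(2)] by simp

lemma linear_between_diff:
  assumes "linear_between scale scale V V f" "subspace V" "v \<in> V" "w \<in> V"
  shows "f (v - w) = f v - f w"
proof -
  have "f (v + (-1) *s w) = f v + (-1) *s f w"
    using assms by (simp add: linear_between_def subspace_scale del: scale_minus_left)
  then show ?thesis by simp
qed

lemma linear_between_sum:
  assumes f: "linear_between scale scale V V f" "subspace V" and u: "\<And>i. i \<in> I \<Longrightarrow> u i \<in> V"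
  shows "f (\<Sum>i\<in>I. u i) = (\<Sum>i\<in>I. f (u i))"
  using u
proof (induction I rule: infinite_finite_induct)
  case (insert x F)
  then show ?case using f by (simp add: linear_betweenD(2)[OF f(1)] subspace_sum)
qed (auto simp: linear_between_0[OF f])

lemma linear_between_minus_scale:
  assumes "linear_between scale scale V V f" "subspace V"
  shows "linear_between scale scale V V (\<lambda>v. f v - c *s v)"
  using assms unfolding linear_between_def
  by (auto simp: subspace_diff subspace_scale algebra_simps)

lemma in_span_sequence:
  fixes g :: "nat \<Rightarrow> 'v"
  shows "x \<in> span (g ` {..<m}) \<Longrightarrow> \<exists>u. x = (\<Sum>i<m. u i *s g i)"
proof (induction m arbitrary: x)
  case (Suc m)
  have "x \<in> span (insert (g m) (g ` {..<m}))"
    using Suc.prems by (simp add: lessThan_Suc)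
  then obtain k where "x - k *s g m \<in> span (g ` {..<m})"
    using span_breakdown_eq by blast
  then obtain u where u: "x - k *s g m = (\<Sum>i<m. u i *s g i)"
    using Suc.IH by blast
  have "x = (\<Sum>i<Suc m. (u(m := k)) i *s g i)"
    using u by (simp add: algebra_simps)
  then show ?case by blast
qed auto

text \<open>Otherwise initial segments of every length would be independent inside
  \<open>span T\<close>. This yields annihilating polynomials below and the first dependent index in
  the proof of Lie's theorem.\<close>

lemma sequence_dependent:
  fixes g :: "nat \<Rightarrow> 'v"
  assumes "finite T" and "\<And>i. g i \<in> span T"
  shows "\<exists>m. g m \<in> span (g ` {..<m})"
proof (rule ccontr)
  assume "\<not> ?thesis"
  then have n: "g m \<notin> span (g ` {..<m})" for m by simp
  have "independent (g ` {..<m}) \<and> card (g ` {..<m}) = m" for m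
  proof (induction m)
    case (Suc m)
    have "g m \<notin> g ` {..<m}" using n[of m] span_base[of "g m" "g ` {..<m}"] by blast
    then show ?case
      using Suc n[of m] independent_insertI[of "g m" "g ` {..<m}"] by (simp add: lessThan_Suc)
  qed (auto simp: independent_empty)
  from this[of "Suc (card T)"] have "Suc (card T) \<le> card T"
    using independent_span_bound[OF assms(1), of "g ` {..<Suc (card T)}"] assms(2)
    by (metis image_subset_iff)
  then show False by simp
qed

text \<open>The value of \<open>p\<close> at \<open>f\<close>, applied to \<open>v\<close>. The
  number of summands is an argument because every \<open>n\<close> above the degree gives the same
  result, so polynomials of different degrees can be compared term by term.\<close>

definition poly_apply :: "nat \<Rightarrow> 'k poly \<Rightarrow> ('v \<Rightarrow> 'v) \<Rightarrow> 'v \<Rightarrow> 'v" where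
  "poly_apply n p f v = (\<Sum>i<n. coeff p i *s (f ^^ i) v)"

lemma poly_apply_eq:
  assumes "degree p < n"
  shows "poly_apply n p f v = poly_apply (Suc (degree p)) p f v"
  unfolding poly_apply_def
  by (rule sum.mono_neutral_right) (use assms in \<open>auto simp: not_less coeff_eq_0 Suc_le_eq\<close>)

lemma poly_apply_root_factor:
  assumes f: "linear_between scale scale V V f" "subspace V" and v: "v \<in> V" and q: "degree q < n"
  shows "poly_apply (Suc n) ([:-c, 1:] * q) f v
       = f (poly_apply n q f v) - c *s poly_apply n q f v"
proof -
  have V: "(f ^^ i) v \<in> V" for i
    by (induction i) (use v linear_betweenD(1)[OF f(1)] in auto)
  have "poly_apply (Suc n) ([:-c, 1:] * q) f v
      = (\<Sum>i<Suc n. coeff (pCons 0 q) i *s (f ^^ i) v) - (\<Sum>i<Suc n. (c * coeff q i) *s (f ^^ i) v)"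
    unfolding poly_apply_def
    by (subst sum_subtractf[symmetric], rule sum.cong) (auto simp: algebra_simps)
  also have "(\<Sum>i<Suc n. coeff (pCons 0 q) i *s (f ^^ i) v) = f (poly_apply n q f v)"
    unfolding poly_apply_def using V
    by (subst sum.lessThan_Suc_shift)
       (simp add: linear_between_sum[OF f] subspace_scale[OF f(2)] linear_betweenD(3)[OF f(1)])
  also have "(\<Sum>i<Suc n. (c * coeff q i) *s (f ^^ i) v) = c *s poly_apply n q f v"
    unfolding poly_apply_def using q by (simp add: scale_sum_right coeff_eq_0)
  finally show ?thesis .
qed

text \<open>Eigenvectors of the induced map on \<open>V / U\<close>, stated without forming the quotient.\<close>

lemma relative_eigenvector:
  assumes f: "linear_between scale scale V V f" and V: "subspace V" and U: "subspace U"
    and sub: "U \<subseteq> V" "U \<noteq> V" and fin: "finite T" "V \<subseteq> span T"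
  shows "\<exists>v\<in>V - U. \<exists>c. f v - c *s v \<in> U"
proof -
  obtain v where v: "v \<in> V" "v \<notin> U" using sub by blast
  have fV: "(f ^^ i) v \<in> V" for i
    by (induction i) (use v linear_betweenD(1)[OF f] in auto)
  \<comment> \<open>Polynomials that annihilate \<open>v\<close> modulo \<open>U\<close>. A linear
    dependence among the iterates of \<open>v\<close> provides a monic one.\<close>
  define P where "P = (\<lambda>p. p \<noteq> 0 \<and> poly_apply (Suc (degree p)) p f v \<in> U)"
  obtain m where "(f ^^ m) v \<in> span ((\<lambda>i. (f ^^ i) v) ` {..<m})"
    using sequence_dependent[OF fin(1), of "\<lambda>i. (f ^^ i) v"] fV fin(2) by blast
  then obtain u where u: "(f ^^ m) v = (\<Sum>i<m. u i *s (f ^^ i) v)"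
    using in_span_sequence[of _ "\<lambda>i. (f ^^ i) v"] by blast
  define p where "p = monom 1 m - (\<Sum>i<m. monom (u i) i)"
  have c: "coeff p i = (if i = m then 1 else if i < m then - u i else 0)" for i
    by (auto simp: p_def coeff_sum)
  have "coeff p m \<noteq> 0" unfolding c by simp
  then have p0: "p \<noteq> 0" by auto
  have "degree p \<le> m" by (rule degree_le) (simp add: c)
  then have "poly_apply (Suc (degree p)) p f v = poly_apply (Suc m) p f v"
    by (simp add: poly_apply_eq[of p "Suc m"])
  also have "\<dots> = 0"
    by (simp add: poly_apply_def c u sum_negf)
  finally have "P p" using p0 U by (simp add: P_def subspace_0)
  then have ex: "\<exists>p. P p" by blast
  \<comment> \<open>A root \<open>c\<close> of an annihilating polynomial of least degree splits off
    a linear factor; by minimality the cofactor applied to \<open>v\<close> stays outside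
    \<open>U\<close>, and this vector is the eigenvector.\<close>
  define p1 where "p1 = arg_min degree P"
  have p1: "P p1" and p1_min: "\<And>q. P q \<Longrightarrow> degree p1 \<le> degree q"
    unfolding p1_def using ex by (auto intro: arg_min_natI arg_min_nat_le)
  have "degree p1 > 0"
  proof (rule ccontr)
    assume "\<not> ?thesis"
    then obtain a where a: "p1 = [:a:]" by (metis degree_eq_zeroE gr0I)
    with p1 have "a \<noteq> 0" "a *s v \<in> U" by (auto simp: P_def poly_apply_def)
    then have "inverse a *s a *s v \<in> U" using U subspace_scale by blast
    then show False using v \<open>a \<noteq> 0\<close> by simp
  qed
  then obtain c where "poly p1 c = 0"
    using alg_closed_imp_poly_has_root by blast
  then have "[:-c, 1:] dvd p1" using poly_eq_0_iff_dvd by blast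
  then obtain q where q: "p1 = [:-c, 1:] * q" by (rule dvdE)
  have q0: "q \<noteq> 0" using p1 by (auto simp: q P_def)
  then have dq: "degree p1 = Suc (degree q)" unfolding q by (subst degree_mult_eq) auto
  define w where "w = poly_apply (degree p1) q f v"
  have w: "w \<in> V" unfolding w_def poly_apply_def
    by (intro subspace_sum[OF V] subspace_scale[OF V] fV)
  have "w \<notin> U"
    using p1_min[of q] q0 dq by (auto simp: P_def w_def)
  moreover have "f w - c *s w \<in> U"
    using p1 poly_apply_root_factor[OF f V v(1), of q "degree p1" c, folded q] dq
    unfolding P_def w_def by simp
  ultimately show ?thesis using w by blast
qed

end

subsection \<open>Lie's theorem\<close>

text \<open>Solvability in the form in which it is used in inductions: \<open>K\<close> is reached from \<open>0\<close> by
  adding one vector \<open>z\<close> at a time, where \<open>z\<close> normalizes what is already there.\<close>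

inductive lie_chain ::
  "('k::field \<Rightarrow> 's::ab_group_add \<Rightarrow> 's) \<Rightarrow> ('s \<Rightarrow> 's \<Rightarrow> 's) \<Rightarrow> 's set \<Rightarrow> bool"
  for sc \<mu> where
  zero: "lie_chain sc \<mu> {0}"
| step: "lie_chain sc \<mu> K \<Longrightarrow> (\<And>k. k \<in> K \<Longrightarrow> \<mu> z k \<in> K) \<Longrightarrow> lie_chain sc \<mu> (lspan sc (insert z K))"

lemma alt_bilinearD:
  assumes "\<mu> \<in> alt_bilinear sc"
  shows "\<mu> (x + y) z = \<mu> x z + \<mu> y z" "\<mu> z (x + y) = \<mu> z x + \<mu> z y"
    "\<mu> (sc c x) z = sc c (\<mu> x z)" "\<mu> z (sc c x) = sc c (\<mu> z x)"
    "\<mu> x x = 0" "\<mu> 0 x = 0" "\<mu> x 0 = 0" "\<mu> (x - y) z = \<mu> x z - \<mu> y z" "\<mu> z (x - y) = \<mu> z x - \<mu> z y"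
    "\<mu> (- x) z = - \<mu> x z" "\<mu> z (- x) = - \<mu> z x"
    "Vector_Spaces.linear sc sc (\<mu> x)" "Vector_Spaces.linear sc sc (\<lambda>x. \<mu> x z)"
proof -
  have l: "Vector_Spaces.linear sc sc (\<mu> x)" "Vector_Spaces.linear sc sc (\<lambda>x. \<mu> x z)" for x z
    using assms by (auto simp: alt_bilinear_def)
  interpret a: Vector_Spaces.linear sc sc "\<mu> z" for z by (rule l)
  interpret b: Vector_Spaces.linear sc sc "\<lambda>x. \<mu> x z" for z by (rule l)
  show "\<mu> (x + y) z = \<mu> x z + \<mu> y z" "\<mu> z (x + y) = \<mu> z x + \<mu> z y"
    "\<mu> (sc c x) z = sc c (\<mu> x z)" "\<mu> z (sc c x) = sc c (\<mu> z x)" "\<mu> 0 x = 0" "\<mu> x 0 = 0"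
    "\<mu> (x - y) z = \<mu> x z - \<mu> y z" "\<mu> z (x - y) = \<mu> z x - \<mu> z y"
    "\<mu> (- x) z = - \<mu> x z" "\<mu> z (- x) = - \<mu> z x"
    "Vector_Spaces.linear sc sc (\<mu> x)" "Vector_Spaces.linear sc sc (\<lambda>x. \<mu> x z)"
    by (rule a.add b.add a.scale b.scale a.zero b.zero a.diff b.diff a.neg b.neg l)+
  show "\<mu> x x = 0" using assms by (auto simp: alt_bilinear_def)
qed

lemma alt_bilinear_skew:
  assumes "\<mu> \<in> alt_bilinear sc"
  shows "\<mu> y x = - \<mu> x y"
proof -
  have "\<mu> (x + y) (x + y) = \<mu> x x + \<mu> y x + (\<mu> x y + \<mu> y y)"
    by (simp only: alt_bilinearD(1,2)[OF assms] ac_simps)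
  then show ?thesis by (simp add: alt_bilinearD(5)[OF assms] add_eq_0_iff)
qed

lemma lie_chain_subspace:
  assumes "vector_space sc" "lie_chain sc \<mu> K"
  shows "subsp sc K"
  using assms(2)
proof cases
  case zero
  interpret vector_space sc by fact
  show ?thesis using zero by simp
next
  case step
  interpret vector_space sc by fact
  show ?thesis using step by simp
qed

context alg_closed_vector_space
begin

lemma linear_between_vimage:
  assumes "linear_between scale scale V V f" "subspace V" "subspace S"
  shows "subspace {v \<in> V. f v - c *s v \<in> S}"
proof (rule subspaceI)
  note l = linear_betweenD[OF linear_between_minus_scale[OF assms(1,2), of c]]
  show "0 \<in> {v \<in> V. f v - c *s v \<in> S}"
    using linear_between_0[OF assms(1,2)] assms by (simp add: subspace_0)
  show "x + y \<in> {v \<in> V. f v - c *s v \<in> S}"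
    if "x \<in> {v \<in> V. f v - c *s v \<in> S}" "y \<in> {v \<in> V. f v - c *s v \<in> S}" for x y
    using that l(2)[of x y] assms by (auto simp: subspace_add)
  show "a *s x \<in> {v \<in> V. f v - c *s v \<in> S}" if "x \<in> {v \<in> V. f v - c *s v \<in> S}" for a x
    using that l(3)[of x a] assms by (auto simp: subspace_scale)
qed

text \<open>With \<open>e i = z\<^sup>i v\<close>, one has \<open>k (e i) = \<lambda> k e i - i \<lambda> [z, k] e (i - 1)\<close> modulo lower terms;
  at the first \<open>i\<close> where \<open>e i\<close> depends on its predecessors this forces \<open>i \<lambda> [z, k] = 0\<close>.
  This replaces the usual trace argument.\<close>

lemma lie_character_normalized:
  fixes \<rho> :: "'s \<Rightarrow> 'v \<Rightarrow> 'v" and \<mu> :: "'s \<Rightarrow> 's \<Rightarrow> 's"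
  assumes V: "subspace V" and U: "subspace U" and sub: "U \<subseteq> V"
    and fin: "finite T" "V \<subseteq> span T"
    and \<rho>: "\<And>x. x \<in> insert z K \<Longrightarrow> linear_between scale scale V V (\<rho> x)"
    and \<rho>U: "\<And>x u. x \<in> insert z K \<Longrightarrow> u \<in> U \<Longrightarrow> \<rho> x u \<in> U"
    and br: "\<And>k v. k \<in> K \<Longrightarrow> v \<in> V \<Longrightarrow> \<rho> (\<mu> z k) v = \<rho> z (\<rho> k v) - \<rho> k (\<rho> z v)"
    and zK: "\<And>k. k \<in> K \<Longrightarrow> \<mu> z k \<in> K"
    and v: "v \<in> V" "v \<notin> U" and lam: "\<And>k. k \<in> K \<Longrightarrow> \<rho> k v - lam k *s v \<in> U"
    and k: "k \<in> K"
  shows "lam (\<mu> z k) = 0"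
proof -
  define e where "e = (\<lambda>i. (\<rho> z ^^ i) v)"
  have eV: "e i \<in> V" for i
    by (induction i) (use v \<rho>[of z] linear_betweenD(1) in \<open>auto simp: e_def\<close>)
  have eS: "e (Suc i) = \<rho> z (e i)" for i by (simp add: e_def)
  \<comment> \<open>A flag starting at \<open>U\<close> that gains one vector \<open>e i\<close> per
    step. \<open>K\<close> will turn out to act on each layer by the scalars
    \<open>lam\<close>.\<close>
  define F where "F = (\<lambda>i. span (e ` {..<i} \<union> U))"
  have Fd: "F i = span (e ` {..<i} \<union> U)" for i by (simp add: F_def)
  have F: "subspace (F i)" for i unfolding F_def by simp
  have cancel: "a \<in> F i" if "a + b \<in> F i" "b \<in> F i" for a b i
    using subspace_diff[OF F that] by simp
  have F0: "F 0 = U" unfolding F_def using U by simp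
  have UF: "U \<subseteq> F i" for i unfolding F_def using span_superset by blast
  have eF: "i < j \<Longrightarrow> e i \<in> F j" for i j unfolding F_def by (auto intro: span_base)
  have Fmono: "i \<le> j \<Longrightarrow> F i \<subseteq> F j" for i j
    unfolding F_def by (rule span_mono) auto
  have FV: "F i \<subseteq> V" for i
    unfolding F_def using eV sub V by (intro span_minimal) auto
  have zF: "\<rho> z u \<in> F (Suc i)" if "u \<in> F i" for u i
  proof -
    have "F i \<subseteq> {v \<in> V. \<rho> z v - 0 *s v \<in> F (Suc i)}"
      unfolding Fd[of i]
    proof (rule span_minimal)
      show "e ` {..<i} \<union> U \<subseteq> {v \<in> V. \<rho> z v - 0 *s v \<in> F (Suc i)}"
        using eV sub UF[of "Suc i"] \<rho>U[of z] eF[of _ "Suc i"] by (auto simp flip: eS)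
    qed (use linear_between_vimage[of V "\<rho> z" "F (Suc i)" 0] \<rho> V F in auto)
    then show ?thesis using that by auto
  qed
  \<comment> \<open>At \<open>i = 0\<close> truncated subtraction makes the last term
    \<open>e 0\<close>, but its coefficient is 0, and the claim is the hypothesis on
    \<open>v\<close> modulo \<open>U\<close>.\<close>
  have key: "\<rho> k (e i) - lam k *s e i + (of_nat i * lam (\<mu> z k)) *s e (i - 1) \<in> F (i - 1)"
    if "k \<in> K" for i k
    using that
  proof (induction i arbitrary: k)
    case 0
    then show ?case using lam[of k] by (simp add: F0 e_def)
  next
    case (Suc i)
    define k' where "k' = \<mu> z k"
    have k': "k' \<in> K" using zK Suc.prems by (simp add: k'_def)
    define u where "u = \<rho> k (e i) - lam k *s e i + (of_nat i * lam k') *s e (i - 1)"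
    have u: "u \<in> F (i - 1)" using Suc.IH[OF Suc.prems] by (simp add: u_def k'_def)
    then have uV: "u \<in> V" using FV by blast
    define u' where "u' = \<rho> k' (e i) - lam k' *s e i"
    have "u' + (of_nat i * lam (\<mu> z k')) *s e (i - 1) \<in> F i"
      using Suc.IH[OF k'] Fmono[of "i - 1" i] by (auto simp: u'_def)
    moreover have i1: "(of_nat i * c) *s e (i - 1) \<in> F i" for c
      using eF[of "i - 1" i] F by (cases i) (auto simp: subspace_scale subspace_0)
    ultimately have u': "u' \<in> F i" using cancel by blast
    have zu: "\<rho> z u \<in> F i"
      using zF[OF u] \<rho>U[of z u] u F0 by (cases i) auto
    have ke: "\<rho> k (e i) = lam k *s e i - (of_nat i * lam k') *s e (i - 1) + u"
      by (simp add: u_def)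
    have "\<rho> z (\<rho> k (e i)) = lam k *s e (Suc i) - (of_nat i * lam k') *s \<rho> z (e (i - 1)) + \<rho> z u"
      unfolding ke using \<rho>[of z] eV uV V
      by (simp add: linear_between_diff[of V] linear_betweenD(2,3)[of _ _ V] subspace_diff
          subspace_scale eS)
    also have "(of_nat i * lam k') *s \<rho> z (e (i - 1)) = (of_nat i * lam k') *s e i"
      by (cases i) (auto simp: eS)
    finally have 1: "\<rho> z (\<rho> k (e i)) = lam k *s e (Suc i) - (of_nat i * lam k') *s e i + \<rho> z u" .
    have "\<rho> k (e (Suc i)) = \<rho> z (\<rho> k (e i)) - \<rho> k' (e i)"
      using br[OF Suc.prems eV[of i]] by (simp add: eS k'_def)
    also have "\<rho> k' (e i) = lam k' *s e i + u'" by (simp add: u'_def)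
    finally have "\<rho> k (e (Suc i)) - lam k *s e (Suc i) + (of_nat (Suc i) * lam k') *s e i = \<rho> z
        u - u'"
      unfolding 1 by (simp add: algebra_simps)
    then show ?case using zu u' F by (simp add: k'_def subspace_diff)
  qed
  \<comment> \<open>The correction term of \<open>key\<close> for \<open>e j\<close> with
    \<open>j\<close> at most \<open>i\<close> lies in \<open>F i\<close>, so \<open>k\<close> acts
    on \<open>F (Suc i) / F i\<close> as \<open>lam k\<close>.\<close>
  have low: "\<rho> k w - lam k *s w \<in> F i" if "k \<in> K" "w \<in> F (Suc i)" for k w i
  proof -
    have "\<rho> k (e j) - lam k *s e j \<in> F i" if "j \<le> i" for j
    proof -
      have "(of_nat j * lam (\<mu> z k)) *s e (j - 1) \<in> F i"
        using eF[of "j - 1" i] that F by (cases j) (auto simp: subspace_scale subspace_0)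
      moreover have "\<rho> k (e j) - lam k *s e j + (of_nat j * lam (\<mu> z k)) *s e (j - 1) \<in> F i"
        using key[OF \<open>k \<in> K\<close>, of j] subsetD[OF Fmono[of "j - 1" i]] that by simp
      ultimately show ?thesis using cancel by blast
    qed
    moreover have "\<rho> k u - lam k *s u \<in> F i" if "u \<in> U" for u
      using that UF \<rho>U[of k u] \<open>k \<in> K\<close> U by (meson insertCI subsetD subspace_diff subspace_scale)
    ultimately have "F (Suc i) \<subseteq> {w \<in> V. \<rho> k w - lam k *s w \<in> F i}"
      unfolding Fd[of "Suc i"] using eV sub \<rho>[of k] V F \<open>k \<in> K\<close>
      by (intro span_minimal linear_between_vimage) auto
    then show ?thesis using that by auto
  qed
  have "\<exists>m. e m \<in> F m"
    using sequence_dependent[OF fin(1), of e] eV fin(2) unfolding F_def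
    by (meson Un_upper1 span_mono subset_iff)
  \<comment> \<open>At the least such \<open>m\<close>, the vector \<open>e m\<close> already lies
    in \<open>F m\<close>, so both \<open>low\<close> and \<open>key\<close> apply to it with the
    same target \<open>F (m - 1)\<close>. Their difference is a multiple of
    \<open>e (m - 1)\<close>, which is not in that space; characteristic 0 then removes the factor
    \<open>m\<close>.\<close>
  then obtain m where m: "e m \<in> F m" "\<And>j. j < m \<Longrightarrow> e j \<notin> F j"
    using exists_least_iff[of "\<lambda>m. e m \<in> F m"] by blast
  have "m \<noteq> 0" using m(1) v F0 by (cases m) (auto simp: e_def)
  then obtain j where j: "m = Suc j" using not0_implies_Suc by blast
  have "(of_nat m * lam (\<mu> z k)) *s e j \<in> F j"
    using key[OF k, of m] low[OF k, of "e m" j] m(1)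
      cancel[of "(of_nat m * lam (\<mu> z k)) *s e j" "\<rho> k (e m) - lam k *s e m" j]
    by (simp add: j add.commute del: of_nat_Suc)
  moreover have "e j \<notin> F j" using m(2) j by simp
  moreover have "inverse c *s c *s e j \<in> F j" if "c *s e j \<in> F j" for c
    using that by (rule subspace_scale[OF F])
  ultimately have "of_nat m * lam (\<mu> z k) = 0"
    by (metis scale_one scale_scale left_inverse)
  then show ?thesis using j by (simp del: of_nat_Suc)
qed

text \<open>Working modulo \<open>U\<close> takes the place of the quotient module
  \<open>V / U\<close>, so that flags can be grown inside the given space. In the inductive step the
  vectors on which \<open>K\<close> acts by \<open>lam\<close> modulo \<open>U\<close> form a
  \<open>z\<close>-stable space, because \<open>lam\<close> vanishes on \<open>[z, K]\<close>; an
  eigenvector of \<open>z\<close> there serves for the enlarged algebra.\<close>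

lemma lie_theorem_relative:
  fixes \<rho> :: "'s::ab_group_add \<Rightarrow> 'v \<Rightarrow> 'v" and sc :: "'k \<Rightarrow> 's \<Rightarrow> 's"
  assumes vs: "vector_space sc" and \<mu>: "\<mu> \<in> alt_bilinear sc"
    and V: "subspace V" and U: "subspace U" and sub: "U \<subseteq> V" "U \<noteq> V"
    and fin: "finite T" "V \<subseteq> span T"
    and lin: "\<And>v. v \<in> V \<Longrightarrow> Vector_Spaces.linear sc scale (\<lambda>x. \<rho> x v)"
  shows "lie_chain sc \<mu> K \<Longrightarrow>
     (\<And>x. x \<in> K \<Longrightarrow> linear_between scale scale V V (\<rho> x)) \<Longrightarrow>
     (\<And>x u. x \<in> K \<Longrightarrow> u \<in> U \<Longrightarrow> \<rho> x u \<in> U) \<Longrightarrow>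
     (\<And>x y v. x \<in> K \<Longrightarrow> y \<in> K \<Longrightarrow> v \<in> V \<Longrightarrow> \<rho> (\<mu> x y) v = \<rho> x (\<rho> y v) - \<rho> y (\<rho> x v)) \<Longrightarrow>
     \<exists>v\<in>V - U. \<exists>lam. \<forall>x\<in>K. \<rho> x v - lam x *s v \<in> U"
proof (induction K rule: lie_chain.induct)
  case zero
  obtain v where v: "v \<in> V - U" using sub by blast
  interpret Vector_Spaces.linear sc scale "\<lambda>x. \<rho> x v" using lin v by blast
  have "\<forall>x\<in>{0}. \<rho> x v - 0 *s v \<in> U" using zero subspace_0[OF U] by simp
  then show ?case by (intro bexI[OF _ v] exI[of _ "\<lambda>_. 0"])
next
  case (step K z)
  interpret s: vector_space sc by fact
  define L where "L = s.span (insert z K)"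
  have KL: "K \<subseteq> L" and zL: "z \<in> L" unfolding L_def by (auto intro: s.span_base)
  have K: "s.span K = K" using lie_chain_subspace[OF vs step.hyps(1)] by simp
  note prems = step.prems[folded L_def]
  have "\<exists>v\<in>V - U. \<exists>lam. \<forall>x\<in>K. \<rho> x v - lam x *s v \<in> U"
    by (rule step.IH) (auto intro: prems simp: subsetD[OF KL])
  then obtain v0 lam where v0: "v0 \<in> V - U" and lam: "\<And>x. x \<in> K \<Longrightarrow> \<rho> x v0 - lam x *s v0 \<in> U"
    by blast
  have lam0: "lam (\<mu> z k) = 0" if "k \<in> K" for k
    by (rule lie_character_normalized[OF V U sub(1) fin, of z K \<rho> \<mu> v0])
       (use that KL zL prems step.hyps(2) v0 lam in \<open>auto simp: subset_iff\<close>)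
  \<comment> \<open>The common weight space of \<open>K\<close> for \<open>lam\<close>, modulo
    \<open>U\<close>.\<close>
  define W where "W = {v \<in> V. \<forall>k\<in>K. \<rho> k v - lam k *s v \<in> U}"
  have W: "subspace W"
  proof -
    have "W = V \<inter> (\<Inter>k\<in>K. {v \<in> V. \<rho> k v - lam k *s v \<in> U})" unfolding W_def by auto
    also have "subspace \<dots>"
      by (intro subspace_inter subspace_Int V linear_between_vimage U prems) (use KL in auto)
    finally show ?thesis .
  qed
  have UW: "U \<subseteq> W" unfolding W_def using sub(1) prems(2) KL U
    by (auto simp: subspace_diff subspace_scale subset_iff)
  have UW': "U \<noteq> W" using v0 lam unfolding W_def by auto
  have zV: "linear_between scale scale V V (\<rho> z)" using prems zL by blast
  have zW: "\<rho> z w \<in> W" if w: "w \<in> W" for w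
  proof -
    have wV: "w \<in> V" using w by (simp add: W_def)
    have "\<rho> k (\<rho> z w) - lam k *s \<rho> z w \<in> U" if k: "k \<in> K" for k
    proof -
      have kw: "\<rho> k w - lam k *s w \<in> U" "\<rho> (\<mu> z k) w - lam (\<mu> z k) *s w \<in> U"
        using w k step.hyps(2) by (auto simp: W_def)
      have kV: "\<rho> k w \<in> V" using prems(1) k KL wV by (meson linear_betweenD(1) subsetD)
      have "\<rho> k (\<rho> z w) = \<rho> z (\<rho> k w) - \<rho> (\<mu> z k) w"
        using prems(3)[of z k w] zL k KL wV by auto
      moreover have "\<rho> z (\<rho> k w - lam k *s w) = \<rho> z (\<rho> k w) - lam k *s \<rho> z w"
        using kV wV V zV by (simp add: linear_between_diff linear_betweenD(3) subspace_scale)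
      ultimately have "\<rho> k (\<rho> z w) - lam k *s \<rho> z w = \<rho> z (\<rho> k w - lam k *s w) - \<rho> (\<mu> z k) w"
        by simp
      also have "\<dots> \<in> U" using kw prems(2)[OF zL] lam0[OF k] by (simp add: U subspace_diff)
      finally show ?thesis .
    qed
    then show ?thesis using linear_betweenD(1)[OF zV wV] by (simp add: W_def)
  qed
  have WV: "W \<subseteq> V" by (auto simp: W_def)
  have "linear_between scale scale W W (\<rho> z)"
    using zV zW WV unfolding linear_between_def by (auto simp: subset_iff)
  then obtain v c where v: "v \<in> W - U" "\<rho> z v - c *s v \<in> U"
    using relative_eigenvector[OF _ W U UW UW' fin(1)] WV fin(2) by blast
  have vV: "v \<in> V" using v WV by blast
  interpret l: Vector_Spaces.linear sc scale "\<lambda>x. \<rho> x v" using lin vV by blast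
  have "\<exists>c. \<rho> x v - c *s v \<in> U" if x: "x \<in> L" for x
  proof -
    obtain a where a: "x - sc a z \<in> K" using x by (auto simp: L_def s.span_breakdown_eq K)
    define y where "y = x - sc a z"
    have xy: "x = y + sc a z" and y: "y \<in> K" using a by (simp_all add: y_def)
    have "\<rho> x v - (lam y + a * c) *s v = (\<rho> y v - lam y *s v) + a *s (\<rho> z v - c *s v)"
      unfolding xy by (simp add: l.add l.scale algebra_simps)
    also have "\<dots> \<in> U" using v y U by (simp add: W_def subspace_add subspace_scale)
    finally show ?thesis by blast
  qed
  then obtain lam' where "\<And>x. x \<in> L \<Longrightarrow> \<rho> x v - lam' x *s v \<in> U" by metis
  then show ?case unfolding L_def[symmetric] using v vV by blast
qed

end

subsection \<open>Generalized eigenspaces\<close>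

context alg_closed_vector_space
begin

abbreviation endo :: "('v \<Rightarrow> 'v) \<Rightarrow> bool" where
  "endo \<equiv> Vector_Spaces.linear scale scale"

lemma endoD:
  assumes "endo f"
  shows "f (x + y) = f x + f y" "f (x - y) = f x - f y" "f (c *s x) = c *s f x" "f 0 = 0"
    "f (- x) = - f x" "f (sum u I) = (\<Sum>i\<in>I. f (u i))"
proof -
  interpret Vector_Spaces.linear scale scale f by fact
  show "f (x + y) = f x + f y" "f (x - y) = f x - f y" "f (c *s x) = c *s f x" "f 0 = 0"
    "f (- x) = - f x" "f (sum u I) = (\<Sum>i\<in>I. f (u i))"
    by (rule add diff scale zero neg sum)+
qed

lemma endoI:
  assumes "\<And>x y. f (x + y) = f x + f y" "\<And>c x. f (c *s x) = c *s f x"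
  shows "endo f"
  by (rule Vector_Spaces.linear.intro) (unfold_locales, auto simp: assms module_hom_axioms_def)

lemma endo_linear_between: "endo f \<Longrightarrow> f ` V \<subseteq> V \<Longrightarrow> linear_between scale scale V V f"
  by (auto simp: linear_between_def endoD)

lemma endo_vimage: "endo f \<Longrightarrow> subspace S \<Longrightarrow> subspace {x. f x \<in> S}"
  by (rule subspaceI) (auto simp: endoD subspace_0 subspace_add subspace_scale)

definition shift :: "('v \<Rightarrow> 'v) \<Rightarrow> 'k \<Rightarrow> 'v \<Rightarrow> 'v" where
  "shift f c x = f x - c *s x"

definition geig :: "('v \<Rightarrow> 'v) \<Rightarrow> 'k \<Rightarrow> 'v set" where
  "geig f c = {x. \<exists>n. (shift f c ^^ n) x = 0}"

lemma endo_shift: "endo f \<Longrightarrow> endo (shift f c)"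
  by (rule endoI) (auto simp: shift_def endoD algebra_simps)

lemma endo_funpow: "endo f \<Longrightarrow> endo (f ^^ n)"
  by (rule endoI; induction n) (auto simp: endoD)

lemma funpow_0_mono:
  assumes "endo f" "(f ^^ n) x = 0" "n \<le> m"
  shows "(f ^^ m) x = 0"
proof -
  have "(f ^^ m) x = (f ^^ (m - n)) ((f ^^ n) x)"
    using assms(3) by (metis comp_apply funpow_add le_add_diff_inverse2)
  then show ?thesis using assms endoD(4)[OF endo_funpow] by simp
qed

lemma subspace_geig:
  assumes "endo f"
  shows "subspace (geig f c)"
proof (rule subspaceI)
  note s = endo_shift[OF assms, of c]
  note l = endoD[OF endo_funpow[OF s]]
  show "0 \<in> geig f c" by (auto simp: geig_def l)
  show "x + y \<in> geig f c" if xy: "x \<in> geig f c" "y \<in> geig f c" for x y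
  proof -
    obtain n m where n: "(shift f c ^^ n) x = 0" "(shift f c ^^ m) y = 0"
      using xy by (auto simp: geig_def)
    have "(shift f c ^^ max n m) (x + y) = 0"
      using funpow_0_mono[OF s n(1), of "max n m"] funpow_0_mono[OF s n(2), of "max n m"] l by simp
    then show ?thesis by (auto simp: geig_def)
  qed
  show "a *s x \<in> geig f c" if "x \<in> geig f c" for a x
    using that by (auto simp: geig_def l)
qed

lemma funpow_commute_apply:
  "(\<And>x. g (f x) = f (g x)) \<Longrightarrow> g ((f ^^ n) x) = (f ^^ n) (g x)"
  by (induction n) auto

lemma geig_commute:
  assumes "endo g" "\<And>x. g (f x) = f (g x)" "x \<in> geig f c"
  shows "g x \<in> geig f c"
proof -
  obtain n where "(shift f c ^^ n) x = 0" using assms(3) by (auto simp: geig_def)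
  moreover have "g (shift f c x) = shift f c (g x)" for x
    by (simp add: shift_def endoD[OF assms(1)] assms(2))
  ultimately show ?thesis
    using funpow_commute_apply[of g "shift f c" n x] endoD(4)[OF assms(1)]
    by (auto simp: geig_def)
qed

lemma geig_invariant: "endo f \<Longrightarrow> x \<in> geig f c \<Longrightarrow> f x \<in> geig f c"
  by (rule geig_commute[where f = f]) auto

lemma geig_shiftI: "shift f c x \<in> geig f c \<Longrightarrow> x \<in> geig f c"
  unfolding geig_def by simp (metis funpow_simps_right(2) comp_apply)

lemma shift_funpow_eigenvector:
  assumes "endo f" "f x = d *s x"
  shows "(shift f c ^^ n) x = (d - c) ^ n *s x"
  by (induction n) (auto simp: shift_def assms endoD[OF assms(1)] algebra_simps)

lemma eigenvector_geig:
  assumes "endo f" "f x = d *s x" "x \<noteq> 0" "x \<in> geig f c"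
  shows "d = c"
  using assms shift_funpow_eigenvector[OF assms(1,2)] by (auto simp: geig_def)

text \<open>Applying \<open>shift f d\<close> repeatedly to a nonzero common element would end in a
  genuine \<open>d\<close>-eigenvector inside \<open>geig f c\<close>, which
  \<open>eigenvector_geig\<close> excludes.\<close>

lemma geig_disjoint:
  assumes f: "endo f" and "c \<noteq> d" "x \<in> geig f c" "x \<in> geig f d"
  shows "x = 0"
proof -
  have "(shift f d ^^ m) x = 0 \<Longrightarrow> x \<in> geig f c \<Longrightarrow> x = 0" for m x
  proof (induction m arbitrary: x)
    case (Suc m)
    have "(shift f d ^^ m) (shift f d x) = 0"
      using Suc.prems(1) by (simp add: funpow_swap1)
    moreover have "shift f d x \<in> geig f c"
      using Suc.prems(2) f subspace_geig[OF f]
      by (auto simp: shift_def intro!: subspace_diff geig_invariant subspace_scale)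
    ultimately have "shift f d x = 0" by (rule Suc.IH)
    then have "f x = d *s x" by (simp add: shift_def)
    then show ?case using eigenvector_geig[OF f _ _ Suc.prems(2)] assms(2) by blast
  qed simp
  then show ?thesis using assms by (auto simp: geig_def)
qed

text \<open>The power of \<open>shift f e\<close> that kills \<open>y e\<close> preserves the other
  generalized eigenspaces, so induction applies to the images. A summand that is killed as well lies
  in two generalized eigenspaces and is 0.\<close>

lemma geig_independent:
  assumes f: "endo f" and F: "finite F"
  shows "(\<And>d. d \<in> F \<Longrightarrow> y d \<in> geig f d) \<Longrightarrow> (\<Sum>d\<in>F. y d) = 0 \<Longrightarrow> d \<in> F \<Longrightarrow> y d = 0"
  using F
proof (induction F arbitrary: y d)
  case (insert e F)
  obtain n where n: "(shift f e ^^ n) (y e) = 0" using insert.prems(1)[of e] by (auto simp: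
      geig_def)
  define g where "g = shift f e ^^ n"
  have g: "endo g" unfolding g_def by (intro endo_funpow endo_shift f)
  have gf: "g (f x) = f (g x)" for x
    unfolding g_def by (rule funpow_commute_apply[symmetric]) (simp add: shift_def endoD[OF f])
  have "g (\<Sum>d\<in>insert e F. y d) = 0" using insert.prems(2) endoD(4)[OF g] by simp
  then have "(\<Sum>d\<in>F. g (y d)) = 0"
    using insert.hyps n[folded g_def] by (simp add: endoD[OF g])
  moreover have "g (y d) \<in> geig f d" if "d \<in> F" for d
    using insert.prems(1) that by (intro geig_commute[where f = f, OF g]) (auto simp: gf)
  ultimately have "g (y d) = 0" if "d \<in> F" for d using insert.IH[of "\<lambda>d. g (y d)"] that by blast
  then have "y d \<in> geig f e" if "d \<in> F" for d using that unfolding g_def geig_def by blast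
  then have y0: "y d = 0" if "d \<in> F" for d
    using geig_disjoint[OF f, of e d] insert.prems(1) insert.hyps that by blast
  then have "y e = 0" using insert.prems(2) insert.hyps by simp
  then show ?case using y0 insert.prems(3) by auto
qed simp

text \<open>On this space \<open>shift f c\<close> is the nonzero scalar \<open>d - c\<close> plus a
  nilpotent map. The preimage is built by induction on the exponent that kills
  \<open>x\<close>.\<close>

lemma shift_surj_geig:
  assumes f: "endo f" and V: "subspace V" "f ` V \<subseteq> V" and "c \<noteq> d" and x: "x \<in> geig f d \<inter> V"
  shows "\<exists>u \<in> geig f d \<inter> V. x = shift f c u"
proof -
  have "(shift f d ^^ n) x = 0 \<Longrightarrow> x \<in> geig f d \<inter> V \<Longrightarrow> \<exists>u \<in> geig f d \<inter> V. x = shift f c u" for n x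
  proof (induction n arbitrary: x)
    case 0
    then show ?case using endoD(4)[OF endo_shift[OF f]] by auto
  next
    case (Suc n)
    have GV: "subspace (geig f d \<inter> V)" by (intro subspace_inter subspace_geig f V)
    have "shift f d x \<in> geig f d \<inter> V"
      using Suc.prems(2) geig_invariant[OF f] V subspace_diff[OF GV] subspace_scale[OF GV]
      unfolding shift_def by blast
    then obtain u where u: "u \<in> geig f d \<inter> V" "shift f d x = shift f c u"
      using Suc.IH[of "shift f d x"] Suc.prems(1) by (auto simp: funpow_swap1)
    have "shift f c (x - u) = (d - c) *s x"
      using u(2) by (simp add: endoD[OF endo_shift[OF f]]) (simp add: shift_def algebra_simps)
    then have "x = shift f c (inverse (d - c) *s (x - u))"
      using assms(4) by (simp add: endoD(3)[OF endo_shift[OF f]])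
    moreover have "inverse (d - c) *s (x - u) \<in> geig f d \<inter> V"
      using u Suc.prems(2) by (intro subspace_scale[OF GV] subspace_diff[OF GV])
    ultimately show ?case by blast
  qed
  then show ?thesis using x by (auto simp: geig_def)
qed

end

locale alg_closed_fd_vector_space =
  alg_closed_vector_space scale + finite_dimensional_vector_space scale Basis
  for scale :: "'k::{alg_closed_field, field_char_0} \<Rightarrow> 'v::ab_group_add \<Rightarrow> 'v" (infixr "*s" 75)
    and Basis
begin

text \<open>For an eigenvalue \<open>c\<close> the image \<open>W\<close> of
  \<open>shift f c\<close> is a smaller invariant subspace and decomposes by induction. Lifting this
  decomposition back along \<open>shift f c\<close> costs only an element of
  \<open>geig f c\<close>.\<close>

lemma geig_decomposition:
  assumes f: "endo f"
  shows "subspace V \<Longrightarrow> f ` V \<subseteq> V \<Longrightarrow> V \<subseteq> span (\<Union>d. geig f d \<inter> V)"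
proof (induction "dim V" arbitrary: V rule: less_induct)
  case less
  show ?case
  proof (cases "V = {0}")
    case True
    then show ?thesis by (simp add: span_zero)
  next
    case False
    have "linear_between scale scale V V f" using f less.prems by (simp add: endo_linear_between)
    then have "\<exists>v\<in>V - {0}. \<exists>c. f v - c *s v \<in> {0}"
      using relative_eigenvector[of V f "{0}" Basis] less.prems False finite_Basis span_Basis
        subspace_0[OF less.prems(1)] by auto
    then obtain v c where v: "v \<in> V" "v \<noteq> 0" "shift f c v = 0" by (auto simp: shift_def)
    note s = endo_shift[OF f, of c]
    define W where "W = shift f c ` V"
    have W: "subspace W"
      unfolding W_def using less.prems(1) s by (rule module_hom.subspace_image[OF
          module_hom_linearI, rotated])
    have WV: "W \<subseteq> V" unfolding W_def shift_def using less.prems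
      by (auto intro!: subspace_diff subspace_scale)
    have fW: "f ` W \<subseteq> W"
    proof -
      have "f (shift f c x) = shift f c (f x)" for x by (simp add: shift_def endoD[OF f])
      then show ?thesis unfolding W_def using less.prems(2) by auto
    qed
    \<comment> \<open>If the shift were onto, it would map a basis of \<open>V\<close> injectively
      to an independent spanning set and hence be injective, contrary to the eigenvector
      \<open>v\<close>.\<close>
    have "W \<noteq> V"
    proof
      assume "W = V"
      obtain B where B: "B \<subseteq> V" "independent B" "V \<subseteq> span B" "card B = dim V"
        using basis_exists by blast
      have "V \<subseteq> span (shift f c ` B)"
        using \<open>W = V\<close> B(3) unfolding W_def
        by (metis image_mono module_hom.span_image[OF module_hom_linearI[OF s]])
      then have "dim V \<le> card (shift f c ` B)"
        using dim_le_card finiteI_independent[OF B(2)] by blast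
      then have inj: "inj_on (shift f c) B" and "card (shift f c ` B) = dim V"
        using B(4) finiteI_independent[OF B(2)] card_image_le[of B "shift f c"]
        by (auto intro: eq_card_imp_inj_on)
      then have "independent (shift f c ` B)"
        using \<open>V \<subseteq> span (shift f c ` B)\<close> WV B(1) finiteI_independent[OF B(2)]
        by (intro card_le_dim_spanning[of _ V]) (auto simp: W_def)
      then have "inj_on (shift f c) (span B)"
        using module_hom.inj_on_span_iff_independent_image[OF module_hom_linearI[OF s]] inj by blast
      then have "v = 0" using v B(3) endoD(4)[OF s] span_zero[of B] unfolding inj_on_def
        by (metis subsetD)
      then show False using v by simp
    qed
    then have "dim W < dim V" using WV W less.prems(1) by (metis dim_psubset span_eq_iff psubsetI)
    then have IH: "W \<subseteq> span (\<Union>d. geig f d \<inter> W)" by (rule less.hyps[OF _ W fW])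
    define P where "P = span (\<Union>d. geig f d \<inter> V)"
    have P: "subspace P" by (simp add: P_def)
    have GP: "geig f d \<inter> V \<subseteq> P" for d unfolding P_def by (meson UN_upper UNIV_I span_superset
        subset_trans)
    have PV: "P \<subseteq> V" unfolding P_def by (rule span_minimal) (use less.prems in auto)
    \<comment> \<open>Away from \<open>c\<close> the shift is onto the generalized eigenspaces; the
      part belonging to \<open>c\<close> is collected in \<open>e\<close>.\<close>
    have split: "\<exists>u\<in>P. \<exists>e\<in>geig f c \<inter> V. w = shift f c u + e" if "w \<in> P" for w
      using that unfolding P_def
    proof (induction w rule: span_induct_alt)
      case base
      show ?case using span_zero subspace_0[OF subspace_geig[OF f]] subspace_0[OF less.prems(1)]
          endoD(4)[OF s] by (intro bexI[of _ 0]) auto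
    next
      case (step a x y)
      obtain u e where ue: "u \<in> span (\<Union>d. geig f d \<inter> V)" "e \<in> geig f c \<inter> V" "y = shift f c u + e"
        using step by blast
      obtain d where d: "x \<in> geig f d \<inter> V" using step by blast
      have GV: "subspace (geig f c \<inter> V)" by (intro subspace_inter subspace_geig f less.prems)
      show ?case
      proof (cases "d = c")
        case True
        have "a *s x + y = shift f c u + (a *s x + e)" by (simp add: ue(3))
        moreover have "a *s x + e \<in> geig f c \<inter> V"
          using ue(2) d True by (metis subspace_add[OF GV] subspace_scale[OF GV])
        ultimately show ?thesis using ue(1) by blast
      next
        case False
        obtain w where w: "w \<in> geig f d \<inter> V" "x = shift f c w"
          using shift_surj_geig[OF f less.prems, of c d x] d False by blast
        have "a *s x + y = shift f c (a *s w + u) + e"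
          by (simp add: ue(3) w(2) endoD[OF s])
        moreover have "a *s w + u \<in> span (\<Union>d. geig f d \<inter> V)"
          using w ue by (blast intro: span_add span_scale span_base)
        ultimately show ?thesis using ue(2) by blast
      qed
    qed
    show ?thesis
    proof
      fix v assume v: "v \<in> V"
      have "shift f c v \<in> P"
        using IH span_mono[of "\<Union>d. geig f d \<inter> W" "\<Union>d. geig f d \<inter> V"] WV v
        unfolding W_def P_def by blast
      then obtain u e where ue: "u \<in> P" "e \<in> geig f c \<inter> V" "shift f c v = shift f c u + e"
        using split by blast
      then have "shift f c (v - u) = e" by (simp add: endoD[OF s])
      then have "v - u \<in> geig f c \<inter> V"
        using ue v PV less.prems(1) by (auto intro!: geig_shiftI subspace_diff)
      then have "v - u + u \<in> P" using GP ue(1) P by (blast intro: subspace_add)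
      then show "v \<in> span (\<Union>d. geig f d \<inter> V)" by (simp add: P_def)
    qed
  qed
qed

text \<open>The maps need not commute; mutual stability of their generalized eigenspaces is what a
  nilpotent Lie algebra of operators provides. Either each map has a single generalized eigenvalue
  on \<open>V\<close>, or one of them splits \<open>V\<close> into smaller invariant pieces.\<close>

lemma weight_decomposition:
  fixes T :: "'i \<Rightarrow> 'v \<Rightarrow> 'v"
  assumes T: "\<And>i. i \<in> I \<Longrightarrow> endo (T i)"
    and inv: "\<And>i j c x. i \<in> I \<Longrightarrow> j \<in> I \<Longrightarrow> x \<in> geig (T i) c \<Longrightarrow> T j x \<in> geig (T i) c"
  shows "subspace V \<Longrightarrow> (\<And>i. i \<in> I \<Longrightarrow> T i ` V \<subseteq> V) \<Longrightarrow>
    V \<subseteq> span (\<Union>\<alpha>. {x \<in> V. \<forall>i\<in>I. x \<in> geig (T i) (\<alpha> i)})"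
proof (induction "dim V" arbitrary: V rule: less_induct)
  case less
  show ?case
  proof (cases "\<forall>i\<in>I. \<exists>c. V \<subseteq> geig (T i) c")
    case True
    then obtain \<alpha> where "\<And>i. i \<in> I \<Longrightarrow> V \<subseteq> geig (T i) (\<alpha> i)" by metis
    then have "V \<subseteq> (\<Union>\<alpha>. {x \<in> V. \<forall>i\<in>I. x \<in> geig (T i) (\<alpha> i)})" by blast
    then show ?thesis using span_superset by blast
  next
    case False
    then obtain i where i: "i \<in> I" "\<And>c. \<not> V \<subseteq> geig (T i) c" by blast
    let ?R = "span (\<Union>\<alpha>. {x \<in> V. \<forall>i\<in>I. x \<in> geig (T i) (\<alpha> i)})"
    have "geig (T i) c \<inter> V \<subseteq> ?R" for c
    proof -
      define W where "W = geig (T i) c \<inter> V"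
      have W: "subspace W" unfolding W_def by (intro subspace_inter subspace_geig T i less.prems)
      have "W \<subset> V" using i(2)[of c] by (auto simp: W_def)
      then have "dim W < dim V" using W less.prems(1) by (metis dim_psubset span_eq_iff)
      moreover have "T j ` W \<subseteq> W" if "j \<in> I" for j
        using inv[OF i(1) that] less.prems(2)[OF that] by (auto simp: W_def)
      ultimately have "W \<subseteq> span (\<Union>\<alpha>. {x \<in> W. \<forall>i\<in>I. x \<in> geig (T i) (\<alpha> i)})"
        using less.hyps W by blast
      also have "\<dots> \<subseteq> ?R" using \<open>W \<subset> V\<close> by (intro span_mono) blast
      finally show ?thesis by (simp add: W_def)
    qed
    then have "span (\<Union>c. geig (T i) c \<inter> V) \<subseteq> ?R" by (intro span_minimal) auto
    then show ?thesis
      using geig_decomposition[OF T[OF i(1)] less.prems(1) less.prems(2)[OF i(1)]] by blast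
  qed
qed

end

subsection \<open>Semisimple parts\<close>

context alg_closed_fd_vector_space
begin

lemma endo_eq_on_span:
  assumes "endo f" "endo g" "\<And>b. b \<in> B \<Longrightarrow> f b = g b" "x \<in> span B"
  shows "f x = g x"
  using assms(4)
  by (induction rule: span_induct_alt) (auto simp: endoD[OF assms(1)] endoD[OF assms(2)] assms(3))

text \<open>The eigenvalues are an explicit argument: linearity of semisimple parts in the Lie
  algebra element is later read off from linearity of \<open>diag\<close> in
  \<open>c\<close>.\<close>

definition diag :: "'v set \<Rightarrow> ('v \<Rightarrow> 'k) \<Rightarrow> 'v \<Rightarrow> 'v" where
  "diag B c x = (\<Sum>b\<in>B. (representation B x b * c b) *s b)"

context
  fixes B :: "'v set"
  assumes B: "independent B" "span B = UNIV"
begin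

lemma finite_basis: "finite B"
  using B finiteI_independent by blast

lemma representation_sum: "(\<Sum>b\<in>B. representation B x b *s b) = x"
  using sum_representation_eq[of B x B] B finite_basis by simp

lemma endo_diag: "endo (diag B c)"
  by (rule endoI)
     (simp_all add: diag_def representation_add[OF B(1)] representation_scale[OF B(1)] B(2)
       algebra_simps sum.distrib scale_sum_right)

lemma diag_basis:
  assumes "b \<in> B"
  shows "diag B c b = c b *s b"
proof -
  have "diag B c b = (\<Sum>b'\<in>B. if b' = b then c b *s b else 0)"
    unfolding diag_def by (rule sum.cong) (auto simp: representation_basis[OF B(1) assms])
  then show ?thesis using assms finite_basis by simp
qed

lemma diag_add: "diag B (\<lambda>b. c b + d b) x = diag B c x + diag B d x"
  by (simp add: diag_def algebra_simps sum.distrib)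

lemma diag_scale: "diag B (\<lambda>b. a * c b) x = a *s diag B c x"
  by (simp add: diag_def algebra_simps scale_sum_right)

lemma diag_cong: "(\<And>b. b \<in> B \<Longrightarrow> c b = d b) \<Longrightarrow> diag B c x = diag B d x"
  by (simp add: diag_def)

lemma diag_comm: "diag B c (diag B d x) = diag B d (diag B c x)"
proof (rule endo_eq_on_span[where f = "\<lambda>x. diag B c (diag B d x)" and x = x and B = B])
  show "endo (\<lambda>x. diag B c (diag B d x))" "endo (\<lambda>x. diag B d (diag B c x))"
    by (rule endoI; simp add: endoD[OF endo_diag])+
  show "diag B c (diag B d b) = diag B d (diag B c b)" if "b \<in> B" for b
    using that by (simp add: diag_basis endoD[OF endo_diag] mult.commute)
qed (simp add: B)

context
  fixes f :: "'v \<Rightarrow> 'v" and c :: "'v \<Rightarrow> 'k"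
  assumes f: "endo f" and gB: "\<And>b. b \<in> B \<Longrightarrow> b \<in> geig f (c b)"
begin

text \<open>Grouping the coordinates of \<open>x\<close> by eigenvalue writes it as a sum over
  generalized eigenspaces, and by \<open>geig_independent\<close> only the part for \<open>e\<close>
  survives. Thus \<open>diag\<close> is scalar on all of \<open>geig f e\<close>, whatever adapted
  basis is used.\<close>

lemma diag_geig:
  assumes x: "x \<in> geig f e"
  shows "diag B c x = e *s x"
proof -
  \<comment> \<open>\<open>e\<close> is inserted because it may fail to occur among the eigenvalues
    of basis vectors, in which case the argument gives \<open>x = 0\<close>.\<close>
  define F where "F = insert e (c ` B)"
  define u where "u = (\<lambda>d. \<Sum>b | b \<in> B \<and> c b = d. representation B x b *s b)"
  define y where "y = (\<lambda>d. u d - (if d = e then x else 0))"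
  have F: "finite F" "e \<in> F" "c ` B \<subseteq> F" using finite_basis by (auto simp: F_def)
  have "u d \<in> geig f d" for d
    unfolding u_def by (rule subspace_sum[OF subspace_geig[OF f]])
      (use gB in \<open>auto intro: subspace_scale[OF subspace_geig[OF f]]\<close>)
  then have yg: "y d \<in> geig f d" for d
    using x unfolding y_def by (auto intro: subspace_diff[OF subspace_geig[OF f]])
  have "(\<Sum>d\<in>F. u d) = x"
    unfolding u_def using sum.group[OF finite_basis F(1,3), of "\<lambda>b. representation B x b *s b"]
    by (simp add: representation_sum)
  then have "(\<Sum>d\<in>F. y d) = 0"
    using F by (simp add: y_def sum_subtractf)
  then have "y d = 0" if "d \<in> F" for d
    using geig_independent[OF f F(1) yg _ that] by blast
  then have u: "u d = (if d = e then x else 0)" if "d \<in> F" for d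
    using that by (auto simp: y_def)
  have "diag B c x = (\<Sum>d\<in>F. \<Sum>b | b \<in> B \<and> c b = d. (representation B x b * c b) *s b)"
    unfolding diag_def using sum.group[OF finite_basis F(1,3), of "\<lambda>b. (representation B x b * c
        b) *s b"]
    by simp
  also have "\<dots> = (\<Sum>d\<in>F. d *s u d)"
    unfolding u_def scale_sum_right by (intro sum.cong) (auto simp: mult.commute)
  also have "\<dots> = (\<Sum>d\<in>F. if d = e then e *s x else 0)"
    by (rule sum.cong) (auto simp: u)
  also have "\<dots> = e *s x" using F by simp
  finally show ?thesis .
qed

lemma diag_commute: "f (diag B c x) = diag B c (f x)"
proof (rule endo_eq_on_span[where f = "\<lambda>x. f (diag B c x)" and x = x and B = B])
  show "endo (\<lambda>x. f (diag B c x))" "endo (\<lambda>x. diag B c (f x))"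
    by (rule endoI; simp add: endoD[OF endo_diag] endoD[OF f])+
  show "f (diag B c b) = diag B c (f b)" if "b \<in> B" for b
    using that diag_geig[OF geig_invariant[OF f gB[OF that]]] by (simp add: diag_basis endoD[OF f])
qed (simp add: B)

text \<open>On each generalized eigenspace the difference coincides with the corresponding shift;
  finiteness of the basis gives a common exponent.\<close>

lemma nilpotent_minus_diag: "nilpotent_endo scale (\<lambda>x. f x - diag B c x)"
proof -
  define g where "g = (\<lambda>x. f x - diag B c x)"
  have g: "endo g" unfolding g_def
    by (rule endoI) (simp_all add: endoD[OF endo_diag] endoD[OF f] algebra_simps)
  have "\<exists>n. (g ^^ n) b = 0" if b: "b \<in> B" for b
  proof -
    have "(g ^^ n) b = (shift f (c b) ^^ n) b \<and> (g ^^ n) b \<in> geig f (c b)" for n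
    proof (induction n)
      case (Suc n)
      then have "diag B c ((g ^^ n) b) = c b *s (g ^^ n) b" by (intro diag_geig) blast
      then have "g ((g ^^ n) b) = shift f (c b) ((g ^^ n) b)"
        unfolding shift_def by (subst g_def) simp
      moreover have "shift f (c b) z \<in> geig f (c b)" if "z \<in> geig f (c b)" for z
        unfolding shift_def using that
        by (intro subspace_diff[OF subspace_geig[OF f]] subspace_scale[OF subspace_geig[OF f]]
            geig_invariant f)
      ultimately show ?case using Suc by (metis funpow.simps(2) comp_apply)
    qed (use gB b in auto)
    then show ?thesis using gB[OF b] by (auto simp: geig_def)
  qed
  then obtain n where n: "\<And>b. b \<in> B \<Longrightarrow> (g ^^ n b) b = 0" by metis
  define m where "m = Max (n ` B)"
  have m: "(g ^^ m) b = 0" if "b \<in> B" for b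
    using funpow_0_mono[OF g n[OF that]] that finite_basis by (simp add: m_def)
  have "(g ^^ m) x = 0" for x
    by (rule endo_eq_on_span[where f = "g ^^ m" and g = "\<lambda>_. 0" and B = B])
       (auto simp: B m endo_funpow[OF g] intro: endoI)
  then show ?thesis unfolding nilpotent_endo_def g_def[symmetric] using g by blast
qed

text \<open>A basis of \<open>U\<close> can be completed by members of \<open>B\<close>. These are
  eigenvectors, so they span an invariant complement.\<close>

lemma semisimple_diag: "semisimple_endo scale (diag B c)"
  unfolding semisimple_endo_def
proof (intro conjI allI impI)
  fix U assume U: "subspace U \<and> diag B c ` U \<subseteq> U"
  obtain BU where BU: "BU \<subseteq> U" "independent BU" "U \<subseteq> span BU"
    using maximal_independent_subset by blast
  obtain B' where B': "BU \<subseteq> B'" "B' \<subseteq> BU \<union> B" "independent B'" "BU \<union> B \<subseteq> span B'"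
    using maximal_independent_subset_extend[of BU "BU \<union> B"] BU(2) by blast
  have spB': "span B' = UNIV"
    using B'(4) B(2) by (metis Un_subset_iff span_mono span_span top.extremum_uniqueI)
  have UB: "U = span BU" using BU U by (metis span_subspace)
  define W where "W = span (B' - BU)"
  have "diag B c ` W \<subseteq> W"
  proof -
    have "W \<subseteq> {x. diag B c x \<in> W}"
      unfolding W_def
    proof (rule span_minimal)
      have "diag B c b \<in> span (B' - BU)" if "b \<in> B' - BU" for b
        using that B'(2) by (subst diag_basis) (auto simp: subset_iff intro: span_scale span_base)
      then show "B' - BU \<subseteq> {x. diag B c x \<in> span (B' - BU)}" by blast
    qed (intro endo_vimage endo_diag subspace_span)
    then show ?thesis by blast
  qed
  moreover have "U \<inter> W = {0}"
  proof -
    have "x = 0" if "x \<in> span BU" "x \<in> span (B' - BU)" for x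
    proof -
      have r: "representation B' x = representation BU x"
        "representation B' x = representation (B' - BU) x"
        by (rule representation_extend[OF B'(3)]; use that B'(1) in auto)+
      have "representation B' x b = 0" for b
        using representation_ne_zero[of BU x b] representation_ne_zero[of "B' - BU" x b] r
        by (metis DiffD2)
      then show ?thesis
        using sum_nonzero_representation_eq[OF B'(3), of x] spB' by simp
    qed
    then show ?thesis unfolding UB W_def using span_zero by auto
  qed
  moreover have "{u + w |u w. u \<in> U \<and> w \<in> W} = UNIV"
    unfolding UB W_def span_Un[symmetric] using B'(1) spB' by (simp add: Un_absorb1)
  ultimately show "\<exists>W. vs_complement scale U W \<and> diag B c ` W \<subseteq> W"
    unfolding vs_complement_def using U subspace_span W_def by blast
qed (rule endo_diag)

text \<open>An invariant complement to the span of the eigenvectors of \<open>s\<close> would itself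
  contain an eigenvector if it were nonzero, so \<open>s\<close> is diagonalizable. On a
  \<open>d\<close>-eigenvector of \<open>s\<close> the powers of \<open>shift f d\<close> are those
  of \<open>n\<close>; it therefore lies in \<open>geig f d\<close>, where \<open>diag\<close> is
  \<open>d\<close> as well.\<close>

lemma semisimple_part_unique:
  assumes s: "semisimple_endo scale s" and n: "nilpotent_endo scale n" and sn: "s \<circ> n = n \<circ> s"
    and fsn: "\<And>x. f x = s x + n x"
  shows "s = diag B c"
proof -
  have s1: "endo s" and n1: "endo n"
    using s n by (auto simp: semisimple_endo_def nilpotent_endo_def)
  have sn': "s (n x) = n (s x)" for x using sn by (metis comp_apply)
  define E where "E = {x. \<exists>d. s x = d *s x}"
  have "s x \<in> span E" if x: "x \<in> E" for x
  proof -
    obtain d where "s x = d *s x" using x by (auto simp: E_def)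
    then show ?thesis using x by (simp add: span_scale span_base)
  qed
  then have "span E \<subseteq> {x. s x \<in> span E}"
    by (intro span_minimal endo_vimage[OF s1]) auto
  then have "\<exists>W. vs_complement scale (span E) W \<and> s ` W \<subseteq> W"
    using s unfolding semisimple_endo_def by blast
  then obtain W where W: "vs_complement scale (span E) W" "s ` W \<subseteq> W" by blast
  have sW: "subspace W" "span E \<inter> W = {0}" "{u + w |u w. u \<in> span E \<and> w \<in> W} = UNIV"
    using W by (auto simp: vs_complement_def)
  have "W = {0}"
  proof (rule ccontr)
    assume "W \<noteq> {0}"
    then obtain v d where v: "v \<in> W" "v \<noteq> 0" "s v - d *s v = 0"
      using relative_eigenvector[of W s "{0}" Basis] sW(1) endo_linear_between[OF s1 W(2)]
        finite_Basis span_Basis subspace_0[OF sW(1)] by auto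
    then have "v \<in> span E" by (intro span_base) (auto simp: E_def)
    then show False using v sW(2) by blast
  qed
  then have EU: "span E = UNIV" using sW(3) by auto
  have "s x = diag B c x" if x: "x \<in> E" for x
  proof -
    obtain d where d: "s x = d *s x" using x by (auto simp: E_def)
    have "(shift f d ^^ k) x = (n ^^ k) x \<and> s ((n ^^ k) x) = d *s (n ^^ k) x" for k
      by (induction k) (auto simp: d shift_def fsn sn' endoD[OF n1])
    moreover obtain k where "(n ^^ k) x = 0" using n by (auto simp: nilpotent_endo_def)
    ultimately have "x \<in> geig f d" by (auto simp: geig_def)
    then show ?thesis using diag_geig d by simp
  qed
  then show ?thesis
    using endo_eq_on_span[OF s1 endo_diag, of E] EU by blast
qed

lemma semisimple_part_diag: "semisimple_part scale f = diag B c"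
  unfolding semisimple_part_def
proof (rule the_equality)
  have "diag B c \<circ> (\<lambda>x. f x - diag B c x) = (\<lambda>x. f x - diag B c x) \<circ> diag B c"
    by (rule ext) (simp add: endoD[OF endo_diag] diag_commute)
  then show "semisimple_endo scale (diag B c) \<and>
    (\<exists>n. nilpotent_endo scale n \<and> diag B c \<circ> n = n \<circ> diag B c \<and> (\<forall>x. f x = diag B c x + n x))"
    using semisimple_diag nilpotent_minus_diag
    by (intro conjI exI[of _ "\<lambda>x. f x - diag B c x"]) auto
qed (use semisimple_part_unique in blast)

end

end

text \<open>\<open>shift f (c + d)\<close> obeys a Leibniz rule with \<open>shift f c\<close> on the
  first and \<open>shift f d\<close> on the second factor, so it lowers the sum of the two
  exponents.\<close>

lemma geig_bilinear:
  assumes m: "m \<in> alt_bilinear scale" and f: "endo f"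
    and der: "\<And>x y. f (m x y) = m (f x) y + m x (f y)"
    and x: "x \<in> geig f c" and y: "y \<in> geig f d"
  shows "m x y \<in> geig f (c + d)"
proof -
  obtain i j where ij: "(shift f c ^^ i) x = 0" "(shift f d ^^ j) y = 0"
    using x y by (auto simp: geig_def)
  have G: "subspace (geig f (c + d))" by (rule subspace_geig[OF f])
  have "(shift f c ^^ i) x = 0 \<Longrightarrow> (shift f d ^^ j) y = 0 \<Longrightarrow> k = i + j \<Longrightarrow> m x y \<in> geig f (c + d)"
    for k i j x y
  proof (induction k arbitrary: i j x y)
    case 0
    then show ?case using subspace_0[OF G] by (simp add: alt_bilinearD[OF m])
  next
    case (Suc k)
    show ?case
    proof (cases "i = 0 \<or> j = 0")
      case True
      then have "m x y = 0" using Suc.prems by (auto simp: alt_bilinearD[OF m])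
      then show ?thesis using subspace_0[OF G] by simp
    next
      case False
      then obtain i' j' where "i = Suc i'" "j = Suc j'"
        by (meson not0_implies_Suc)
      have "(shift f c ^^ i') (shift f c x) = 0" "(shift f d ^^ j') (shift f d y) = 0"
        using Suc.prems(1,2) by (simp_all only: \<open>i = Suc i'\<close> \<open>j = Suc j'\<close> funpow_Suc_right
            comp_apply)
      then have "m (shift f c x) y \<in> geig f (c + d)" "m x (shift f d y) \<in> geig f (c + d)"
        using Suc.IH[of i' "shift f c x" j y] Suc.IH[of i x j' "shift f d y"] Suc.prems
          \<open>i = Suc i'\<close> \<open>j = Suc j'\<close>
        by simp_all
      moreover have "shift f (c + d) (m x y) = m (shift f c x) y + m x (shift f d y)"
        by (simp add: shift_def der alt_bilinearD[OF m] algebra_simps)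
      ultimately show ?thesis by (metis geig_shiftI subspace_add[OF G])
    qed
  qed
  then show ?thesis using ij by blast
qed

text \<open>By bilinearity it suffices to test basis vectors \<open>b\<close> and \<open>b'\<close>:
  there \<open>m b b'\<close> has generalized eigenvalue \<open>c b + c b'\<close>, on which
  \<open>diag\<close> is this scalar.\<close>

lemma diag_derivation:
  assumes B: "independent B" "span B = UNIV"
    and m: "m \<in> alt_bilinear scale" and f: "endo f"
    and der: "\<And>x y. f (m x y) = m (f x) y + m x (f y)"
    and gB: "\<And>b. b \<in> B \<Longrightarrow> b \<in> geig f (c b)"
  shows "diag B c (m x y) = m (diag B c x) y + m x (diag B c y)"
proof -
  note D = endoD[OF endo_diag[OF B]] and M = alt_bilinearD[OF m]
  have 1: "diag B c (m b y) = m (diag B c b) y + m b (diag B c y)" if b: "b \<in> B" for b y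
  proof (rule endo_eq_on_span[where f = "\<lambda>y. diag B c (m b y)" and x = y and B = B])
    show "endo (\<lambda>y. diag B c (m b y))" "endo (\<lambda>y. m (diag B c b) y + m b (diag B c y))"
      by (rule endoI; simp add: D M algebra_simps)+
    show "diag B c (m b b') = m (diag B c b) b' + m b (diag B c b')" if b': "b' \<in> B" for b'
      using diag_geig[OF B f gB geig_bilinear[OF m f der gB[OF b] gB[OF b']]] b b'
      by (simp add: diag_basis[OF B] M scale_left_distrib)
  qed (simp add: B)
  show ?thesis
  proof (rule endo_eq_on_span[where f = "\<lambda>x. diag B c (m x y)" and x = x and B = B])
    show "endo (\<lambda>x. diag B c (m x y))" "endo (\<lambda>x. m (diag B c x) y + m x (diag B c y))"
      by (rule endoI; simp add: D M algebra_simps)+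
  qed (use 1 B in auto)
qed

end

subsection \<open>Nilradical and weights\<close>

text \<open>Unlike in \<open>lower_central_series\<close>, the acting set and the starting set are
  independent. This allows the nilpotent action of a fixed ideal to be followed on a growing
  space.\<close>

primrec act_series ::
  "('k::field \<Rightarrow> 's::ab_group_add \<Rightarrow> 's) \<Rightarrow> ('s \<Rightarrow> 's \<Rightarrow> 's) \<Rightarrow> 's set \<Rightarrow> 's set \<Rightarrow> nat \<Rightarrow> 's set" where
  "act_series sc \<mu> I F 0 = F"
| "act_series sc \<mu> I F (Suc n) = lspan sc {\<mu> x y | x y. x \<in> I \<and> y \<in> act_series sc \<mu> I F n}"

context alg_closed_fd_vector_space
begin

text \<open>Brackets of \<open>L\<close> land in \<open>K\<close>, so every space between
  \<open>K\<close> and \<open>L\<close> is normalized by \<open>L\<close> and basis vectors can be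
  added in any order.\<close>

lemma lie_chain_extend:
  assumes K: "lie_chain scale m K" and KL: "K \<subseteq> L" and L: "subspace L"
    and br: "\<And>x y. x \<in> L \<Longrightarrow> y \<in> L \<Longrightarrow> m x y \<in> K"
  shows "lie_chain scale m L"
proof -
  obtain T where T: "T \<subseteq> L" "independent T" "L \<subseteq> span T"
    using maximal_independent_subset by blast
  have "T' \<subseteq> T \<Longrightarrow> lie_chain scale m (span (K \<union> T'))" if "finite T'" for T'
    using that
  proof (induction T' rule: finite_induct)
    case empty
    then show ?case
      using K lie_chain_subspace[OF vector_space_axioms K] by (simp add: span_eq_iff[THEN iffD2])
  next
    case (insert t F)
    have "span (K \<union> F) \<subseteq> L" using KL T(1) insert.prems L by (intro span_minimal) auto
    then have "m t k \<in> span (K \<union> F)" if "k \<in> span (K \<union> F)" for k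
      using br[of t k] that insert.prems T(1) by (blast intro: span_base)
    then have "lie_chain scale m (span (insert t (span (K \<union> F))))"
      using insert by (intro lie_chain.step) auto
    also have "span (insert t (span (K \<union> F))) = span (K \<union> insert t F)"
    proof
      show "span (insert t (span (K \<union> F))) \<subseteq> span (K \<union> insert t F)"
        using span_mono[of "K \<union> F" "K \<union> insert t F"] by (intro span_minimal) (auto intro: span_base)
      show "span (K \<union> insert t F) \<subseteq> span (insert t (span (K \<union> F)))"
        by (intro span_mono) (auto intro: span_base)
    qed
    finally show ?case .
  qed
  then have "lie_chain scale m (span (K \<union> T))" using finiteI_independent[OF T(2)] by blast
  also have "span (K \<union> T) = L"
    using T KL L by (metis Un_least Un_upper2 span_mono span_subspace subset_trans)
  finally show ?thesis .
qed

text \<open>The derived series, cut down to \<open>H\<close>, is climbed from the bottom: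
  \<open>k\<close> counts the steps above the zero term.\<close>

lemma solvable_lie_chain:
  assumes sol: "lie_solvable scale m" and H: "subspace H" "\<And>x y. x \<in> H \<Longrightarrow> y \<in> H \<Longrightarrow> m x y \<in> H"
  shows "lie_chain scale m H"
proof -
  let ?D = "derived_series scale m"
  obtain n where n: "?D n = {0}" using sol by (auto simp: lie_solvable_def)
  have sub: "subspace (?D i)" for i by (cases i) auto
  have dec: "?D (Suc i) \<subseteq> ?D i" for i
    by (induction i) (auto intro!: span_mono)
  have "k \<le> n \<Longrightarrow> lie_chain scale m (H \<inter> ?D (n - k))" for k
  proof (induction k)
    case 0
    have "H \<inter> ?D n = {0}" using n subspace_0[OF H(1)] by auto
    then show ?case by (simp add: lie_chain.zero)
  next
    case (Suc k)
    have e: "n - k = Suc (n - Suc k)" using Suc.prems by simp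
    show ?case
    proof (rule lie_chain_extend)
      show "lie_chain scale m (H \<inter> ?D (n - k))" using Suc by simp
      show "H \<inter> ?D (n - k) \<subseteq> H \<inter> ?D (n - Suc k)" unfolding e using dec by blast
      show "subspace (H \<inter> ?D (n - Suc k))" by (intro subspace_inter H sub)
      show "m x y \<in> H \<inter> ?D (n - k)" if "x \<in> H \<inter> ?D (n - Suc k)" "y \<in> H \<inter> ?D (n - Suc k)" for x y
        unfolding e using that H(2) by (auto intro!: span_base)
    qed
  qed
  from this[of n] show ?thesis by simp
qed

lemma lie_chain_cong:
  assumes "lie_chain scale m K" "K \<subseteq> N" "\<And>x y. x \<in> N \<Longrightarrow> y \<in> N \<Longrightarrow> m' x y = m x y"
  shows "lie_chain scale m' K"
  using assms(1,2)
proof (induction rule: lie_chain.induct)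
  case (step K z)
  have KN: "K \<subseteq> N" "z \<in> N" using step.prems span_superset by blast+
  show ?case
    by (rule lie_chain.step) (use step KN assms(3) in \<open>auto simp: subset_iff\<close>)
qed (rule lie_chain.zero)

end

locale fd_lie = alg_closed_fd_vector_space scale Basis
  for scale :: "'k::{alg_closed_field, field_char_0} \<Rightarrow> 'v::ab_group_add \<Rightarrow> 'v" (infixr "*s" 75)
    and Basis +
  fixes brk :: "'v \<Rightarrow> 'v \<Rightarrow> 'v"
  assumes lie: "lie_bracket scale brk"
begin

lemma brk_alt: "brk \<in> alt_bilinear scale"
  using lie by (simp add: lie_bracket_def)

lemmas brk = alt_bilinearD[OF brk_alt]

lemma brk_skew: "brk y x = - brk x y"
  by (rule alt_bilinear_skew[OF brk_alt])

lemma ad_derivation: "brk a (brk x y) = brk (brk a x) y + brk x (brk a y)"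
proof -
  have "brk a (brk x y) + brk x (brk y a) + brk y (brk a x) = 0"
    using lie by (simp add: lie_bracket_def)
  then show ?thesis
    unfolding brk_skew[of y a] brk_skew[of y "brk a x"]
    by (simp add: brk algebra_simps eq_neg_iff_add_eq_0)
qed

lemma brk_brk: "brk (brk x y) v = brk x (brk y v) - brk y (brk x v)"
  by (simp add: ad_derivation[of x y v])

text \<open>Take an ideal \<open>F\<close> of largest dimension on which \<open>I\<close> acts
  nilpotently. If it were proper, Lie's theorem would give a common eigenvector \<open>v\<close>
  modulo \<open>F\<close>; its character vanishes on brackets, and on \<open>A\<close> because
  \<open>ad A\<close> is nilpotent. Hence \<open>I\<close> maps \<open>v\<close> into
  \<open>F\<close>, and \<open>F\<close> could be enlarged by \<open>v\<close>.\<close>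

lemma nilpotent_ideal:
  assumes chain: "lie_chain scale brk UNIV" and A: "\<And>x. (brk A ^^ n) x = 0"
  defines "I \<equiv> span (insert A {brk x y | x y. True})"
  shows "lie_ideal scale brk I" "lie_nilpotent scale brk I"
proof -
  have brI: "brk x y \<in> I" for x y unfolding I_def by (rule span_base) blast
  have AI: "A \<in> I" unfolding I_def by (rule span_base) blast
  have I: "subspace I" unfolding I_def by simp
  show "lie_ideal scale brk I" using brI I by (simp add: lie_ideal_def)
  let ?L = "act_series scale brk I"
  define P where "P = (\<lambda>F. lie_ideal scale brk F \<and> (\<exists>k. ?L F k = {0}))"
  have "P {0}" unfolding P_def lie_ideal_def by (auto simp: brk intro: exI[of _ 0])
  moreover have "\<forall>F. P F \<longrightarrow> dim F < Suc (dim UNIV)"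
    using dim_subset[OF subset_UNIV] by (auto simp: less_Suc_eq_le)
  ultimately obtain F where PF: "P F" and max: "\<And>F'. P F' \<Longrightarrow> dim F' \<le> dim F"
    using ex_has_greatest_nat[of P "{0}" dim "Suc (dim UNIV)"] by (metis less_imp_le)
  have F: "subspace F" "\<And>x y. y \<in> F \<Longrightarrow> brk x y \<in> F" using PF by (auto simp: P_def lie_ideal_def)
  have "F = UNIV"
  proof (rule ccontr)
    assume "F \<noteq> UNIV"
    have "\<exists>v\<in>UNIV - F. \<exists>lam. \<forall>x\<in>UNIV. brk x v - lam x *s v \<in> F"
      by (rule lie_theorem_relative[OF vector_space_axioms brk_alt, of UNIV F Basis brk UNIV])
         (use F chain \<open>F \<noteq> UNIV\<close> brk finite_Basis span_Basis brk_brk in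
           \<open>auto intro!: endo_linear_between\<close>)
    then obtain v lam where v: "v \<notin> F" "\<And>x. brk x v - lam x *s v \<in> F" by blast
    have fix_F: "brk x v \<in> F" if "x \<in> I" for x
    proof -
      have "I \<subseteq> {x. brk x v \<in> F}"
        unfolding I_def
      proof (rule span_minimal)
        have "(brk A ^^ k) v - lam A ^ k *s v \<in> F" for k
        proof (induction k)
          case (Suc k)
          have "(brk A ^^ Suc k) v - lam A ^ Suc k *s v =
            brk A ((brk A ^^ k) v - lam A ^ k *s v) + lam A ^ k *s (brk A v - lam A *s v)"
            by (simp add: brk algebra_simps)
          also have "\<dots> \<in> F" using Suc v F by (intro subspace_add subspace_scale) auto
          finally show ?case .
        qed (simp add: subspace_0 F)
        from this[of n] have "lam A ^ n *s v \<in> F"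
          using A subspace_neg[OF F(1)] by fastforce
        then have "lam A = 0"
          using subspace_scale[OF F(1), of "lam A ^ n *s v" "inverse (lam A ^ n)"] v(1)
          by (cases "lam A = 0") auto
        then have "brk A v \<in> F" using v(2)[of A] by simp
        \<comment> \<open>Modulo \<open>F\<close> both \<open>x\<close> and \<open>y\<close> act on
          \<open>v\<close> by scalars, and scalars commute.\<close>
        moreover have "brk (brk x y) v \<in> F" for x y
        proof -
          have "brk (brk x y) v = brk x (brk y v - lam y *s v) - brk y (brk x v - lam x *s v)
             + lam y *s (brk x v - lam x *s v) - lam x *s (brk y v - lam y *s v)"
            by (simp add: brk_brk brk algebra_simps)
          also have "\<dots> \<in> F" by (simp only: subspace_add subspace_diff subspace_scale F v(2))
          finally show ?thesis .
        qed
        ultimately show "insert A {brk x y |x y. True} \<subseteq> {x. brk x v \<in> F}" by blast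
      next
        show "subspace {x. brk x v \<in> F}" by (intro endo_vimage F brk)
      qed
      then show ?thesis using that by blast
    qed
    define F' where "F' = span (insert v F)"
    have sF: "span F = F" using F by simp
    have F'D: "\<exists>a f. y = a *s v + f \<and> f \<in> F" if y: "y \<in> F'" for y
    proof -
      obtain a where "y - a *s v \<in> F" using y by (auto simp: F'_def span_breakdown_eq sF)
      then show ?thesis by (intro exI[of _ a] exI[of _ "y - a *s v"]) simp
    qed
    have FF': "F \<subseteq> F'" "v \<in> F'" by (auto simp: F'_def intro: span_base)
    have sF': "subspace F'" by (simp add: F'_def)
    have "lie_ideal scale brk F'" unfolding lie_ideal_def
    proof (intro conjI allI ballI)
      fix x y assume "y \<in> F'"
      then obtain a f where f: "y = a *s v + f" "f \<in> F" using F'D by blast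
      have "brk x y = a *s lam x *s v + (a *s (brk x v - lam x *s v) + brk x f)"
        by (simp add: f brk algebra_simps)
      also have "\<dots> \<in> F'"
        using v f F FF' by (intro subspace_add[OF sF'] subspace_scale[OF sF']) auto
      finally show "brk x y \<in> F'" .
    qed (rule sF')
    \<comment> \<open>\<open>I\<close> carries all of \<open>F'\<close> into \<open>F\<close>, so
      the series of \<open>F'\<close> runs just one step behind that of \<open>F\<close>.\<close>
    moreover have "?L F' (Suc k) \<subseteq> ?L F k" for k
    proof (induction k)
      case 0
      have "brk x y \<in> F" if "x \<in> I" "y \<in> F'" for x y
      proof -
        obtain a f where f: "y = a *s v + f" "f \<in> F" using F'D \<open>y \<in> F'\<close> by blast
        then have "brk x y = a *s brk x v + brk x f" by (simp add: brk)
        then show ?thesis using fix_F[OF that(1)] f F by (simp add: subspace_add subspace_scale)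
      qed
      then have "span {brk x y |x y. x \<in> I \<and> y \<in> F'} \<subseteq> F"
        using F(1) by (intro span_minimal) auto
      then show ?case by simp
    next
      case (Suc k)
      have "{brk x y |x y. x \<in> I \<and> y \<in> ?L F' (Suc k)} \<subseteq> {brk x y |x y. x \<in> I \<and> y \<in> ?L F k}"
        using Suc by blast
      then show ?case unfolding act_series.simps(2)[of _ _ _ _ "Suc k"] act_series.simps(2)[of _
          _ _ F k]
        by (rule span_mono)
    qed
    then have "?L F' (Suc k) = {0}" if "?L F k = {0}" for k
      using that span_zero by (force simp del: act_series.simps simp: act_series.simps(2))
    then have "\<exists>k. ?L F' k = {0}" using PF unfolding P_def by blast
    ultimately have "P F'" by (simp add: P_def)
    then have "dim F' \<le> dim F" by (rule max)
    moreover have "F \<subset> F'" using FF' v(1) by blast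
    then have "dim F < dim F'" using sF by (metis F'_def dim_psubset span_span)
    ultimately show False by simp
  qed
  then obtain k where k: "?L UNIV k = {0}" using PF by (auto simp: P_def)
  have "lower_central_series scale brk I k \<subseteq> ?L UNIV k"
  proof (induction k)
    case (Suc k)
    then show ?case by (auto intro!: span_mono)
  qed simp
  moreover have "0 \<in> lower_central_series scale brk I k"
    using subspace_0[OF I] by (cases k) (auto intro: span_zero)
  ultimately show "lie_nilpotent scale brk I" using k by (auto simp: lie_nilpotent_def)
qed

lemma nilradical_contains:
  assumes "lie_solvable scale brk" "is_nilradical scale brk N"
  shows "brk x y \<in> N" and "(\<And>x. (brk A ^^ n) x = 0) \<Longrightarrow> A \<in> N"
proof -
  have chain: "lie_chain scale brk UNIV" using assms(1) by (rule solvable_lie_chain) auto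
  have N: "lie_ideal scale brk I \<Longrightarrow> lie_nilpotent scale brk I \<Longrightarrow> I \<subseteq> N" for I
    using assms(2) by (auto simp: is_nilradical_def)
  have sub: "span (insert A {brk x y | x y. True}) \<subseteq> N" if "\<And>x. (brk A ^^ n) x = 0" for A n
    using nilpotent_ideal[OF chain that] by (rule N)
  \<comment> \<open>With \<open>A = 0\<close> the ideal of \<open>nilpotent_ideal\<close> is the
    derived algebra.\<close>
  have "(brk 0 ^^ 1) x = 0" for x by (simp add: brk)
  from sub[OF this] show "brk x y \<in> N" by (auto intro: span_base dest!: subsetD)
  show "A \<in> N" if "\<And>x. (brk A ^^ n) x = 0"
    using sub[OF that] by (auto intro: span_base dest!: subsetD)
qed

lemma lower_central_funpow:
  "A \<in> H \<Longrightarrow> B \<in> H \<Longrightarrow> (brk A ^^ k) B \<in> lower_central_series scale brk H k"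
  by (induction k) (auto intro!: span_base)

lemma nilpotent_geig_0:
  assumes "lie_nilpotent scale brk H" "A \<in> H" "B \<in> H"
  shows "B \<in> geig (brk A) 0"
proof -
  obtain k where "lower_central_series scale brk H k = {0}"
    using assms(1) by (auto simp: lie_nilpotent_def)
  then have "(brk A ^^ k) B = 0" using lower_central_funpow[OF assms(2,3), of k] by auto
  moreover have "shift (brk A) 0 = brk A" by (rule ext) (simp add: shift_def)
  ultimately show ?thesis by (auto simp: geig_def)
qed

text \<open>Each element of \<open>H\<close> lies in the 0-space of \<open>ad A\<close> for every
  \<open>A\<close> in \<open>H\<close>, so by \<open>geig_bilinear\<close> its bracket preserves all
  generalized eigenspaces of \<open>ad A\<close>. This is the stability that
  \<open>weight_decomposition\<close> asks for.\<close>

lemma nilpotent_subalgebra_weights: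
  assumes sol: "lie_solvable scale brk" and N: "lie_ideal scale brk N"
    and H: "lie_subalgebra scale brk H" "lie_nilpotent scale brk H"
  obtains BN al where "independent BN" "span BN = N"
    "\<And>b A. b \<in> BN \<Longrightarrow> A \<in> H \<Longrightarrow> b \<in> geig (brk A) (al b A)"
    "\<And>b A A'. b \<in> BN \<Longrightarrow> A \<in> H \<Longrightarrow> A' \<in> H \<Longrightarrow> al b (A + A') = al b A + al b A'"
    "\<And>b A c. b \<in> BN \<Longrightarrow> A \<in> H \<Longrightarrow> al b (c *s A) = c * al b A"
proof -
  have Hs: "subspace H" "\<And>x y. x \<in> H \<Longrightarrow> y \<in> H \<Longrightarrow> brk x y \<in> H"
    using H(1) by (auto simp: lie_subalgebra_def)
  have Ns: "subspace N" "\<And>x y. y \<in> N \<Longrightarrow> brk x y \<in> N" using N by (auto simp: lie_ideal_def)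
  have inv: "brk B x \<in> geig (brk A) c" if "A \<in> H" "B \<in> H" "x \<in> geig (brk A) c" for A B x c
    using geig_bilinear[OF brk_alt brk(12) ad_derivation nilpotent_geig_0[OF H(2) that(1,2)]
        that(3)]
    by simp
  define wts where "wts = (\<Union>\<alpha>. {x \<in> N. \<forall>A\<in>H. x \<in> geig (brk A) (\<alpha> A)})"
  have NW: "N \<subseteq> span wts"
    unfolding wts_def by (rule weight_decomposition) (use inv Ns brk in auto)
  obtain BN where BN: "BN \<subseteq> wts" "independent BN" "wts \<subseteq> span BN"
    using maximal_independent_subset by blast
  have "span BN = N"
  proof
    have "wts \<subseteq> N" unfolding wts_def by blast
    then show "span BN \<subseteq> N" using BN(1) Ns(1) by (intro span_minimal) auto
    show "N \<subseteq> span BN" using NW BN(3) by (metis span_minimal subset_trans subspace_span)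
  qed
  have "\<exists>\<alpha>. \<forall>A\<in>H. b \<in> geig (brk A) (\<alpha> A)" if "b \<in> BN" for b
    using BN(1) that unfolding wts_def by blast
  then obtain al where al: "\<And>b A. b \<in> BN \<Longrightarrow> A \<in> H \<Longrightarrow> b \<in> geig (brk A) (al b A)" by metis
  have lin: "al b (A + A') = al b A + al b A'" "al b (c *s A) = c * al b A"
    if b: "b \<in> BN" and A: "A \<in> H" "A' \<in> H" for b A A' c
  proof -
    \<comment> \<open>The weight space of \<open>b\<close> contains, by Lie's theorem, a genuine
      common eigenvector. Its eigenvalues are linear in the acting element and have to agree with
      the weight.\<close>
    define V where "V = (\<Inter>A\<in>H. geig (brk A) (al b A))"
    have V: "subspace V" unfolding V_def by (intro subspace_Int subspace_geig brk)
    have VH: "brk x v \<in> V" if "x \<in> H" "v \<in> V" for x v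
      using inv that unfolding V_def by blast
    have "b \<in> V" using al[OF b] by (auto simp: V_def)
    moreover have "b \<noteq> 0" using b BN(2) dependent_zero by blast
    ultimately have V0: "{0} \<noteq> V" by blast
    have "\<exists>v\<in>V - {0}. \<exists>lam. \<forall>x\<in>H. brk x v - lam x *s v \<in> {0}"
      by (rule lie_theorem_relative[OF vector_space_axioms brk_alt V _ _ V0 finite_Basis])
         (use V VH Hs sol brk span_Basis brk_brk subspace_0[OF V] in
           \<open>auto intro!: endo_linear_between solvable_lie_chain\<close>)
    then obtain v lam where v: "v \<in> V" "v \<noteq> 0" "\<And>x. x \<in> H \<Longrightarrow> brk x v = lam x *s v" by auto
    have ev: "al b x = lam x" if "x \<in> H" for x
      using eigenvector_geig[OF brk(12) v(3)[OF that] v(2)] v(1) that unfolding V_def by force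
    have "lam (A + A') *s v = (lam A + lam A') *s v"
      using v(3)[of "A + A'"] A Hs(1) by (simp add: subspace_add brk v(3) scale_left_distrib)
    moreover have "lam (c *s A) *s v = (c * lam A) *s v"
      using v(3)[of "c *s A"] A Hs(1) by (metis brk(3) scale_scale subspace_scale v(3))
    ultimately have "lam (A + A') = lam A + lam A'" "lam (c *s A) = c * lam A"
      using v(2) by (simp_all only: scale_cancel_right simp_thms)
    then show "al b (A + A') = al b A + al b A'" "al b (c *s A) = c * al b A"
      using A Hs(1) by (simp_all add: ev subspace_add subspace_scale)
  qed
  show thesis by (rule that[OF BN(2) \<open>span BN = N\<close> al lin])
qed

end

subsection \<open>Alternating forms and the Chevalley--Eilenberg differential\<close>

text \<open>The action of an endomorphism on forms by insertion into each slot. For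
  \<open>f = m x\<close> it is minus the Lie derivative along \<open>x\<close> with trivial
  coefficients.\<close>

primrec der :: "('s \<Rightarrow> 's) \<Rightarrow> ('s list \<Rightarrow> 'k::comm_ring_1) \<Rightarrow> 's list \<Rightarrow> 'k" where
  "der f w [] = 0"
| "der f w (x # xs) = w (f x # xs) + der f (\<lambda>ys. w (x # ys)) xs"

text \<open>The Chevalley-Eilenberg differential with coefficients in the character
  \<open>l\<close>, defined by Cartan's formula: contracting the differential with \<open>x\<close>
  gives the Lie derivative \<open>l x - der (m x)\<close> minus the differential of the contraction.
  Inductions over argument lists and the homotopy argument become immediate; agreement with the
  index formula is \<open>cdiff_eq_sums\<close>.\<close>

primrec cdiff ::
  "('s \<Rightarrow> 's \<Rightarrow> 's) \<Rightarrow> ('s \<Rightarrow> 'k::comm_ring_1) \<Rightarrow> ('s list \<Rightarrow> 'k) \<Rightarrow> 's list \<Rightarrow> 'k" where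
  "cdiff m l w [] = 0"
| "cdiff m l w (x # xs) = l x * w xs - der (m x) w xs - cdiff m l (\<lambda>ys. w (x # ys)) xs"

primrec alt_sum :: "('s \<Rightarrow> 's list \<Rightarrow> 'k::comm_ring_1) \<Rightarrow> 's list \<Rightarrow> 'k" where
  "alt_sum F [] = 0"
| "alt_sum F (x # xs) = F x xs - alt_sum (\<lambda>y ys. F y (x # ys)) xs"

lemma der_add: "der f (\<lambda>ys. w ys + v ys) xs = der f w xs + der f v xs"
  by (induction xs arbitrary: w v) (simp_all add: algebra_simps)

lemma der_scale: "der f (\<lambda>ys. c * w ys) xs = c * der f w xs"
  by (induction xs arbitrary: w) (simp_all add: algebra_simps)

lemma der_diff: "der f (\<lambda>ys. w ys - v ys) xs = der f w xs - der f v xs"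
  by (induction xs arbitrary: w v) (simp_all add: algebra_simps)

lemma der_0 [simp]: "der f (\<lambda>ys. 0) xs = 0"
  by (induction xs) simp_all

lemma der_append: "der f w (as @ bs) = der f (\<lambda>ys. w (ys @ bs)) as + der f (\<lambda>ys. w (as @ ys)) bs"
  by (induction as arbitrary: w) (simp_all add: algebra_simps)

lemma der_cong: "(\<And>ys. length ys = length xs \<Longrightarrow> w ys = v ys) \<Longrightarrow> der f w xs = der f v xs"
proof (induction xs arbitrary: w v)
  case (Cons x xs)
  have "der f (\<lambda>ys. w (x # ys)) xs = der f (\<lambda>ys. v (x # ys)) xs"
    using Cons.prems by (intro Cons.IH) simp
  then show ?case using Cons.prems by simp
qed simp

lemma cdiff_add: "cdiff m l (\<lambda>ys. w ys + v ys) xs = cdiff m l w xs + cdiff m l v xs"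
  by (induction xs arbitrary: w v) (simp_all add: der_add algebra_simps)

lemma cdiff_scale: "cdiff m l (\<lambda>ys. c * w ys) xs = c * cdiff m l w xs"
  by (induction xs arbitrary: w) (simp_all add: der_scale algebra_simps)

lemma cdiff_0 [simp]: "cdiff m l (\<lambda>ys. 0) xs = 0"
  by (induction xs) simp_all

lemma cdiff_sum: "cdiff m l (\<lambda>ys. \<Sum>i\<in>I. w i ys) xs = (\<Sum>i\<in>I. cdiff m l (w i) xs)"
  by (induction I rule: infinite_finite_induct) (simp_all add: cdiff_add)

lemma alt_sum_add: "alt_sum (\<lambda>y ys. F y ys + G y ys) xs = alt_sum F xs + alt_sum G xs"
  by (induction xs arbitrary: F G) (simp_all add: algebra_simps)

lemma alt_sum_minus: "alt_sum (\<lambda>y ys. - F y ys) xs = - alt_sum F xs"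
  by (induction xs arbitrary: F) (simp_all add: algebra_simps)

lemma alt_sum_0: "alt_sum (\<lambda>y ys. 0) xs = 0"
  by (induction xs) simp_all

text \<open>List patterns in place of indices make the notion stable under fixing the first
  argument. Forms of all lengths are treated at once; the degree enters only through
  \<open>supp\<close>.\<close>

definition altn :: "('s list \<Rightarrow> 'k::comm_ring_1) \<Rightarrow> bool" where
  "altn w \<longleftrightarrow> (\<forall>as bs cs x. w (as @ x # bs @ x # cs) = 0)"

definition supp :: "nat \<Rightarrow> ('s list \<Rightarrow> 'k::comm_ring_1) \<Rightarrow> bool" where
  "supp p w \<longleftrightarrow> (\<forall>xs. length xs \<noteq> p \<longrightarrow> w xs = 0)"

lemma altn_Cons: "altn w \<Longrightarrow> altn (\<lambda>ys. w (x # ys))"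
  unfolding altn_def by (metis append_Cons)

lemma supp_der: "supp p w \<Longrightarrow> supp p (der f w)"
  unfolding supp_def
proof (intro allI impI)
  fix xs :: "'a list" assume "\<forall>xs. length xs \<noteq> p \<longrightarrow> w xs = 0" "length xs \<noteq> p"
  then have "der f w xs = der f (\<lambda>_. 0) xs" by (intro der_cong) auto
  then show "der f w xs = 0" by simp
qed

context alg_closed_vector_space
begin

definition mlin :: "('v list \<Rightarrow> 'k) \<Rightarrow> bool" where
  "mlin w \<longleftrightarrow> (\<forall>as bs x y. w (as @ (x + y) # bs) = w (as @ x # bs) + w (as @ y # bs)) \<and>
    (\<forall>as bs c x. w (as @ (c *s x) # bs) = c * w (as @ x # bs))"

lemma mlinD:
  assumes "mlin w"
  shows "w (as @ (x + y) # bs) = w (as @ x # bs) + w (as @ y # bs)"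
    "w (as @ (c *s x) # bs) = c * w (as @ x # bs)"
    "w ((x + y) # bs) = w (x # bs) + w (y # bs)" "w ((c *s x) # bs) = c * w (x # bs)"
  using assms unfolding mlin_def by (metis append_Nil)+

lemma mlin_more:
  assumes "mlin w"
  shows "w (as @ 0 # bs) = 0" "w (as @ (x - y) # bs) = w (as @ x # bs) - w (as @ y # bs)"
    "w (0 # bs) = 0" "w ((x - y) # bs) = w (x # bs) - w (y # bs)"
proof -
  show 0: "w (as @ 0 # bs) = 0" for as using mlinD(2)[OF assms, of as 0 0] by simp
  show 1: "w (as @ (x - y) # bs) = w (as @ x # bs) - w (as @ y # bs)" for as
    using mlinD(1)[OF assms, of as "x - y" y bs] by simp
  show "w (0 # bs) = 0" "w ((x - y) # bs) = w (x # bs) - w (y # bs)"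
    using 0[of "[]"] 1[of "[]"] by simp_all
qed

lemma mlin_sum:
  assumes "mlin w"
  shows "w ((\<Sum>i\<in>I. u i) # bs) = (\<Sum>i\<in>I. w (u i # bs))"
  by (induction I rule: infinite_finite_induct) (simp_all add: mlin_more[OF assms] mlinD[OF assms])

lemma mlin_Cons:
  assumes "mlin w"
  shows "mlin (\<lambda>ys. w (x # ys))"
proof -
  have "w (x # as @ (y + z) # bs) = w (x # as @ y # bs) + w (x # as @ z # bs)"
    "w (x # as @ (c *s y) # bs) = c * w (x # as @ y # bs)" for as y z c bs
    using mlinD(1,2)[OF assms, of "x # as"] by simp_all
  then show ?thesis by (simp add: mlin_def)
qed

lemma mlin_0_in_set:
  assumes "mlin w" "0 \<in> set xs"
  shows "w xs = 0"
  using split_list[OF assms(2)] mlin_more(1)[OF assms(1)] by blast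

lemma altn_skew:
  assumes "mlin w" "altn w"
  shows "w (as @ x # bs @ y # cs) = - w (as @ y # bs @ x # cs)"
proof -
  have z: "w (as @ z # bs @ z # cs) = 0" for z using assms(2) by (simp add: altn_def)
  have "w (as @ (x + y) # bs @ (x + y) # cs)
    = w (as @ x # bs @ x # cs) + w (as @ x # bs @ y # cs)
      + (w (as @ y # bs @ x # cs) + w (as @ y # bs @ y # cs))"
    using mlinD(1)[OF assms(1), of as x y "bs @ (x + y) # cs"]
      mlinD(1)[OF assms(1), of "as @ x # bs" x y cs] mlinD(1)[OF assms(1), of "as @ y # bs" x y cs]
    by simp
  then show ?thesis by (simp add: z eq_neg_iff_add_eq_0)
qed

lemma altn_skew_Cons:
  "mlin w \<Longrightarrow> altn w \<Longrightarrow> w (x # y # cs) = - w (y # x # cs)"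
  using altn_skew[of w "[]" x "[]" y cs] by simp

lemma der_fun_add: "mlin w \<Longrightarrow> der (\<lambda>x. f x + g x) w xs = der f w xs + der g w xs"
proof (induction xs arbitrary: w)
  case (Cons x xs)
  then show ?case using mlin_Cons[OF Cons.prems, of x] by (simp add: mlinD(3)[OF Cons.prems])
qed simp

lemma der_fun_diff: "mlin w \<Longrightarrow> der (\<lambda>x. f x - g x) w xs = der f w xs - der g w xs"
proof (induction xs arbitrary: w)
  case (Cons x xs)
  then show ?case using mlin_Cons[OF Cons.prems, of x] by (simp add: mlin_more(4)[OF Cons.prems])
qed simp

lemma der_fun_scale: "mlin w \<Longrightarrow> der (\<lambda>x. c *s f x) w xs = c * der f w xs"
proof (induction xs arbitrary: w)
  case (Cons x xs)
  then show ?case using mlin_Cons[OF Cons.prems, of x] by (simp add: mlinD(4)[OF Cons.prems]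
      algebra_simps)
qed simp

lemma der_fun_0: "mlin w \<Longrightarrow> der (\<lambda>x. 0) w xs = 0"
proof (induction xs arbitrary: w)
  case (Cons x xs)
  then show ?case using mlin_Cons[OF Cons.prems, of x] by (simp add: mlin_more[OF Cons.prems])
qed simp

lemma der_commutator:
  "mlin w \<Longrightarrow> der f (der g w) xs - der g (der f w) xs = der (\<lambda>x. g (f x) - f (g x)) w xs"
proof (induction xs arbitrary: w)
  case (Cons x xs)
  have e: "(\<lambda>ys. der h w (x # ys)) = (\<lambda>ys. w (h x # ys) + der h (\<lambda>ys. w (x # ys)) ys)" for h
    by (rule ext) simp
  show ?case
    using Cons.IH[OF mlin_Cons[OF Cons.prems], of x]
    by (simp add: der_add mlin_more(4)[OF Cons.prems] algebra_simps)
qed simp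

lemma mlin_der:
  assumes w: "mlin w" and f: "endo f"
  shows "mlin (der f w)"
  unfolding mlin_def
proof (intro conjI allI)
  fix as bs x y c
  show "der f w (as @ (x + y) # bs) = der f w (as @ x # bs) + der f w (as @ y # bs)"
    by (simp add: der_append mlinD(1)[OF w] endoD(1)[OF f] der_add)
  show "der f w (as @ (c *s x) # bs) = c * der f w (as @ x # bs)"
    by (simp add: der_append mlinD(2)[OF w] endoD(3)[OF f] der_scale distrib_left)
qed

lemma altn_der:
  assumes w: "mlin w" "altn w"
  shows "altn (der f w)"
  unfolding altn_def
proof (intro allI)
  fix as bs cs x
  have z: "w (as @ z # bs @ z # cs) = 0" for as z bs cs using w(2) by (simp add: altn_def)
  show "der f w (as @ x # bs @ x # cs) = 0"
    using altn_skew[OF w, of as "f x" bs x cs] by (simp add: der_append z)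
qed

text \<open>The commutator of \<open>der D\<close> with \<open>der (m x)\<close> is compensated by
  the term in which \<open>D\<close> hits the first argument \<open>x\<close>.\<close>

lemma cdiff_der:
  assumes D: "endo D" and dm: "\<And>x y. D (m x y) = m (D x) y + m x (D y)" and l: "\<And>x. l (D x) = 0"
  shows "mlin w \<Longrightarrow> cdiff m l (der D w) xs = der D (cdiff m l w) xs"
proof (induction xs arbitrary: w)
  case (Cons x xs)
  have c: "der D (der (m x) w) xs - der (m x) (der D w) xs = - der (m (D x)) w xs"
    unfolding der_commutator[OF Cons.prems]
    using der_fun_scale[OF Cons.prems, of "-1" "m (D x)"] by (simp add: dm)
  show ?case
    using Cons.IH[OF mlin_Cons[OF Cons.prems], of x] c
    by (simp add: cdiff_add der_add der_diff der_scale l algebra_simps)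
qed simp

lemma mlin_cdiff:
  assumes m: "m \<in> alt_bilinear scale"
    and l: "\<And>x y. l (x + y) = l x + l y" "\<And>c x. l (c *s x) = c * l x"
  shows "mlin w \<Longrightarrow> mlin (cdiff m l w)"
proof -
  note M = alt_bilinearD[OF m]
  have "cdiff m l w (as @ (x + y) # bs) = cdiff m l w (as @ x # bs) + cdiff m l w (as @ y # bs) \<and>
    cdiff m l w (as @ (c *s x) # bs) = c * cdiff m l w (as @ x # bs)" if "mlin w" for w as bs c x y
    using that
  proof (induction as arbitrary: w)
    case Nil
    have "(\<lambda>z. m (x + y) z) = (\<lambda>z. m x z + m y z)" "m (c *s x) = (\<lambda>z. c *s m x z)"
      by (auto simp: M)
    then show ?case
      by (simp add: l der_fun_add[OF Nil] der_fun_scale[OF Nil] mlinD[OF Nil] cdiff_add cdiff_scale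
          algebra_simps)
  next
    case (Cons a as)
    show ?case
      using Cons.IH[OF mlin_Cons[OF Cons.prems], of a] mlin_der[OF Cons.prems M(12), of a]
      by (simp add: mlinD[OF Cons.prems] mlinD[OF mlin_der[OF Cons.prems M(12), of a]]
          algebra_simps)
  qed
  then show "mlin w \<Longrightarrow> mlin (cdiff m l w)" by (simp add: mlin_def)
qed

lemma der_eq_alt_sum:
  "mlin w \<Longrightarrow> altn w \<Longrightarrow> der g w xs = alt_sum (\<lambda>y ys. w (g y # ys)) xs"
proof (induction xs arbitrary: w)
  case (Cons x xs)
  show ?case
    using Cons.IH[OF mlin_Cons[OF Cons.prems(1)] altn_Cons[OF Cons.prems(2)], of x]
    by (simp add: altn_skew_Cons[OF Cons.prems, of x] alt_sum_minus)
qed simp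

text \<open>The correction consists of the operators \<open>l x - der (E x)\<close>. It vanishes on
  forms of weight \<open>l\<close>, which is how the two twists cancel.\<close>

lemma cdiff_twist:
  assumes m: "\<And>x y. m x y = n x y + E x y - E y x"
  shows "mlin w \<Longrightarrow> altn w \<Longrightarrow>
    cdiff m l w xs = cdiff n (\<lambda>_. 0) w xs + alt_sum (\<lambda>x ys. l x * w ys - der (E x) w ys) xs"
proof (induction xs arbitrary: w)
  case (Cons x xs)
  have mx: "m x = (\<lambda>y. (n x y + E x y) - E y x)" by (rule ext) (rule m)
  have "der (m x) w xs = der (n x) w xs + der (E x) w xs - alt_sum (\<lambda>y ys. w (E y x # ys)) xs"
    unfolding mx der_fun_diff[OF Cons.prems(1)] der_fun_add[OF Cons.prems(1)]
    using der_eq_alt_sum[OF Cons.prems, of "\<lambda>y. E y x" xs] by simp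
  moreover have "alt_sum (\<lambda>y ys. l y * w (x # ys) - der (E y) w (x # ys)) xs =
      alt_sum (\<lambda>y ys. l y * w (x # ys) - der (E y) (\<lambda>ys. w (x # ys)) ys) xs
      - alt_sum (\<lambda>y ys. w (E y x # ys)) xs"
    unfolding alt_sum_minus[symmetric] diff_conv_add_uminus alt_sum_add[symmetric]
    by (simp add: algebra_simps)
  ultimately show ?case
    using Cons.IH[OF mlin_Cons[OF Cons.prems(1)] altn_Cons[OF Cons.prems(2)], of x]
    by simp
qed simp

lemma der_nilpotent:
  assumes f: "endo f" "\<And>x. (f ^^ k) x = 0" and w: "mlin w" "supp p w"
  shows "\<exists>j. (der f ^^ j) w = (\<lambda>_. 0)"
proof -
  \<comment> \<open>\<open>R k w\<close>: the form vanishes as soon as the powers of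
    \<open>f\<close> applied to its arguments have total exponent at least \<open>k\<close>. One
    application of \<open>der f\<close> lowers this bound by 1, and \<open>R 0\<close> means that
    the form is 0.\<close>
  define R where "R = (\<lambda>k (w :: 'v list \<Rightarrow> 'k). \<forall>is ys. length is = length ys \<longrightarrow> k \<le> sum_list is \<longrightarrow>
    w (map2 (\<lambda>i. f ^^ i) is ys) = (0::'k))"
  have Rd: "R k w \<longleftrightarrow> (\<forall>is ys. length is = length ys \<longrightarrow> k \<le> sum_list is \<longrightarrow>
    w (map2 (\<lambda>i. f ^^ i) is ys) = 0)" for k w
    by (simp add: R_def)
  have "length is = length ys \<Longrightarrow> k \<le> sum_list is \<Longrightarrow> R (Suc k) w \<Longrightarrow>
      der f w (map2 (\<lambda>i. f ^^ i) is ys) = 0" for "is" and ys :: "'v list" and k w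
  proof (induction "is" ys arbitrary: k w rule: list_induct2)
    case (Cons i "is" y ys)
    have Rw: "w (map2 (\<lambda>i. f ^^ i) js zs) = 0" if "length js = length zs" "Suc k \<le> sum_list js"
        for js and zs :: "'v list"
      using Cons.prems(2) that unfolding Rd by blast
    have "w (map2 (\<lambda>i. f ^^ i) (Suc i # is) (y # ys)) = 0"
      using Cons.prems(1) Cons.hyps by (intro Rw) auto
    moreover have "R (Suc (k - i)) (\<lambda>ys. w ((f ^^ i) y # ys))"
      unfolding Rd
    proof (intro allI impI)
      fix js and zs :: "'v list" assume a: "length js = length zs" "Suc (k - i) \<le> sum_list js"
      then have "w (map2 (\<lambda>i. f ^^ i) (i # js) (y # zs)) = 0" by (intro Rw) auto
      then show "w ((f ^^ i) y # map2 (\<lambda>i. f ^^ i) js zs) = 0" by simp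
    qed
    then have "der f (\<lambda>ys. w ((f ^^ i) y # ys)) (map2 (\<lambda>i. f ^^ i) is ys) = 0"
      using Cons.prems by (intro Cons.IH[of "k - i"]) auto
    ultimately show ?case by simp
  qed simp
  then have step: "R (Suc k) w \<Longrightarrow> R k (der f w)" for k w
    unfolding Rd[of k] by blast
  have iter: "R j w \<Longrightarrow> R 0 ((der f ^^ j) w)" for j w
  proof (induction j arbitrary: w)
    case (Suc j)
    from Suc.IH[OF step[OF Suc.prems]] show ?case by (simp add: funpow_swap1)
  qed simp
  \<comment> \<open>If the exponents of \<open>p\<close> arguments add up to more than
    \<open>k * p\<close>, one of them is at least \<open>k\<close>. The \<open>Suc\<close> also
    covers \<open>p = 0\<close>, where the total is 0 and the form need not vanish.\<close>
  have "R (Suc (k * p)) w"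
    unfolding Rd
  proof (intro allI impI)
    fix "is" :: "nat list" and ys :: "'v list"
    assume a: "length is = length ys" "Suc (k * p) \<le> sum_list is"
    show "w (map2 (\<lambda>i. f ^^ i) is ys) = 0"
    proof (cases "length is = p")
      case True
      have "\<exists>i\<in>set is. k \<le> i"
      proof (rule ccontr)
        assume "\<not> ?thesis"
        then have "sum_list is \<le> sum_list (map (\<lambda>_. k) is)"
          using sum_list_mono[of "is" "\<lambda>i. i" "\<lambda>_. k"] by (simp add: not_le less_imp_le)
        then show False using a True by (simp add: sum_list_triv mult.commute)
      qed
      then obtain j where j: "j < length is" "k \<le> is ! j" by (metis in_set_conv_nth)
      have "map2 (\<lambda>i. f ^^ i) is ys ! j = (f ^^ (is ! j)) (ys ! j)" using j a by simp
      also have "\<dots> = 0" using funpow_0_mono[OF f(1) f(2) j(2)] .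
      finally have "0 \<in> set (map2 (\<lambda>i. f ^^ i) is ys)"
        using j a by (metis length_map length_zip min.idem nth_mem)
      then show ?thesis by (rule mlin_0_in_set[OF w(1)])
    next
      case False
      then show ?thesis using w(2) a by (simp add: supp_def)
    qed
  qed
  then have R0: "R 0 ((der f ^^ Suc (k * p)) w)" by (rule iter)
  have "(der f ^^ Suc (k * p)) w ys = 0" for ys
  proof -
    have "map2 (\<lambda>i. f ^^ i) (replicate (length ys) 0) ys = ys" by (induction ys) auto
    then show ?thesis using R0 unfolding Rd by (metis length_replicate zero_le)
  qed
  then show ?thesis by blast
qed

end

subsection \<open>Weight decomposition of forms\<close>

lemma alt_sum_nths:
  "alt_sum F xs = (\<Sum>i<length xs. (-1) ^ i * F (xs ! i) (nths xs (- {i})))"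
proof (induction xs arbitrary: F)
  case (Cons x xs)
  have "{j. Suc j \<in> - {0}} = UNIV" "{j. Suc j \<in> - {Suc i}} = - {i}" for i by auto
  then have n: "nths (x # xs) (- {0}) = xs" "nths (x # xs) (- {Suc i}) = x # nths xs (- {i})" for i
    by (simp_all add: nths_Cons nths_all)
  show ?case
    by (simp add: Cons.IH sum.lessThan_Suc_shift n sum_negf del: sum.lessThan_Suc)
qed simp

definition pair_sum ::
  "('s \<Rightarrow> 's \<Rightarrow> 's) \<Rightarrow> ('s list \<Rightarrow> 'k::comm_ring_1) \<Rightarrow> 's list \<Rightarrow> 'k" where
  "pair_sum m w xs = (\<Sum>j<length xs. \<Sum>i<j.
     (-1) ^ (i + j) * w (m (xs ! i) (xs ! j) # nths xs (- {i, j})))"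

lemma supp_cdiff: "supp p w \<Longrightarrow> supp (Suc p) (cdiff m l w)"
proof -
  have "(\<And>ys. Suc (length ys) = length xs \<Longrightarrow> w ys = 0) \<Longrightarrow> cdiff m l w xs = 0" for xs w
  proof (induction xs arbitrary: w)
    case (Cons x xs)
    have "der (m x) w xs = der (m x) (\<lambda>_. 0) xs" by (rule der_cong) (simp add: Cons.prems)
    moreover have "cdiff m l (\<lambda>ys. w (x # ys)) xs = 0" by (rule Cons.IH) (simp add: Cons.prems)
    ultimately show ?case by (simp add: Cons.prems)
  qed simp
  then show "supp p w \<Longrightarrow> supp (Suc p) (cdiff m l w)" unfolding supp_def by auto
qed

context alg_closed_vector_space
begin

text \<open>Pairs that contain the head combine to \<open>der (m x)\<close>. In the others
  \<open>x\<close> is moved to the front past the bracket entry, which changes the sign.\<close>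

lemma pair_sum_Cons:
  assumes w: "mlin w" "altn w"
  shows "pair_sum m w (x # xs) = - der (m x) w xs - pair_sum m (\<lambda>ys. w (x # ys)) xs"
proof -
  have "{k. Suc k \<in> - {0, Suc j}} = - {j}" "{k. Suc k \<in> - {Suc i, Suc j}} = - {i, j}" for i j by
      auto
  then have n: "nths (x # xs) (- {0, Suc j}) = nths xs (- {j})"
    "nths (x # xs) (- {Suc i, Suc j}) = x # nths xs (- {i, j})" for i j
    by (simp_all add: nths_Cons)
  have "pair_sum m w (x # xs) = (\<Sum>j<length xs. - ((-1) ^ j * w (m x (xs ! j) # nths xs (- {j})))
     - (\<Sum>i<j. (-1) ^ (i + j) * w (x # m (xs ! i) (xs ! j) # nths xs (- {i, j}))))"
    unfolding pair_sum_def
    by (simp add: sum.lessThan_Suc_shift n del: sum.lessThan_Suc)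
       (rule sum.cong, simp_all add: altn_skew_Cons[OF w, of _ x] sum_negf)
  also have "\<dots> = - der (m x) w xs - pair_sum m (\<lambda>ys. w (x # ys)) xs"
    by (simp add: sum_subtractf sum_negf pair_sum_def der_eq_alt_sum[OF w] alt_sum_nths)
  finally show ?thesis .
qed

lemma cdiff_eq_sums:
  "mlin w \<Longrightarrow> altn w \<Longrightarrow> cdiff m l w xs = alt_sum (\<lambda>x ys. l x * w ys) xs + pair_sum m w xs"
proof (induction xs arbitrary: w)
  case Nil
  then show ?case by (simp add: pair_sum_def)
next
  case (Cons x xs)
  show ?case
    using Cons.IH[OF mlin_Cons[OF Cons.prems(1)] altn_Cons[OF Cons.prems(2)], of x]
    by (simp add: pair_sum_Cons[OF Cons.prems])
qed

text \<open>On cochains with values in a line on which the algebra acts by \<open>l\<close>, the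
  differential reduces to the scalar one.\<close>

lemma ce_diff_eq_cdiff:
  assumes vs: "vector_space scV" and w: "mlin w" "altn w" "supp p w"
    and \<rho>: "\<And>x c. \<rho> x (scV c v) = scV (l x * c) v"
  shows "ce_diff m scV \<rho> p (\<lambda>xs. scV (w xs) v) = (\<lambda>xs. scV (cdiff m l w xs) v)"
proof
  fix xs
  interpret V: vector_space scV by fact
  show "ce_diff m scV \<rho> p (\<lambda>xs. scV (w xs) v) xs = scV (cdiff m l w xs) v"
  proof (cases "length xs = Suc p")
    case True
    have p: "{..p} = {..<Suc p}" by auto
    show ?thesis
      by (simp only: ce_diff_def cdiff_eq_sums[OF w(1,2)] alt_sum_nths pair_sum_def True if_True
          simp_thms
          \<rho> V.scale_scale V.scale_sum_left V.scale_left_distrib p)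
  next
    case False
    then show ?thesis using supp_cdiff[OF w(3), of m l] by (simp add: ce_diff_def supp_def)
  qed
qed

text \<open>Adjacent swaps bring two equal entries next to each other; swapping them shows that
  twice the value is 0, and characteristic 0 gives the claim.\<close>

lemma adjacent_skew_altn:
  assumes sk: "\<And>as x y bs. w (as @ x # y # bs) = - w (as @ y # x # bs :: 'v list) "
  shows "altn (w :: 'v list \<Rightarrow> 'k)"
proof -
  have "w (as @ x # bs @ x # cs) = 0" for as x bs cs
  proof (induction bs arbitrary: as)
    case Nil
    have "2 * w (as @ x # x # cs) = 0" using sk[of as x x cs] by (simp add: eq_neg_iff_add_eq_0)
    then show ?case by simp
  next
    case (Cons b bs)
    then show ?case using sk[of as x b "bs @ x # cs"] Cons.IH[of "as @ [b]"] by simp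
  qed
  then show ?thesis by (simp add: altn_def)
qed

end

section \<open>Multilinear extension from basis words, and projections onto weights\<close>

primrec mext :: "('s \<Rightarrow> 's \<Rightarrow> 'k::comm_ring_1) \<Rightarrow> 's set \<Rightarrow> ('s list \<Rightarrow> 'k) \<Rightarrow> 's list \<Rightarrow> 'k" where
  "mext r B \<phi> [] = \<phi> []"
| "mext r B \<phi> (x # xs) = (\<Sum>b\<in>B. r x b * mext r B (\<lambda>ys. \<phi> (b # ys)) xs)"

lemma mext_cong:
  "(\<And>bs. set bs \<subseteq> B \<Longrightarrow> length bs = length xs \<Longrightarrow> \<phi> bs = \<psi> bs) \<Longrightarrow> mext r B \<phi> xs = mext r B \<psi> xs"
proof (induction xs arbitrary: \<phi> \<psi>)
  case (Cons x xs)
  have "mext r B (\<lambda>ys. \<phi> (b # ys)) xs = mext r B (\<lambda>ys. \<psi> (b # ys)) xs" if "b \<in> B" for b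
    using Cons.prems that by (intro Cons.IH) simp
  then show ?case by simp
qed simp

lemma mext_add: "mext r B (\<lambda>ys. \<phi> ys + \<psi> ys) xs = mext r B \<phi> xs + mext r B \<psi> xs"
  by (induction xs arbitrary: \<phi> \<psi>) (simp_all add: sum.distrib algebra_simps)

lemma mext_scale: "mext r B (\<lambda>ys. c * \<phi> ys) xs = c * mext r B \<phi> xs"
  by (induction xs arbitrary: \<phi>) (simp_all add: sum_distrib_left algebra_simps)

lemma mext_0: "mext r B (\<lambda>ys. 0) xs = 0"
  by (induction xs) simp_all

lemma mext_skew:
  assumes "\<And>as x y bs. \<phi> (as @ x # y # bs) = - \<phi> (as @ y # x # bs)"
  shows "mext r B \<phi> (as @ x # y # bs) = - mext r B \<phi> (as @ y # x # bs)"
  using assms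
proof (induction as arbitrary: \<phi>)
  case Nil
  have eq: "(\<lambda>ys. \<phi> (b # c # ys)) = (\<lambda>ys. - 1 * \<phi> (c # b # ys))" for b c
    by (rule ext) (use Nil[of "[]" b c] in simp)
  have e: "mext r B (\<lambda>ys. \<phi> (b # c # ys)) bs = - 1 * mext r B (\<lambda>ys. \<phi> (c # b # ys)) bs" for b c
    using arg_cong[OF eq[of b c], of "\<lambda>f. mext r B f bs"] by (simp only: mext_scale)
  have h: "r x b * (r y c * mext r B (\<lambda>ys. \<phi> (b # c # ys)) bs) =
      - (r y c * (r x b * mext r B (\<lambda>ys. \<phi> (c # b # ys)) bs))" for b c
    unfolding e[of b c] by (simp add: mult.left_commute)
  have "(\<Sum>b\<in>B. \<Sum>c\<in>B. r x b * (r y c * mext r B (\<lambda>ys. \<phi> (b # c # ys)) bs)) =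
      - (\<Sum>b\<in>B. \<Sum>c\<in>B. r y c * (r x b * mext r B (\<lambda>ys. \<phi> (c # b # ys)) bs))"
    unfolding sum_negf[symmetric] by (intro sum.cong refl h)
  also have "\<dots> = - (\<Sum>c\<in>B. \<Sum>b\<in>B. r y c * (r x b * mext r B (\<lambda>ys. \<phi> (c # b # ys)) bs))"
    by (subst sum.swap) simp
  finally show ?case by (simp add: sum_distrib_left)
next
  case (Cons a as)
  have "mext r B (\<lambda>ys. \<phi> (b # ys)) (as @ x # y # bs) = - mext r B (\<lambda>ys. \<phi> (b # ys)) (as @ y # x
      # bs)" for b
  proof (rule Cons.IH)
    show "\<phi> (b # as' @ x' # y' # bs') = - \<phi> (b # as' @ y' # x' # bs')" for as' x' y' bs'
      using Cons.prems[of "b # as'" x' y' bs'] by simp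
  qed
  then show ?case by (simp add: sum_negf)
qed

text \<open>The weight of the basis word \<open>bs\<close>, a function of the torus element:
  \<open>der (E x)\<close> multiplies the value of a form at \<open>bs\<close> by
  \<open>wsum wt bs x\<close>.\<close>

definition wsum :: "('s \<Rightarrow> 't \<Rightarrow> 'k::comm_ring_1) \<Rightarrow> 's list \<Rightarrow> 't \<Rightarrow> 'k" where
  "wsum wt bs = (\<lambda>x. \<Sum>b\<leftarrow>bs. wt b x)"

definition wsums :: "('s \<Rightarrow> 't \<Rightarrow> 'k::comm_ring_1) \<Rightarrow> 's set \<Rightarrow> nat \<Rightarrow> ('t \<Rightarrow> 'k) set" where
  "wsums wt B p = wsum wt ` {bs. set bs \<subseteq> B \<and> length bs = p}"

context alg_closed_fd_vector_space
begin

text \<open>The projection onto forms of weight \<open>l\<close>, the simultaneous eigenspace of all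
  \<open>der (E x)\<close>: the values at basis words of other weights are deleted, the rest is
  extended multilinearly.\<close>

definition proj :: "'v set \<Rightarrow> ('v \<Rightarrow> 't \<Rightarrow> 'k) \<Rightarrow> ('t \<Rightarrow> 'k) \<Rightarrow> ('v list \<Rightarrow> 'k) \<Rightarrow> 'v list \<Rightarrow> 'k" where
  "proj B wt l w = mext (representation B) B (\<lambda>bs. if wsum wt bs = l then w bs else 0)"

context
  fixes B :: "'v set"
  assumes B: "independent B" "span B = UNIV"
begin

lemma mlin_mext: "mlin (mext (representation B) B \<phi>)"
proof -
  have "mext (representation B) B \<phi> (as @ (x + y) # bs) =
      mext (representation B) B \<phi> (as @ x # bs) + mext (representation B) B \<phi> (as @ y # bs) \<and>
    mext (representation B) B \<phi> (as @ (c *s x) # bs) = c * mext (representation B) B \<phi> (as @ x #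
        bs)"
    for as x y c bs \<phi>
    by (induction as arbitrary: \<phi>)
       (simp_all add: representation_add[OF B(1)] representation_scale[OF B(1)] B(2)
         sum.distrib sum_distrib_left algebra_simps)
  then show ?thesis by (simp add: mlin_def)
qed

lemma mext_basis: "set bs \<subseteq> B \<Longrightarrow> mext (representation B) B \<phi> bs = \<phi> bs"
proof (induction bs arbitrary: \<phi>)
  case (Cons b bs)
  then have "mext (representation B) B \<phi> (b # bs) =
    (\<Sum>c\<in>B. if c = b then \<phi> (b # bs) else 0)"
    by (auto simp: representation_basis[OF B(1)] intro!: sum.cong)
  then show ?case using Cons.prems finite_basis[OF B] by simp
qed simp

lemma mext_mlin: "mlin w \<Longrightarrow> mext (representation B) B w xs = w xs"
proof (induction xs arbitrary: w)
  case (Cons x xs)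
  have "w (x # xs) = w ((\<Sum>b\<in>B. representation B x b *s b) # xs)"
    by (simp add: representation_sum[OF B])
  also have "\<dots> = (\<Sum>b\<in>B. representation B x b * w (b # xs))"
    by (simp add: mlin_sum[OF Cons.prems] mlinD[OF Cons.prems])
  finally show ?case by (simp add: Cons.IH mlin_Cons[OF Cons.prems])
qed simp

lemma mlin_eqI:
  assumes "mlin w" "mlin v" "\<And>bs. set bs \<subseteq> B \<Longrightarrow> w bs = v bs"
  shows "w = v"
proof
  fix xs show "w xs = v xs"
    using mext_cong[of B xs w v] mext_mlin assms by metis
qed

lemma mlin_proj: "mlin (proj B wt l w)"
  unfolding proj_def by (rule mlin_mext)

lemma proj_basis: "set bs \<subseteq> B \<Longrightarrow> proj B wt l w bs = (if wsum wt bs = l then w bs else 0)"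
  unfolding proj_def by (simp add: mext_basis)

lemma altn_proj:
  assumes "mlin w" "altn w"
  shows "altn (proj B wt l w)"
proof (rule adjacent_skew_altn)
  fix as x y bs
  have s: "wsum wt (as @ x # y # bs) = wsum wt (as @ y # x # bs)" for as bs x y
    by (rule ext) (simp add: wsum_def algebra_simps)
  have sk: "w (as @ x # y # bs) = - w (as @ y # x # bs)" for as x y bs
    using altn_skew[OF assms, of as x "[]"] by simp
  show "proj B wt l w (as @ x # y # bs) = - proj B wt l w (as @ y # x # bs)"
    unfolding proj_def
  proof (rule mext_skew)
    fix as x y bs
    show "(if wsum wt (as @ x # y # bs) = l then w (as @ x # y # bs) else 0) =
      - (if wsum wt (as @ y # x # bs) = l then w (as @ y # x # bs) else 0)"
      using sk[of as x y bs] by (simp only: s[of as x y bs]) auto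
  qed
qed

lemma supp_proj: "supp p w \<Longrightarrow> supp p (proj B wt l w)"
  unfolding supp_def
proof (intro allI impI)
  fix xs :: "'v list" assume "\<forall>xs. length xs \<noteq> p \<longrightarrow> w xs = 0" "length xs \<noteq> p"
  then have "proj B wt l w xs = mext (representation B) B (\<lambda>_. 0) xs"
    unfolding proj_def by (intro mext_cong) auto
  then show "proj B wt l w xs = 0" by (simp add: mext_0)
qed

lemma proj_add: "proj B wt l (\<lambda>ys. w ys + v ys) xs = proj B wt l w xs + proj B wt l v xs"
  unfolding proj_def mext_add[symmetric] by (rule mext_cong) simp

lemma proj_scale: "proj B wt l (\<lambda>ys. c * w ys) xs = c * proj B wt l w xs"
  unfolding proj_def mext_scale[symmetric] by (rule mext_cong) simp

lemma finite_wsums: "finite (wsums wt B p)"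
  unfolding wsums_def using finite_lists_length_eq[OF finite_basis[OF B]] by blast

lemma mlin_zero: "mlin (\<lambda>_. 0)"
  by (simp add: mlin_def)

lemma proj_outside:
  assumes "supp p w" "l \<notin> wsums wt B p"
  shows "proj B wt l w = (\<lambda>_. 0)"
proof (rule mlin_eqI[OF mlin_proj mlin_zero])
  show "proj B wt l w bs = 0" if "set bs \<subseteq> B" for bs
    using assms that by (auto simp: proj_basis supp_def wsums_def)
qed

lemma mlin_setsum: "(\<And>i. i \<in> I \<Longrightarrow> mlin (w i)) \<Longrightarrow> mlin (\<lambda>ys. \<Sum>i\<in>I. w i ys)"
  by (simp add: mlin_def sum.distrib sum_distrib_left)

lemma sum_proj:
  assumes "mlin w" "supp p w"
  shows "w = (\<lambda>ys. \<Sum>l\<in>wsums wt B p. proj B wt l w ys)"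
proof (rule mlin_eqI[OF assms(1) mlin_setsum[OF mlin_proj]])
  fix bs assume bs: "set bs \<subseteq> B"
  have "w bs = 0" if "wsum wt bs \<notin> wsums wt B p"
    using that bs assms(2) by (auto simp: wsums_def supp_def)
  then show "w bs = (\<Sum>l\<in>wsums wt B p. proj B wt l w bs)"
    unfolding proj_basis[OF bs] sum.delta'[OF finite_wsums] by simp
qed

context
  fixes E :: "'t \<Rightarrow> 'v \<Rightarrow> 'v" and wt :: "'v \<Rightarrow> 't \<Rightarrow> 'k"
  assumes E: "\<And>x. endo (E x)" and EB: "\<And>x b. b \<in> B \<Longrightarrow> E x b = wt b x *s b"
begin

lemma der_basis: "mlin w \<Longrightarrow> set bs \<subseteq> B \<Longrightarrow> der (E x) w bs = wsum wt bs x * w bs"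
proof (induction bs arbitrary: w)
  case (Cons b bs)
  then show ?case using Cons.IH[OF mlin_Cons[OF Cons.prems(1)], of b]
    by (simp add: EB mlinD[OF Cons.prems(1)] wsum_def algebra_simps)
qed (simp add: wsum_def)

lemma mlin_scale: "mlin w \<Longrightarrow> mlin (\<lambda>ys. c * w ys)"
  by (simp add: mlin_def algebra_simps)

lemma der_proj: "der (E x) (proj B wt l w) = (\<lambda>ys. l x * proj B wt l w ys)"
  by (rule mlin_eqI)
     (auto intro: mlin_der mlin_proj mlin_scale E simp: der_basis mlin_proj proj_basis)

lemma proj_weight:
  assumes w: "mlin w" and l: "\<And>x. der (E x) w = (\<lambda>ys. l x * w ys)"
  shows "proj B wt k w = (if k = l then w else (\<lambda>_. 0))"
proof (rule mlin_eqI[OF mlin_proj])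
  have *: "w bs = 0" if "wsum wt bs \<noteq> l" "set bs \<subseteq> B" for bs
  proof -
    obtain x where "wsum wt bs x \<noteq> l x" using \<open>wsum wt bs \<noteq> l\<close> by blast
    moreover have "wsum wt bs x * w bs = l x * w bs"
      using der_basis[OF w that(2), of x] l by metis
    ultimately show ?thesis by simp
  qed
  fix bs assume "set bs \<subseteq> B"
  then show "proj B wt k w bs = (if k = l then w else (\<lambda>_. 0)) bs"
    using * by (auto simp: proj_basis)
qed (simp add: w mlin_zero)

text \<open>By \<open>cdiff_der\<close> the differential preserves the weight of a form, so it may
  be applied separately to the weight components of \<open>w\<close>.\<close>

lemma proj_cdiff:
  assumes m: "m \<in> alt_bilinear scale"
    and h: "\<And>x y. h (x + y) = h x + h y" "\<And>c x. h (c *s x) = c * h x"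
    and der: "\<And>x y z. E x (m y z) = m (E x y) z + m y (E x z)" and hE: "\<And>x y. h (E x y) = 0"
    and w: "mlin w" "supp p w"
  shows "proj B wt l (cdiff m h w) = cdiff m h (proj B wt l w)"
proof -
  have mc: "mlin v \<Longrightarrow> mlin (cdiff m h v)" for v by (rule mlin_cdiff[OF m h])
  have pk: "proj B wt l (cdiff m h (proj B wt k w)) =
    (if l = k then cdiff m h (proj B wt k w) else (\<lambda>_. 0))" for k
  proof (rule proj_weight)
    show "mlin (cdiff m h (proj B wt k w))" by (intro mc mlin_proj)
    show "der (E x) (cdiff m h (proj B wt k w)) = (\<lambda>ys. k x * cdiff m h (proj B wt k w) ys)" for x
    proof
      fix ys
      have "der (E x) (cdiff m h (proj B wt k w)) ys = cdiff m h (der (E x) (proj B wt k w)) ys"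
        using cdiff_der[where D = "E x" and m = m and l = h and w = "proj B wt k w"] E der hE
            mlin_proj
        by metis
      then show "der (E x) (cdiff m h (proj B wt k w)) ys = k x * cdiff m h (proj B wt k w) ys"
        by (simp add: der_proj cdiff_scale)
    qed
  qed
  have ps: "proj B wt l (\<lambda>ys. \<Sum>i\<in>I. v i ys) xs = (\<Sum>i\<in>I. proj B wt l (v i) xs)"
    for I and v :: "('t \<Rightarrow> 'k) \<Rightarrow> 'v list \<Rightarrow> 'k" and xs
  proof (induction I rule: infinite_finite_induct)
    case (insert x F)
    then show ?case by (simp add: proj_add)
  qed (use proj_scale[of wt l 0 "\<lambda>_. 0"] in simp_all)
  have "cdiff m h w = (\<lambda>ys. \<Sum>k\<in>wsums wt B p. cdiff m h (proj B wt k w) ys)"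
    using arg_cong[OF sum_proj[OF w, of wt], of "cdiff m h"] by (auto simp: cdiff_sum)
  then have "proj B wt l (cdiff m h w) xs =
      (\<Sum>k\<in>wsums wt B p. if l = k then cdiff m h (proj B wt k w) xs else 0)" for xs
    by (simp only: ps pk) (rule sum.cong; simp)
  then have "proj B wt l (cdiff m h w) xs = cdiff m h (proj B wt l w) xs" for xs
    unfolding sum.delta'[OF finite_wsums] using proj_outside[OF w(2), of l wt] by auto
  then show ?thesis by blast
qed

end

end

end

section \<open>Closed and exact forms, and the homotopy argument\<close>

context alg_closed_vector_space
begin

definition forms :: "nat \<Rightarrow> ('v list \<Rightarrow> 'k) set" where
  "forms p = {w. mlin w \<and> altn w \<and> supp p w}"

definition closed_forms where
  "closed_forms m l p = {w \<in> forms p. cdiff m l w = (\<lambda>_. 0)}"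

text \<open>The support condition says that \<open>v\<close> has degree \<open>p - 1\<close> but
  avoids subtraction: at \<open>p = 0\<close> it forces \<open>v = 0\<close>, so no case distinction
  is required.\<close>

definition exact_forms where
  "exact_forms m l p = {cdiff m l v | v. mlin v \<and> altn v \<and> (\<forall>xs. Suc (length xs) \<noteq> p \<longrightarrow> v xs = 0)}"

lemma exact_forms_subspace:
  "(\<lambda>_. 0) \<in> exact_forms m l p"
  "v \<in> exact_forms m l p \<Longrightarrow> w \<in> exact_forms m l p \<Longrightarrow> (\<lambda>ys. v ys + w ys) \<in> exact_forms m l p"
  "v \<in> exact_forms m l p \<Longrightarrow> (\<lambda>ys. c * v ys) \<in> exact_forms m l p"
proof -
  show "(\<lambda>_. 0) \<in> exact_forms m l p"
    unfolding exact_forms_def by (auto intro!: exI[of _ "\<lambda>_. 0"] simp: mlin_def altn_def)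
  show "(\<lambda>ys. v ys + w ys) \<in> exact_forms m l p"
    if vw: "v \<in> exact_forms m l p" "w \<in> exact_forms m l p"
  proof -
    obtain v' w' where "mlin v'" "altn v'" "\<forall>xs. Suc (length xs) \<noteq> p \<longrightarrow> v' xs = 0" "v = cdiff m l v'"
      "mlin w'" "altn w'" "\<forall>xs. Suc (length xs) \<noteq> p \<longrightarrow> w' xs = 0" "w = cdiff m l w'"
      using vw unfolding exact_forms_def by blast
    then show ?thesis
      unfolding exact_forms_def
      by (auto intro!: exI[of _ "\<lambda>ys. v' ys + w' ys"] simp: mlin_def altn_def cdiff_add
          algebra_simps)
  qed
  show "(\<lambda>ys. c * v ys) \<in> exact_forms m l p" if v: "v \<in> exact_forms m l p"
  proof -
    obtain v' where "mlin v'" "altn v'" "\<forall>xs. Suc (length xs) \<noteq> p \<longrightarrow> v' xs = 0" "v = cdiff m l v'"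
      using v unfolding exact_forms_def by blast
    then show ?thesis
      unfolding exact_forms_def
      by (auto intro!: exI[of _ "\<lambda>ys. c * v' ys"] simp: mlin_def altn_def cdiff_scale algebra_simps)
  qed
qed

text \<open>By Cartan's formula \<open>l a - der (m a)\<close> is homotopic to \<open>0\<close>, and on the
  \<open>c\<close>-eigenspace of \<open>der g\<close> it is the nonzero scalar \<open>l a - c\<close> minus a nilpotent map.\<close>

lemma closed_form_exact:
  assumes f: "endo f" "\<And>x. (f ^^ k) x = 0" "\<And>x y. f (m x y) = m (f x) y + m x (f y)"
      "\<And>x. l (f x) = 0"
    and g: "endo g" "\<And>x. g (f x) = f (g x)" and a: "\<And>y. m a y = f y + g y" and c: "l a \<noteq> c"
    and w: "w \<in> closed_forms m l p" "der g w = (\<lambda>ys. c * w ys)"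
  shows "w \<in> exact_forms m l p"
proof -
  have wp: "mlin w" "supp p w" using w by (auto simp: closed_forms_def forms_def)
  have "(der f ^^ j) v = (\<lambda>_. 0) \<Longrightarrow> v \<in> closed_forms m l p \<Longrightarrow> der g v = (\<lambda>ys. c * v ys) \<Longrightarrow>
      v \<in> exact_forms m l p" for j v
  proof (induction j arbitrary: v)
    case 0
    then show ?case using exact_forms_subspace(1) by simp
  next
    case (Suc j)
    have v: "mlin v" "altn v" "supp p v" "cdiff m l v = (\<lambda>_. 0)"
      using Suc.prems(2) by (auto simp: closed_forms_def forms_def)
    have "der f v \<in> exact_forms m l p"
    proof (rule Suc.IH)
      show "(der f ^^ j) (der f v) = (\<lambda>_. 0)" using Suc.prems(1) by (simp add: funpow_swap1)
      have "cdiff m l (der f v) xs = 0" for xs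
        using cdiff_der[where D = f and m = m and l = l, OF f(1,3,4) v(1)] v(4) by simp
      then show "der f v \<in> closed_forms m l p"
        using v by (auto simp: closed_forms_def forms_def intro: mlin_der altn_der supp_der f)
      have "der g (der f v) xs = der f (der g v) xs" for xs
        using der_commutator[OF v(1), of g f xs] g(2) by (simp add: der_fun_0[OF v(1)])
      then show "der g (der f v) = (\<lambda>ys. c * der f v ys)"
        using Suc.prems(3) by (auto simp: der_scale)
    qed
    moreover have "cdiff m l (\<lambda>ys. v (a # ys)) \<in> exact_forms m l p"
      using v unfolding exact_forms_def
      by (auto intro!: exI[of _ "\<lambda>ys. v (a # ys)"] mlin_Cons altn_Cons simp: supp_def)
    ultimately have "(\<lambda>ys. inverse (l a - c) * (cdiff m l (\<lambda>ys. v (a # ys)) ys + der f v ys))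
        \<in> exact_forms m l p"
      by (intro exact_forms_subspace)
    moreover have "inverse (l a - c) * (cdiff m l (\<lambda>ys. v (a # ys)) ys + der f v ys) = v ys" for ys
    proof -
      have ma: "m a = (\<lambda>y. f y + g y)" by (rule ext) (rule a)
      \<comment> \<open>This is Cartan's formula. It expresses \<open>(l a - c)\<close> times
        \<open>v\<close> as the differential of the contraction with \<open>a\<close> plus
        \<open>der f v\<close>, and the latter is exact by induction.\<close>
      have "0 = cdiff m l v (a # ys)" using v(4) by simp
      also have "\<dots> = (l a - c) * v ys - der f v ys - cdiff m l (\<lambda>ys. v (a # ys)) ys"
        by (simp add: ma der_fun_add[OF v(1)] Suc.prems(3) algebra_simps)
      finally have "cdiff m l (\<lambda>ys. v (a # ys)) ys + der f v ys = (l a - c) * v ys"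
        by (simp add: algebra_simps)
      then show ?thesis using c by simp
    qed
    ultimately show ?case by simp
  qed
  moreover obtain j where "(der f ^^ j) w = (\<lambda>_. 0)" using der_nilpotent[OF f(1,2) wp] by blast
  ultimately show ?thesis using w by blast
qed

end

subsection \<open>Dimension of record modules\<close>

text \<open>The weaker second premise is adapted to images of generating sets, which may lose
  elements.\<close>

lemma Least_eqI:
  fixes P Q :: "nat \<Rightarrow> bool"
  assumes PQ: "\<And>n. P n \<Longrightarrow> Q n" and QP: "\<And>n. Q n \<Longrightarrow> \<exists>m\<le>n. P m"
  shows "Least P = Least Q"
proof (cases "\<exists>n. P n")
  case True
  then have P: "P (Least P)" by (rule LeastI_ex)
  then have Q: "Q (Least Q)" using PQ by (blast intro: LeastI)
  then obtain m where "m \<le> Least Q" "P m" using QP by blast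
  then have "Least P \<le> Least Q" by (meson Least_le le_trans)
  moreover have "Least Q \<le> Least P" using P PQ by (blast intro: Least_le)
  ultimately show ?thesis by simp
next
  case False
  then have "P = Q" using QP by blast
  then show ?thesis by simp
qed

text \<open>A record module that is the image of a subspace under a linear map; the axioms of a vector
  space need not be checked for the record.\<close>

locale module_image = vector_space scale
  for scale :: "'k::field \<Rightarrow> 'v::ab_group_add \<Rightarrow> 'v" (infixr "*s" 75) +
  fixes Z :: "'v set" and \<Phi> :: "'v \<Rightarrow> 'c" and M :: "('k, 'c) module"
  assumes Z: "subspace Z"
    and carrier: "carrier M = \<Phi> ` Z"
    and zero: "\<zero>\<^bsub>M\<^esub> = \<Phi> 0"
    and add: "\<And>y z. y \<in> Z \<Longrightarrow> z \<in> Z \<Longrightarrow> \<Phi> y \<oplus>\<^bsub>M\<^esub> \<Phi> z = \<Phi> (y + z)"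
    and smult: "\<And>c z. z \<in> Z \<Longrightarrow> c \<odot>\<^bsub>M\<^esub> \<Phi> z = \<Phi> (c *s z)"
begin

lemma vectorspace: "vectorspace class_ring M"
proof -
  have g: "abelian_group M"
  proof (rule abelian_groupI)
    fix x assume "x \<in> carrier M"
    then obtain z where z: "z \<in> Z" "x = \<Phi> z" by (auto simp: carrier)
    then have "\<Phi> (- z) \<oplus>\<^bsub>M\<^esub> x = \<zero>\<^bsub>M\<^esub>" using Z by (simp add: add zero subspace_neg)
    then show "\<exists>y\<in>carrier M. y \<oplus>\<^bsub>M\<^esub> x = \<zero>\<^bsub>M\<^esub>" using z Z by (auto simp: carrier subspace_neg)
  qed (use Z in \<open>auto simp: carrier zero add subspace_add subspace_0 ac_simps\<close>)
  have "Module.module class_ring M"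
    by (rule Module.module.intro[OF _ g])
       (use Z in \<open>auto simp: Module.module_axioms_def carrier add smult subspace_scale subspace_add
         scale_left_distrib scale_right_distrib
         domain.axioms(1)[OF field.axioms(1)[OF class_field]]\<close>)
  then show ?thesis by (simp add: vectorspace_def class_field)
qed

lemma span_\<Phi>:
  assumes S: "S \<subseteq> Z"
  shows "LinearCombinations.module.span class_ring M (\<Phi> ` S) = \<Phi> ` span S"
proof -
  interpret M: vectorspace class_ring M by (rule vectorspace)
  have sZ: "span S \<subseteq> Z" using S Z by (rule span_minimal)
  have "LinearCombinations.submodule class_ring (\<Phi> ` span S) M"
  proof (rule LinearCombinations.submodule.intro)
    show "Module.module class_ring M" by (rule M.module_axioms)
    show "\<Phi> ` span S \<subseteq> carrier M" using sZ by (auto simp: carrier)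
    show "\<zero>\<^bsub>M\<^esub> \<in> \<Phi> ` span S" by (auto simp: zero span_zero)
    show "v \<oplus>\<^bsub>M\<^esub> w \<in> \<Phi> ` span S" if vw: "v \<in> \<Phi> ` span S" "w \<in> \<Phi> ` span S" for v w
    proof -
      obtain y z where "y \<in> span S" "z \<in> span S" "v = \<Phi> y" "w = \<Phi> z" using vw by blast
      then show ?thesis using sZ by (auto simp: add subset_iff intro: span_add)
    qed
    show "c \<odot>\<^bsub>M\<^esub> v \<in> \<Phi> ` span S" if v: "v \<in> \<Phi> ` span S" for c v
    proof -
      obtain y where "y \<in> span S" "v = \<Phi> y" using v by blast
      then show ?thesis using sZ by (auto simp: smult subset_iff intro: span_scale)
    qed
  qed
  then have "M.span (\<Phi> ` S) \<subseteq> \<Phi> ` span S"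
    by (intro M.span_is_subset) (auto intro: span_base)
  moreover have "\<Phi> ` span S \<subseteq> M.span (\<Phi> ` S)"
  proof -
    have SC: "\<Phi> ` S \<subseteq> carrier M" using S by (auto simp: carrier)
    have sub: "LinearCombinations.submodule class_ring (M.span (\<Phi> ` S)) M"
      by (rule M.span_is_submodule[OF SC])
    have "span S \<subseteq> {z \<in> Z. \<Phi> z \<in> M.span (\<Phi> ` S)}"
    proof (rule span_minimal)
      show "S \<subseteq> {z \<in> Z. \<Phi> z \<in> M.span (\<Phi> ` S)}" using S M.in_own_span[OF SC] by auto
      show "subspace {z \<in> Z. \<Phi> z \<in> M.span (\<Phi> ` S)}"
      proof (rule subspaceI)
        show "0 \<in> {z \<in> Z. \<Phi> z \<in> M.span (\<Phi> ` S)}"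
          using LinearCombinations.submodule.zero_closed[OF sub] Z by (simp add: zero subspace_0)
        show "x + y \<in> {z \<in> Z. \<Phi> z \<in> M.span (\<Phi> ` S)}"
          if "x \<in> {z \<in> Z. \<Phi> z \<in> M.span (\<Phi> ` S)}" "y \<in> {z \<in> Z. \<Phi> z \<in> M.span (\<Phi> ` S)}" for x y
          using LinearCombinations.submodule.m_closed[OF sub, of "\<Phi> x" "\<Phi> y"] that Z
          by (simp add: add subspace_add)
        show "c *s x \<in> {z \<in> Z. \<Phi> z \<in> M.span (\<Phi> ` S)}"
          if "x \<in> {z \<in> Z. \<Phi> z \<in> M.span (\<Phi> ` S)}" for c x
          using LinearCombinations.submodule.smult_closed[OF sub, of c "\<Phi> x"] that Z
          by (simp add: smult subspace_scale)
      qed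
    qed
    then show ?thesis by blast
  qed
  ultimately show ?thesis by blast
qed

text \<open>On the right the record enters only through equality of values of \<open>\<Phi>\<close>.
  Two images of \<open>Z\<close> with the same fibres can then be compared directly.\<close>

lemma rdim_eq:
  "rdim M = (LEAST n. \<exists>S. S \<subseteq> Z \<and> finite S \<and> card S = n \<and> (\<forall>z\<in>Z. \<exists>y\<in>span S. \<Phi> z = \<Phi> y))"
proof -
  interpret M: vectorspace class_ring M by (rule vectorspace)
  have gen: "M.span (\<Phi> ` S) = carrier M \<longleftrightarrow> (\<forall>z\<in>Z. \<exists>y\<in>span S. \<Phi> z = \<Phi> y)" if S: "S \<subseteq> Z" for S
    using span_\<Phi>[OF S] span_minimal[OF S Z] by (auto simp: carrier)
  show ?thesis
    unfolding rdim_def M.dim_def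
  proof (rule Least_eqI)
    fix n assume "\<exists>A. finite A \<and> card A = n \<and> A \<subseteq> carrier M \<and> M.span A = carrier M"
    then obtain A where A: "finite A" "card A = n" "A \<subseteq> carrier M" "M.span A = carrier M" by blast
    \<comment> \<open>Chosen preimages of a generating set are in bijection with it, so its size is
      kept.\<close>
    define S where "S = inv_into Z \<Phi> ` A"
    have AS: "\<Phi> ` S = A" using A(3) unfolding S_def carrier by (simp add: image_inv_into_cancel)
    have SZ: "S \<subseteq> Z" using A(3) unfolding S_def carrier by (auto intro: inv_into_into)
    have "card S = n" "finite S"
      using A(1-3) unfolding S_def carrier by (auto simp: card_image inj_on_inv_into)
    then show "\<exists>S. S \<subseteq> Z \<and> finite S \<and> card S = n \<and> (\<forall>z\<in>Z. \<exists>y\<in>span S. \<Phi> z = \<Phi> y)"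
      using SZ gen[OF SZ] A(4) AS by blast
  next
    fix n assume "\<exists>S. S \<subseteq> Z \<and> finite S \<and> card S = n \<and> (\<forall>z\<in>Z. \<exists>y\<in>span S. \<Phi> z = \<Phi> y)"
    then obtain S where S: "S \<subseteq> Z" "finite S" "card S = n" "\<forall>z\<in>Z. \<exists>y\<in>span S. \<Phi> z = \<Phi> y" by blast
    have "finite (\<Phi> ` S)" "card (\<Phi> ` S) \<le> n" "\<Phi> ` S \<subseteq> carrier M" "M.span (\<Phi> ` S) = carrier M"
      using S gen[OF S(1)] card_image_le[OF S(2), of \<Phi>] by (auto simp: carrier)
    then show "\<exists>m\<le>n. \<exists>A. finite A \<and> card A = m \<and> A \<subseteq> carrier M \<and> M.span A = carrier M" by blast
  qed
qed

lemma rdim_inj: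
  assumes inj: "inj_on \<Phi> Z" and fin: "finite T" "Z \<subseteq> span T"
  shows "rdim M = dim Z"
  unfolding rdim_eq
proof (rule Least_equality)
  obtain B where B: "B \<subseteq> Z" "independent B" "Z \<subseteq> span B" "card B = dim Z"
    using basis_exists by blast
  have "finite B" using independent_span_bound[OF fin(1) B(2)] B(1) fin(2) by blast
  then show "\<exists>S. S \<subseteq> Z \<and> finite S \<and> card S = dim Z \<and> (\<forall>z\<in>Z. \<exists>y\<in>span S. \<Phi> z = \<Phi> y)"
    using B by blast
  fix n assume "\<exists>S. S \<subseteq> Z \<and> finite S \<and> card S = n \<and> (\<forall>z\<in>Z. \<exists>y\<in>span S. \<Phi> z = \<Phi> y)"
  then obtain S where S: "S \<subseteq> Z" "finite S" "card S = n" "\<forall>z\<in>Z. \<exists>y\<in>span S. \<Phi> z = \<Phi> y" by blast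
  have "Z \<subseteq> span S"
  proof
    fix z assume z: "z \<in> Z"
    then obtain y where y: "y \<in> span S" "\<Phi> z = \<Phi> y" using S(4) by blast
    moreover have "y \<in> Z" using span_minimal[OF S(1) Z] y(1) by blast
    ultimately show "z \<in> span S" using inj z by (metis inj_onD)
  qed
  then show "dim Z \<le> n" using dim_le_card S by blast
qed

end

lemma rdim_cong:
  assumes M: "module_image sc Z \<Phi> M" and M': "module_image sc Z \<Phi>' M'"
    and ker: "\<And>y z. y \<in> Z \<Longrightarrow> z \<in> Z \<Longrightarrow> \<Phi> y = \<Phi> z \<longleftrightarrow> \<Phi>' y = \<Phi>' z"
  shows "rdim M = rdim M'"
proof -
  interpret A: module_image sc Z \<Phi> M by (rule M)
  interpret B: module_image sc Z \<Phi>' M' by (rule M')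
  have "(\<forall>z\<in>Z. \<exists>y\<in>A.span S. \<Phi> z = \<Phi> y) \<longleftrightarrow> (\<forall>z\<in>Z. \<exists>y\<in>A.span S. \<Phi>' z = \<Phi>' y)"
    if "S \<subseteq> Z" for S
  proof (intro ball_cong bex_cong refl)
    fix z y assume "z \<in> Z" "y \<in> A.span S"
    then show "\<Phi> z = \<Phi> y \<longleftrightarrow> \<Phi>' z = \<Phi>' y"
      using A.span_minimal[OF that A.Z] by (intro ker) auto
  qed
  then show ?thesis
    unfolding A.rdim_eq B.rdim_eq by (intro arg_cong[where f = Least] ext ex_cong1 conj_cong refl)
qed

subsection \<open>Irreducible modules of solvable Lie algebras\<close>

lemma vector_space_fscale:
  assumes "vector_space sc"
  shows "vector_space (fscale sc)"
proof -
  interpret vector_space sc by fact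
  show ?thesis
    by unfold_locales
       (auto simp: fscale_def scale_left_distrib scale_right_distrib plus_fun_def)
qed

lemma vector_space_mult: "vector_space ((*) :: 'k::field \<Rightarrow> 'k \<Rightarrow> 'k)"
  by unfold_locales (auto simp: algebra_simps)

definition is_char ::
  "('k::field, 's) std_module \<Rightarrow> (nat \<Rightarrow> 'k) \<Rightarrow> ('s \<Rightarrow> 'k) \<Rightarrow> bool" where
  "is_char M v l \<longleftrightarrow> v \<noteq> 0 \<and> fst M = lspan std_scale {v} \<and> (\<forall>x. snd M x v = std_scale (l x) v)"

definition vec_form :: "(nat \<Rightarrow> 'k::field) \<Rightarrow> ('s list \<Rightarrow> 'k) \<Rightarrow> 's list \<Rightarrow> nat \<Rightarrow> 'k" where
  "vec_form v w = (\<lambda>xs. std_scale (w xs) v)"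

context alg_closed_fd_vector_space
begin

interpretation std: alg_closed_vector_space "std_scale :: 'k \<Rightarrow> (nat \<Rightarrow> 'k) \<Rightarrow> nat \<Rightarrow> 'k"
  by (intro alg_closed_vector_space.intro vector_space_fscale vector_space_mult)

text \<open>Lie's theorem modulo \<open>{0}\<close> yields a common eigenvector; the line through it
  is a submodule and hence everything.\<close>

lemma irrep_has_char:
  assumes m: "m \<in> alt_bilinear scale" and chain: "lie_chain scale m UNIV" and M: "M \<in> irreps
      scale m"
  shows "\<exists>v l. is_char M v l"
proof -
  obtain V \<rho> where [simp]: "M = (V, \<rho>)" by (cases M)
  have ir: "irreducible_module scale m std_scale (V, \<rho>)" using M by (simp add: irreps_def)
  then have fm: "fd_lie_module scale m std_scale (V, \<rho>)" and V0: "V \<noteq> {0}"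
    and irr: "\<And>W. std.subspace W \<Longrightarrow> W \<subseteq> V \<Longrightarrow> (\<And>x. \<rho> x ` W \<subseteq> W) \<Longrightarrow> W = {0} \<or> W = V"
    by (auto simp: irreducible_module_def)
  have V: "std.subspace V" and lb: "\<And>x. linear_between std_scale std_scale V V (\<rho> x)"
    and lin: "\<And>v. v \<in> V \<Longrightarrow> Vector_Spaces.linear scale std_scale (\<lambda>x. \<rho> x v)"
    and br: "\<And>x y v. v \<in> V \<Longrightarrow> \<rho> (m x y) v = \<rho> x (\<rho> y v) - \<rho> y (\<rho> x v)"
    using fm by (auto simp: fd_lie_module_def)
  obtain T where T: "finite T" "std.span T = V" using fm by (auto simp: fd_lie_module_def)
  have "\<exists>v\<in>V - {0}. \<exists>l. \<forall>x\<in>UNIV. \<rho> x v - std_scale (l x) v \<in> {0}"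
    by (rule std.lie_theorem_relative[OF vector_space_axioms m V _ _ _ T(1), of "{0}" \<rho> UNIV])
       (use std.subspace_0[OF V] V0 T(2) lin chain lb br std.linear_between_0[OF lb V] in auto)
  then obtain v l where v: "v \<in> V" "v \<noteq> 0" "\<And>x. \<rho> x v = std_scale (l x) v" by auto
  have sub: "std.span {v} \<subseteq> V" using v(1) V by (intro std.span_minimal) auto
  have "\<rho> x ` std.span {v} \<subseteq> std.span {v}" for x
  proof
    fix u assume "u \<in> \<rho> x ` std.span {v}"
    then obtain c where "u = \<rho> x (std_scale c v)" by (auto simp: std.span_singleton)
    then have "u = std_scale (c * l x) v"
      using linear_betweenD(3)[OF lb v(1)] by (simp add: v(3) del: std.scale_scale add:
          std.scale_scale)
    then show "u \<in> std.span {v}" by (auto simp: std.span_singleton)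
  qed
  then have "std.span {v} = {0} \<or> std.span {v} = V" using irr sub by simp
  then have "std.span {v} = V" using v(2) std.span_base[of v "{v}"] by auto
  then show ?thesis using v by (auto simp: is_char_def)
qed

lemma char_linear:
  assumes M: "M \<in> irreps scale m" and c: "is_char M v l"
  shows "l (x + y) = l x + l y" "l (a *s x) = a * l x" "l (m x y) = 0"
proof -
  obtain V \<rho> where [simp]: "M = (V, \<rho>)" by (cases M)
  have fm: "fd_lie_module scale m std_scale (V, \<rho>)"
    using M by (simp add: irreps_def irreducible_module_def)
  have v: "v \<in> V" "v \<noteq> 0" "\<And>x. \<rho> x v = std_scale (l x) v"
    using c std.span_base[of v "{v}"] by (auto simp: is_char_def)
  have lb: "\<And>x. linear_between std_scale std_scale V V (\<rho> x)"
    and lin: "Vector_Spaces.linear scale std_scale (\<lambda>x. \<rho> x v)"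
    and br: "\<And>x y. \<rho> (m x y) v = \<rho> x (\<rho> y v) - \<rho> y (\<rho> x v)"
    using fm v(1) by (auto simp: fd_lie_module_def)
  have "std_scale (l (x + y)) v = std_scale (l x + l y) v"
    "std_scale (l (a *s x)) v = std_scale (a * l x) v"
    using lin by (auto simp: Vector_Spaces.linear_iff v(3) std.scale_left_distrib)
  then show "l (x + y) = l x + l y" "l (a *s x) = a * l x"
    using v(2) std.scale_cancel_right by blast+
  have "std_scale (l (m x y)) v = std_scale 0 v"
    using br[of x y] linear_betweenD(3)[OF lb v(1)] by (simp add: v(3) mult.commute)
  then show "l (m x y) = 0" using v(2) std.scale_cancel_right by blast
qed

lemma char_action:
  assumes M: "M \<in> irreps scale m" and c: "is_char M v l"
  shows "snd M x (std_scale a v) = std_scale (l x * a) v"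
proof -
  obtain V \<rho> where [simp]: "M = (V, \<rho>)" by (cases M)
  have lb: "linear_between std_scale std_scale V V (\<rho> x)"
    using M by (simp add: irreps_def irreducible_module_def fd_lie_module_def)
  have "v \<in> V" using c std.span_base[of v "{v}"] by (auto simp: is_char_def)
  then show ?thesis using linear_betweenD(3)[OF lb] c by (simp add: is_char_def mult.commute)
qed

lemma iso_iff_char_eq:
  assumes M: "M \<in> irreps scale m" "is_char M v l" and M': "M' \<in> irreps scale m'" "is_char M' v' l'"
  shows "module_iso std_scale std_scale M M' \<longleftrightarrow> l = l'"
proof
  have V: "fst M = std.span {v}" "fst M' = std.span {v'}" "v \<noteq> 0" "v' \<noteq> 0"
    using assms by (auto simp: is_char_def)
  {
    assume "module_iso std_scale std_scale M M'"
    then obtain f where f: "linear_between std_scale std_scale (fst M) (fst M') f" "bij_betw f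
        (fst M) (fst M')"
      "\<And>x u. u \<in> fst M \<Longrightarrow> f (snd M x u) = snd M' x (f u)"
      by (auto simp: module_iso_def split: prod.splits)
    have vV: "v \<in> fst M" by (simp add: V std.span_base)
    have "f v \<in> fst M'" using linear_betweenD(1)[OF f(1) vV] .
    then obtain c where c: "f v = std_scale c v'" by (auto simp: V std.span_singleton)
    have f0: "f 0 = 0" using linear_betweenD(3)[OF f(1) vV, of 0] by simp
    have "f v \<noteq> 0"
      using f(2) f0 V(3) vV std.span_zero[of "{v}"] unfolding bij_betw_def inj_on_def V(1) by metis
    then have c0: "c \<noteq> 0" using c by auto
    have "l x = l' x" for x
    proof -
      have "std_scale (l x * c) v' = std_scale (l' x * c) v'"
        using f(3)[OF vV, of x] char_action[OF M, of x 1] char_action[OF M', of x c]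
          linear_betweenD(3)[OF f(1) vV, of "l x"] by (simp add: c)
      then show ?thesis using V(4) c0 by simp
    qed
    then show "l = l'" by blast
  }
  assume ll: "l = l'"
  define co where "co = (\<lambda>u. SOME c. u = std_scale c v)"
  have co: "co (std_scale c v) = c" for c
    unfolding co_def using V(3) by (intro some_equality) auto
  define f where "f = (\<lambda>u. std_scale (co u) v')"
  have f: "f (std_scale c v) = std_scale c v'" for c by (simp add: f_def co)
  have "linear_between std_scale std_scale (fst M) (fst M') f"
    unfolding linear_between_def V std.span_singleton
    using f by (auto simp: std.scale_left_distrib[symmetric])
  moreover have "bij_betw f (fst M) (fst M')"
    unfolding bij_betw_def V std.span_singleton
  proof
    show "inj_on f (range (\<lambda>k. std_scale k v))" by (rule inj_onI) (use f V(4) in auto)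
    show "f ` range (\<lambda>k. std_scale k v) = range (\<lambda>k. std_scale k v')" using f by (auto simp:
        image_image)
  qed
  moreover have "f (snd M x u) = snd M' x (f u)" if "u \<in> fst M" for x u
    using that char_action[OF M, of x] char_action[OF M', of x]
    by (auto simp: V std.span_singleton f ll)
  ultimately show "module_iso std_scale std_scale M M'"
    unfolding module_iso_def by (auto split: prod.splits)
qed

lemma char_exists:
  assumes m: "m \<in> alt_bilinear scale"
    and l: "\<And>x y. l (x + y) = l x + l y" "\<And>c x. l (c *s x) = c * l x" "\<And>x y. l (m x y) = 0"
  shows "\<exists>M\<in>irreps scale m. \<exists>v. is_char M v l"
proof -
  \<comment> \<open>Any nonzero vector would serve to span the line that carries the
    character.\<close>
  define v :: "nat \<Rightarrow> 'k" where "v = (\<lambda>_. 1)"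
  have v0: "v \<noteq> 0" by (auto simp: v_def fun_eq_iff)
  define M :: "('k, 'v) std_module" where "M = (std.span {v}, \<lambda>x u. std_scale (l x) u)"
  have "is_char M v l" using v0 by (simp add: is_char_def M_def)
  moreover have "M \<in> irreps scale m"
  proof -
    have fm: "fd_lie_module scale m std_scale (std.span {v}, \<lambda>x u. std_scale (l x) u)"
      unfolding fd_lie_module_def
    proof (clarsimp, intro conjI allI ballI)
      show "\<exists>B. finite B \<and> std.span B = std.span {v}" by (rule exI[of _ "{v}"]) simp
      show "linear_between std_scale std_scale (std.span {v}) (std.span {v}) (std_scale (l x))"
          for x
        by (auto simp: linear_between_def std.scale_right_distrib mult.commute intro:
            std.span_scale)
      show "Vector_Spaces.linear scale std_scale (\<lambda>x. std_scale (l x) u)" for u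
        unfolding Vector_Spaces.linear_iff
        using vector_space_axioms std.vector_space_axioms by (auto simp: l std.scale_left_distrib)
    qed (simp_all add: l mult.commute)
    have "W = {0} \<or> W = std.span {v}" if W: "std.subspace W" "W \<subseteq> std.span {v}" for W
    proof (cases "W = {0}")
      case False
      then obtain w where w: "w \<in> W" "w \<noteq> 0" using std.subspace_0[OF W(1)] by auto
      then obtain c where c: "w = std_scale c v" using W(2) by (auto simp: std.span_singleton)
      then have "c \<noteq> 0" using w(2) by auto
      then have "v = std_scale (inverse c) w" by (simp add: c)
      then have "v \<in> W" using std.subspace_scale[OF W(1) w(1)] by simp
      then have "std.span {v} \<subseteq> W" using W(1) by (intro std.span_minimal) auto
      then show ?thesis using W(2) by blast
    qed simp
    moreover have "std.span {v} \<noteq> {0}" using v0 std.span_base[of v "{v}"] by auto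
    ultimately show ?thesis using fm by (simp add: irreps_def irreducible_module_def M_def)
  qed
  ultimately show ?thesis by blast
qed

lemma cochains_line:
  assumes v: "v \<noteq> 0"
  shows "cochains scale std_scale (std.span {v}) p = vec_form v ` forms p"
proof
  show "cochains scale std_scale (std.span {v}) p \<subseteq> vec_form v ` forms p"
  proof
    fix f assume f: "f \<in> cochains scale std_scale (std.span {v}) p"
    have 1: "f xs = 0" if "length xs \<noteq> p" for xs using f that by (simp add: cochains_def)
    have 2: "Vector_Spaces.linear scale std_scale (\<lambda>x. f (xs[i := x]))" if "length xs = p" "i <
        p" for xs i
      using f that by (simp add: cochains_def)
    have 3: "f xs = 0" if "length xs = p" "i < j" "j < p" "xs ! i = xs ! j" for xs i j
      using f that unfolding cochains_def by blast
    have "\<exists>c. f xs = std_scale c v" for xs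
    proof (cases "length xs = p")
      case True
      then have "f xs \<in> std.span {v}" using f by (simp add: cochains_def)
      then show ?thesis by (auto simp: std.span_singleton)
    next
      case False
      then show ?thesis using 1 by (intro exI[of _ 0]) simp
    qed
    then obtain w where w: "\<And>xs. f xs = std_scale (w xs) v" by metis
    have w0: "w xs = 0" if "f xs = 0" for xs using that v by (simp add: w)
    have "mlin w"
      unfolding mlin_def
    proof (intro conjI allI)
      fix as bs :: "'v list" and x y c
      have up: "(as @ x # bs)[length as := z] = as @ z # bs" for z by simp
      have "f (as @ (x + y) # bs) = f (as @ x # bs) + f (as @ y # bs) \<and>
        f (as @ (c *s x) # bs) = std_scale c (f (as @ x # bs))"
      proof (cases "length (as @ x # bs) = p")
        case True
        then have "length as < p" by auto
        then have "Vector_Spaces.linear scale std_scale (\<lambda>z. f (as @ z # bs))"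
          using 2[OF True, of "length as"] unfolding up by blast
        then show ?thesis by (simp add: Vector_Spaces.linear_iff)
      qed (simp add: 1)
      then have "std_scale (w (as @ (x + y) # bs)) v = std_scale (w (as @ x # bs) + w (as @ y #
          bs)) v"
        "std_scale (w (as @ (c *s x) # bs)) v = std_scale (c * w (as @ x # bs)) v"
        by (simp_all add: w std.scale_left_distrib)
      then show "w (as @ (x + y) # bs) = w (as @ x # bs) + w (as @ y # bs)"
        "w (as @ (c *s x) # bs) = c * w (as @ x # bs)"
        using v std.scale_cancel_right by blast+
    qed
    moreover have "altn w"
      unfolding altn_def
    proof (intro allI)
      fix as bs cs :: "'v list" and x
      show "w (as @ x # bs @ x # cs) = 0"
      proof (cases "length (as @ x # bs @ x # cs) = p")
        case True
        then show ?thesis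
          by (intro w0 3[of _ "length as" "length as + Suc (length bs)"])
             (auto simp: nth_append)
      qed (simp add: w0 1)
    qed
    moreover have "supp p w" using w0 1 by (simp add: supp_def)
    ultimately show "f \<in> vec_form v ` forms p"
      using w by (auto simp: forms_def vec_form_def intro!: image_eqI[of _ _ w])
  qed
  show "vec_form v ` forms p \<subseteq> cochains scale std_scale (std.span {v}) p"
  proof
    fix f assume "f \<in> vec_form v ` forms p"
    then obtain w where w: "mlin w" "altn w" "supp p w" and f: "\<And>xs. f xs = std_scale (w xs) v"
      by (auto simp: forms_def vec_form_def)
    have 1: "f xs \<in> std.span {v}" for xs by (auto simp: f std.span_singleton)
    have 2: "f xs = 0" if "length xs \<noteq> p" for xs using w(3) that by (simp add: f supp_def)
    have 3: "Vector_Spaces.linear scale std_scale (\<lambda>x. f (xs[i := x]))" if "length xs = p" "i <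
        p" for xs i
      unfolding Vector_Spaces.linear_iff
      using that vector_space_axioms std.vector_space_axioms
      by (simp add: f upd_conv_take_nth_drop mlinD[OF w(1)] std.scale_left_distrib)
    have 4: "f xs = 0" if j: "length xs = p" "i < j" "j < p" "xs ! i = xs ! j" for xs i j
    proof -
      define cs where "cs = drop (Suc i) xs"
      have "xs = take i xs @ xs ! i # cs" using j unfolding cs_def by (intro id_take_nth_drop) simp
      moreover have "cs = take (j - Suc i) cs @ cs ! (j - Suc i) # drop (Suc (j - Suc i)) cs"
        using j unfolding cs_def by (intro id_take_nth_drop) simp
      moreover have "cs ! (j - Suc i) = xs ! i" using j by (simp add: cs_def)
      ultimately have "xs = take i xs @ xs ! i # take (j - Suc i) cs @ xs ! i # drop (Suc (j -
          Suc i)) cs"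
        by metis
      then have "w xs = 0" using w(2) unfolding altn_def by metis
      then show ?thesis by (simp add: f)
    qed
    show "f \<in> cochains scale std_scale (std.span {v}) p"
      unfolding cochains_def mem_Collect_eq using 1 2 3 4 by blast
  qed
qed

end

subsection \<open>Cohomology with one-dimensional coefficients\<close>

context vector_space
begin

lemma coset_eq_iff:
  assumes "subspace B"
  shows "{y + b | b. b \<in> B} = {z + b | b. b \<in> B} \<longleftrightarrow> y - z \<in> B"
proof
  assume "{y + b | b. b \<in> B} = {z + b | b. b \<in> B}"
  moreover have "y \<in> {y + b | b. b \<in> B}" using subspace_0[OF assms] by force
  ultimately obtain b where "y = z + b" "b \<in> B" by blast
  then show "y - z \<in> B" by simp
next
  assume yz: "y - z \<in> B"
  have "y + b \<in> {z + b | b. b \<in> B}" if "b \<in> B" for b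
    using subspace_add[OF assms yz that] by (intro CollectI exI[of _ "y - z + b"]) simp
  moreover have "z + b \<in> {y + b | b. b \<in> B}" if "b \<in> B" for b
    using subspace_diff[OF assms that yz] by (intro CollectI exI[of _ "b - (y - z)"]) simp
  ultimately show "{y + b | b. b \<in> B} = {z + b | b. b \<in> B}" by blast
qed

lemma quot_space_image:
  assumes Z: "subspace Z" and B: "subspace B"
  shows "module_image scale Z (\<lambda>z. {z + b | b. b \<in> B}) (quot_space scale Z B)"
proof
  show "subspace Z" by (rule Z)
  show "carrier (quot_space scale Z B) = (\<lambda>z. {z + b | b. b \<in> B}) ` Z"
    by (auto simp: quot_space_def)
  show "\<zero>\<^bsub>quot_space scale Z B\<^esub> = {0 + b | b. b \<in> B}" by (simp add: quot_space_def)
  show "{y + b | b. b \<in> B} \<oplus>\<^bsub>quot_space scale Z B\<^esub> {z + b | b. b \<in> B} = {y + z + b | b. b \<in> B}"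
      for y z
  proof -
    have "y + b + (z + b') \<in> {y + z + b | b. b \<in> B}" if "b \<in> B" "b' \<in> B" for b b'
      using subspace_add[OF B that] by (intro CollectI exI[of _ "b + b'"]) (simp add: algebra_simps)
    moreover have "\<exists>s t. y + z + b = s + t \<and> s \<in> {y + b | b. b \<in> B} \<and> t \<in> {z + b | b. b \<in> B}"
      if "b \<in> B" for b
      using that subspace_0[OF B] by (intro exI[of _ "y + b"] exI[of _ "z + 0"]) auto
    ultimately show ?thesis by (auto simp: quot_space_def)
  qed
  show "c \<odot>\<^bsub>quot_space scale Z B\<^esub> {z + b | b. b \<in> B} = {c *s z + b | b. b \<in> B}" for c z
  proof -
    have "c *s (z + b) + b' \<in> {c *s z + b | b. b \<in> B}" if "b \<in> B" "b' \<in> B" for b b'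
      using subspace_add[OF B subspace_scale[OF B that(1)] that(2), of c]
      by (intro CollectI exI[of _ "c *s b + b'"]) (simp add: algebra_simps)
    moreover have "\<exists>s b'. c *s z + b = c *s s + b' \<and> s \<in> {z + b | b. b \<in> B} \<and> b' \<in> B"
      if "b \<in> B" for b
      using that subspace_0[OF B] by (intro exI[of _ "z + 0"] exI[of _ b]) auto
    ultimately show ?thesis by (auto simp: quot_space_def)
  qed
qed

end

abbreviation form_scale :: "'k::field \<Rightarrow> ('s list \<Rightarrow> 'k) \<Rightarrow> 's list \<Rightarrow> 'k" where
  "form_scale \<equiv> fscale (*)"

lemma vec_form_linear:
  "Vector_Spaces.linear form_scale (fscale std_scale) (vec_form v)"
  unfolding Vector_Spaces.linear_iff
  by (auto intro!: vector_space_fscale vector_space_mult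
      simp: vec_form_def fscale_def fun_eq_iff algebra_simps)

lemma vec_form_eq_iff: "v \<noteq> 0 \<Longrightarrow> vec_form v w = vec_form v w' \<longleftrightarrow> w = w'"
  by (auto simp: vec_form_def fscale_def fun_eq_iff)

context alg_closed_fd_vector_space
begin

interpretation std: alg_closed_vector_space "std_scale :: 'k \<Rightarrow> (nat \<Rightarrow> 'k) \<Rightarrow> nat \<Rightarrow> 'k"
  by (intro alg_closed_vector_space.intro vector_space_fscale vector_space_mult)

interpretation F: vector_space "form_scale :: 'k \<Rightarrow> ('v list \<Rightarrow> 'k) \<Rightarrow> 'v list \<Rightarrow> 'k"
  by (intro vector_space_fscale vector_space_mult)

lemma subspace_forms: "F.subspace (forms p)"
  by (rule F.subspaceI)
     (auto simp: forms_def mlin_def altn_def supp_def fscale_def algebra_simps)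

lemma subspace_closed_forms: "F.subspace (closed_forms m l p)"
proof (rule F.subspaceI)
  note s = subspace_forms[of p]
  show "0 \<in> closed_forms m l p"
    using F.subspace_0[OF s] cdiff_0[of m l] by (auto simp: closed_forms_def zero_fun_def)
  show "x + y \<in> closed_forms m l p" if "x \<in> closed_forms m l p" "y \<in> closed_forms m l p" for x y
    using that F.subspace_add[OF s, of x y] cdiff_add[of m l x y]
    by (auto simp: closed_forms_def plus_fun_def)
  show "form_scale c x \<in> closed_forms m l p" if "x \<in> closed_forms m l p" for c x
    using that F.subspace_scale[OF s, of x c] cdiff_scale[of m l c x]
    by (auto simp: closed_forms_def fscale_def)
qed

lemma subspace_exact_forms: "F.subspace (exact_forms m l p)"
  unfolding F.subspace_def plus_fun_def zero_fun_def fscale_def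
  by (auto intro: exact_forms_subspace)

lemma exact_forms_cases:
  "exact_forms m l 0 = {0}" "exact_forms m l (Suc q) = cdiff m l ` forms q"
proof -
  have "v = 0" if "\<forall>xs. v xs = 0" for v :: "'v list \<Rightarrow> 'k" using that by auto
  moreover have "cdiff m l 0 = 0" using cdiff_0[of m l] by (auto simp: zero_fun_def)
  moreover have "mlin 0" "altn (0 :: 'v list \<Rightarrow> 'k)" by (auto simp: mlin_def altn_def)
  ultimately show "exact_forms m l 0 = {0}" by (auto simp: exact_forms_def intro: exI[of _ 0])
  show "exact_forms m l (Suc q) = cdiff m l ` forms q"
    by (auto simp: exact_forms_def forms_def supp_def)
qed

context
  fixes m M v l
  assumes M: "M \<in> irreps scale m" and ch: "is_char M v l"
begin

lemma v_nz: "v \<noteq> 0" using ch by (simp add: is_char_def)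

lemma ce_diff_char:
  assumes w: "w \<in> forms p"
  shows "ce_diff m std_scale (snd M) p (vec_form v w) = vec_form v (cdiff m l w)"
  using ce_diff_eq_cdiff[OF std.vector_space_axioms, of w p "snd M" v l m] w char_action[OF M ch]
  by (simp add: forms_def vec_form_def)

lemma cochains_char: "cochains scale std_scale (fst M) p = vec_form v ` forms p"
  using cochains_line[OF v_nz] ch by (simp add: is_char_def)

lemma cocycles_char: "cocycles scale m std_scale M p = vec_form v ` closed_forms m l p"
proof -
  have "vec_form v (\<lambda>_ :: 'v list. 0) = 0" by (simp add: vec_form_def fscale_def zero_fun_def)
  then have z: "vec_form v u = 0 \<longleftrightarrow> u = (\<lambda>_. 0)" for u :: "'v list \<Rightarrow> 'k"
    using vec_form_eq_iff[OF v_nz, of u "\<lambda>_. 0"] by simp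
  have "cocycles scale m std_scale M p =
    {f \<in> vec_form v ` forms p. ce_diff m std_scale (snd M) p f = 0}"
    by (simp add: cocycles_def split_beta cochains_char)
  also have "\<dots> = vec_form v ` closed_forms m l p"
    using z by (auto simp: closed_forms_def ce_diff_char)
  finally show ?thesis .
qed

lemma coboundaries_char: "coboundaries scale m std_scale M p = vec_form v ` exact_forms m l p"
proof (cases p)
  case 0
  then show ?thesis
    by (simp add: coboundaries_def split_beta exact_forms_cases)
       (simp add: vec_form_def fscale_def zero_fun_def)
next
  case (Suc q)
  then show ?thesis
    by (auto simp: coboundaries_def split_beta exact_forms_cases cochains_char image_image
        ce_diff_char
        cong: image_cong)
qed

text \<open>The class of \<open>w\<close> tensored with \<open>v\<close>. This map presents the
  record \<open>cohomology\<close> as an image of scalar closed forms.\<close>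

definition coh_class :: "nat \<Rightarrow> ('v list \<Rightarrow> 'k) \<Rightarrow> ('v list \<Rightarrow> nat \<Rightarrow> 'k) set" where
  "coh_class p w = {vec_form v w + b | b. b \<in> vec_form v ` exact_forms m l p}"

lemma subspace_vec_form:
  assumes "F.subspace S"
  shows "module.subspace (fscale std_scale) (vec_form v ` S)"
  by (rule module_hom.subspace_image[OF module_hom_linearI[OF vec_form_linear] assms])

lemma coh_class_eq_iff: "coh_class p w = coh_class p w' \<longleftrightarrow> w - w' \<in> exact_forms m l p"
proof -
  interpret S: vector_space "fscale std_scale :: 'k \<Rightarrow> ('v list \<Rightarrow> nat \<Rightarrow> 'k) \<Rightarrow> _"
    by (intro vector_space_fscale vector_space_mult)
  interpret L: Vector_Spaces.linear form_scale "fscale std_scale" "vec_form v" by (rule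
      vec_form_linear)
  have "coh_class p w = coh_class p w' \<longleftrightarrow> vec_form v w - vec_form v w' \<in> vec_form v ` exact_forms
      m l p"
    unfolding coh_class_def by (intro S.coset_eq_iff subspace_vec_form subspace_exact_forms)
  also have "vec_form v w - vec_form v w' = vec_form v (w - w')" by (simp add: L.diff)
  also have "vec_form v (w - w') \<in> vec_form v ` exact_forms m l p \<longleftrightarrow> w - w' \<in> exact_forms m l p"
    by (auto simp: vec_form_eq_iff[OF v_nz])
  finally show ?thesis .
qed

lemma cohomology_image:
  "module_image form_scale (closed_forms m l p) (coh_class p) (cohomology scale m std_scale M p)"
proof -
  interpret S: vector_space "fscale std_scale :: 'k \<Rightarrow> ('v list \<Rightarrow> nat \<Rightarrow> 'k) \<Rightarrow> _"
    by (intro vector_space_fscale vector_space_mult)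
  interpret L: Vector_Spaces.linear form_scale "fscale std_scale" "vec_form v" by (rule
      vec_form_linear)
  interpret Q: module_image "fscale std_scale" "cocycles scale m std_scale M p"
    "\<lambda>z. {z + b | b. b \<in> coboundaries scale m std_scale M p}" "cohomology scale m std_scale M p"
    unfolding cohomology_def
    by (intro S.quot_space_image)
       (simp_all add: cocycles_char coboundaries_char subspace_vec_form subspace_exact_forms
         subspace_closed_forms)
  show ?thesis
  proof
    show "F.subspace (closed_forms m l p)" by (rule subspace_closed_forms)
    show "carrier (cohomology scale m std_scale M p) = coh_class p ` closed_forms m l p"
      unfolding Q.carrier by (simp add: cocycles_char coboundaries_char coh_class_def image_image)
    show "\<zero>\<^bsub>cohomology scale m std_scale M p\<^esub> = coh_class p 0"
      unfolding Q.zero by (simp add: coboundaries_char coh_class_def)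
    show "coh_class p y \<oplus>\<^bsub>cohomology scale m std_scale M p\<^esub> coh_class p z = coh_class p (y + z)"
      if "y \<in> closed_forms m l p" "z \<in> closed_forms m l p" for y z
      using Q.add[of "vec_form v y" "vec_form v z"] that
      by (simp add: coboundaries_char cocycles_char coh_class_def L.add)
    show "c \<odot>\<^bsub>cohomology scale m std_scale M p\<^esub> coh_class p z = coh_class p (form_scale c z)"
      if "z \<in> closed_forms m l p" for c z
      using Q.smult[of "vec_form v z" c] that
      by (simp add: coboundaries_char cocycles_char coh_class_def L.scale)
  qed
qed

lemma cohomology_nontrivial:
  "carrier (cohomology scale m std_scale M p) \<noteq> {\<zero>\<^bsub>cohomology scale m std_scale M p\<^esub>} \<longleftrightarrow>
    \<not> closed_forms m l p \<subseteq> exact_forms m l p"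
proof -
  interpret C: module_image form_scale "closed_forms m l p" "coh_class p"
    "cohomology scale m std_scale M p" by (rule cohomology_image)
  have "carrier (cohomology scale m std_scale M p) = {\<zero>\<^bsub>cohomology scale m std_scale M p\<^esub>} \<longleftrightarrow>
    (\<forall>w\<in>closed_forms m l p. coh_class p w = coh_class p 0)"
    using F.subspace_0[OF subspace_closed_forms[of m l p]] unfolding C.carrier C.zero by blast
  then show ?thesis by (auto simp: coh_class_eq_iff)
qed

end

end

subsection \<open>Twisting by a torus of derivations\<close>

text \<open>Here \<open>nu\<close> stands for the nilshadow and \<open>mu\<close> for one member of
  the family; \<open>wt b x\<close> is the eigenvalue at \<open>b\<close> of the torus element
  attached to \<open>x\<close>. The locale isolates what the comparison of cohomology requires.
  \<open>nu\<close> and its forms do not depend on the member, whereas \<open>wt\<close>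
  does.\<close>

locale torus_twist = alg_closed_fd_vector_space scale Basis
  for scale :: "'k::{alg_closed_field, field_char_0} \<Rightarrow> 'v::ab_group_add \<Rightarrow> 'v" (infixr "*s" 75)
    and Basis +
  fixes aa N B :: "'v set" and wt :: "'v \<Rightarrow> 'v \<Rightarrow> 'k" and nu mu :: "'v \<Rightarrow> 'v \<Rightarrow> 'v"
  assumes B: "independent B" "span B = UNIV"
    and wt_add: "\<And>b x y. b \<in> B \<Longrightarrow> wt b (x + y) = wt b x + wt b y"
    and wt_scale: "\<And>b c x. b \<in> B \<Longrightarrow> wt b (c *s x) = c * wt b x"
    and wt_N: "\<And>b x. b \<in> B \<Longrightarrow> x \<in> N \<Longrightarrow> wt b x = 0"
    and E_aa: "\<And>x a. a \<in> aa \<Longrightarrow> diag B (\<lambda>b. wt b x) a = 0"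
    and E_N: "\<And>x y. diag B (\<lambda>b. wt b x) y \<in> N"
    and E_nu: "\<And>x y z. diag B (\<lambda>b. wt b x) (nu y z) =
      nu (diag B (\<lambda>b. wt b x) y) z + nu y (diag B (\<lambda>b. wt b x) z)"
    and decomp: "\<And>x. \<exists>a\<in>aa. \<exists>n\<in>N. x = a + n"
    and N_span: "N \<subseteq> span (B \<inter> N)"
    and nu_alt: "nu \<in> alt_bilinear scale"
    and nu_N: "\<And>x y. nu x y \<in> N"
    and nu_nilpotent: "\<And>x. x \<in> aa \<union> N \<Longrightarrow> \<exists>k. \<forall>y. (nu x ^^ k) y = 0"
    and mu_eq: "\<And>x y. mu x y = nu x y + diag B (\<lambda>b. wt b x) y - diag B (\<lambda>b. wt b y) x"
    and mu_lie: "lie_bracket scale mu"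
    and mu_chain: "lie_chain scale mu UNIV"
begin

interpretation F: vector_space "form_scale :: 'k \<Rightarrow> ('v list \<Rightarrow> 'k) \<Rightarrow> 'v list \<Rightarrow> 'k"
  by (intro vector_space_fscale vector_space_mult)

sublocale mu: fd_lie scale Basis mu
  by unfold_locales (rule mu_lie)

definition E :: "'v \<Rightarrow> 'v \<Rightarrow> 'v" where
  "E x = diag B (\<lambda>b. wt b x)"

abbreviation P :: "('v \<Rightarrow> 'k) \<Rightarrow> ('v list \<Rightarrow> 'k) \<Rightarrow> 'v list \<Rightarrow> 'k" where
  "P \<equiv> proj B wt"

lemma endo_E: "endo (E x)" unfolding E_def by (rule endo_diag[OF B])

lemma E_basis: "b \<in> B \<Longrightarrow> E x b = wt b x *s b"
  unfolding E_def by (rule diag_basis[OF B])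

lemma E_in_N: "E x y \<in> N" unfolding E_def by (rule E_N)

lemma E_of_N: "x \<in> N \<Longrightarrow> E x y = 0"
  unfolding E_def using diag_cong[OF B, of "\<lambda>b. wt b x" "\<lambda>_. 0"] wt_N by (simp add: diag_def)

lemma E_on_aa: "a \<in> aa \<Longrightarrow> E x a = 0" unfolding E_def by (rule E_aa)

lemma E_comm: "E x (E y z) = E y (E x z)" unfolding E_def by (rule diag_comm[OF B])

lemma mu: "mu x y = nu x y + E x y - E y x" unfolding E_def by (rule mu_eq)

lemma E_nu': "E x (nu y z) = nu (E x y) z + nu y (E x z)" unfolding E_def by (rule E_nu)

lemma E_mu: "E x (mu y z) = mu (E x y) z + mu y (E x z)"
  by (simp add: mu endoD[OF endo_E] E_nu' E_of_N[OF E_in_N] E_comm[of x] algebra_simps)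

definition linear_char :: "('v \<Rightarrow> 'k) \<Rightarrow> bool" where
  "linear_char l \<longleftrightarrow> (\<forall>x y. l (x + y) = l x + l y) \<and> (\<forall>c x. l (c *s x) = c * l x)"

text \<open>Characters of the quotient by \<open>N\<close>. All weights of forms are of this kind,
  and other characters of \<open>mu\<close> have no cohomology by
  \<open>closed_exact_nonvanishing\<close>.\<close>

definition vanishing_char :: "('v \<Rightarrow> 'k) \<Rightarrow> bool" where
  "vanishing_char l \<longleftrightarrow> linear_char l \<and> (\<forall>x\<in>N. l x = 0)"

lemma linear_charD:
  assumes "linear_char l"
  shows "l (x + y) = l x + l y" "l (c *s x) = c * l x" "l 0 = 0" "l (x - y) = l x - l y"
proof -
  show 1: "l (x + y) = l x + l y" "l (c *s x) = c * l x" for x y c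
    using assms by (auto simp: linear_char_def)
  show "l 0 = 0" using 1(2)[of 0 0] by simp
  show "l (x - y) = l x - l y" using 1(1)[of "x - y" y] by simp
qed

lemma vanishing_0: "vanishing_char (\<lambda>_. 0)"
  by (simp add: vanishing_char_def linear_char_def)

lemma P_forms: "w \<in> forms p \<Longrightarrow> P l w \<in> forms p"
  by (simp add: forms_def mlin_proj[OF B] altn_proj[OF B] supp_proj[OF B])

lemma P_add: "P l (v + w) = P l v + P l w"
  using proj_add[OF B, of wt l v w] by (auto simp: plus_fun_def)

lemma P_scale: "P l (form_scale c w) = form_scale c (P l w)"
  using proj_scale[OF B, of wt l c w] by (auto simp: fscale_def)

lemma P_0: "P l 0 = 0"
  using P_scale[of l 0 0] by (simp add: fscale_def zero_fun_def)

lemma P_diff: "P l (v - w) = P l v - P l w"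
  using P_add[of l "v - w" w] by (simp add: eq_diff_eq)

lemma P_sum: "P l (\<Sum>i\<in>I. u i) = (\<Sum>i\<in>I. P l (u i))"
  by (induction I rule: infinite_finite_induct) (simp_all only: sum.infinite sum.empty sum.insert
    P_0 P_add not_False_eq_True)

lemma der_P: "der (E x) (P l w) = (\<lambda>ys. l x * P l w ys)"
  by (rule der_proj[OF B endo_E E_basis])

lemma P_P: "P k (P l w) = (if k = l then P l w else 0)"
proof -
  have "P k (P l w) = (if k = l then P l w else (\<lambda>_. 0))"
    by (rule proj_weight[OF B endo_E E_basis mlin_proj[OF B] der_P])
  then show ?thesis by (simp add: zero_fun_def)
qed

lemma P_cdiff_mu:
  assumes "vanishing_char h" "w \<in> forms p"
  shows "P l (cdiff mu h w) = cdiff mu h (P l w)"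
  by (rule proj_cdiff[OF B endo_E E_basis mu.brk_alt])
     (use assms E_in_N in \<open>auto simp: E_mu vanishing_char_def linear_charD forms_def\<close>)

lemma P_cdiff_nu: "w \<in> forms p \<Longrightarrow> P l (cdiff nu (\<lambda>_. 0) w) = cdiff nu (\<lambda>_. 0) (P l w)"
  by (rule proj_cdiff[OF B endo_E E_basis nu_alt]) (auto simp: E_nu' forms_def)

text \<open>On the weight \<open>l\<close> component the correction term of
  \<open>cdiff_twist\<close> is zero. The left side depends on the member of the family, the
  differential on the right does not.\<close>

lemma cdiff_P:
  assumes "w \<in> forms p"
  shows "cdiff mu l (P l w) = cdiff nu (\<lambda>_. 0) (P l w)"
proof
  fix xs
  have "cdiff mu l (P l w) xs = cdiff nu (\<lambda>_. 0) (P l w) xs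
      + alt_sum (\<lambda>x ys. l x * P l w ys - der (E x) (P l w) ys) xs"
    using P_forms[OF assms] by (intro cdiff_twist mu) (auto simp: forms_def)
  then show "cdiff mu l (P l w) xs = cdiff nu (\<lambda>_. 0) (P l w) xs"
    by (simp add: der_P alt_sum_0)
qed

lemma P_closed_iff:
  "w \<in> forms p \<Longrightarrow> P l w \<in> closed_forms mu l p \<longleftrightarrow> P l w \<in> closed_forms nu (\<lambda>_. 0) p"
  by (simp add: closed_forms_def P_forms cdiff_P)

lemma P_closed_nu:
  assumes "w \<in> closed_forms nu (\<lambda>_. 0) p"
  shows "P l w \<in> closed_forms nu (\<lambda>_. 0) p"
  using assms P_cdiff_nu[of w p l] P_0[of l] by (simp add: closed_forms_def P_forms zero_fun_def)

lemma P_closed_mu: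
  assumes "vanishing_char h" "w \<in> closed_forms mu h p"
  shows "P l w \<in> closed_forms mu h p"
  using assms P_cdiff_mu[of h w p l] P_0[of l] by (simp add: closed_forms_def P_forms zero_fun_def)

lemma P_exact_mu_to_nu:
  assumes "vanishing_char l" "w \<in> exact_forms mu l p"
  shows "P l w \<in> exact_forms nu (\<lambda>_. 0) p"
proof (cases p)
  case 0
  then show ?thesis using assms by (simp add: exact_forms_cases P_0)
next
  case (Suc q)
  then obtain v where v: "v \<in> forms q" "w = cdiff mu l v" using assms by (auto simp:
      exact_forms_cases)
  then have "P l w = cdiff nu (\<lambda>_. 0) (P l v)" using assms(1) by (simp add: P_cdiff_mu cdiff_P)
  then show ?thesis using v P_forms by (auto simp: Suc exact_forms_cases)
qed

lemma P_exact_nu_to_mu: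
  assumes "w \<in> exact_forms nu (\<lambda>_. 0) p"
  shows "P l w \<in> exact_forms mu l p"
proof (cases p)
  case 0
  then show ?thesis using assms by (simp add: exact_forms_cases P_0)
next
  case (Suc q)
  then obtain v where v: "v \<in> forms q" "w = cdiff nu (\<lambda>_. 0) v"
    using assms by (auto simp: exact_forms_cases)
  then have "P l w = cdiff mu l (P l v)" by (simp add: P_cdiff_nu cdiff_P)
  then show ?thesis using v P_forms by (auto simp: Suc exact_forms_cases)
qed

lemma wsums_vanishing:
  assumes "l \<in> wsums wt B p"
  shows "vanishing_char l"
proof -
  obtain bs where bs: "set bs \<subseteq> B" "l = wsum wt bs" using assms by (auto simp: wsums_def)
  have "vanishing_char (wsum wt bs)"
    using bs(1)
  proof (induction bs)
    case (Cons b bs)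
    then show ?case
      by (auto simp: vanishing_char_def linear_char_def wsum_def wt_add wt_scale wt_N algebra_simps)
  qed (simp add: wsum_def vanishing_0)
  then show ?thesis by (simp add: bs)
qed

lemma sum_P:
  assumes "w \<in> forms p"
  shows "w = (\<Sum>l\<in>wsums wt B p. P l w)"
proof
  fix xs
  have "(\<Sum>l\<in>L. P l w) xs = (\<Sum>l\<in>L. P l w xs)" for L
    by (induction L rule: infinite_finite_induct) auto
  then show "w xs = (\<Sum>l\<in>wsums wt B p. P l w) xs"
    using sum_proj[OF B, of w p wt] assms by (metis (no_types, lifting) forms_def mem_Collect_eq)
qed

lemma P_outside: "w \<in> forms p \<Longrightarrow> l \<notin> wsums wt B p \<Longrightarrow> P l w = 0"
  using proj_outside[OF B, of p w l wt] by (simp add: forms_def zero_fun_def)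

text \<open>A component of weight \<open>k\<close> different from \<open>l\<close> is exact: both
  characters vanish on \<open>N\<close>, so they differ at some \<open>a\<close> in
  \<open>aa\<close>, where \<open>mu a\<close> is the sum of the commuting maps \<open>nu a\<close>,
  nilpotent, and \<open>E a\<close>. Then \<open>closed_form_exact\<close> applies with the scalar
  \<open>l a - k a\<close>.\<close>

lemma closed_minus_P_exact:
  assumes l: "vanishing_char l" and w: "w \<in> closed_forms mu l p"
  shows "w - P l w \<in> exact_forms mu l p"
proof -
  have wf: "w \<in> forms p" using w by (simp add: closed_forms_def)
  have ex: "P k w \<in> exact_forms mu l p" if k: "k \<in> wsums wt B p" "k \<noteq> l" for k
  proof -
    have kv: "vanishing_char k" using k by (intro wsums_vanishing)
    obtain x where "k x \<noteq> l x" using k(2) by blast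
    moreover obtain a n where a: "a \<in> aa" "n \<in> N" "x = a + n" using decomp by blast
    ultimately have la: "l a \<noteq> k a"
      using l kv by (auto simp: vanishing_char_def linear_charD)
    obtain j where j: "\<And>y. (nu a ^^ j) y = 0" using nu_nilpotent a(1) by blast
    have ma: "mu a y = nu a y + E a y" for y using a(1) by (simp add: mu E_on_aa)
    then have na: "nu a y = mu a y - E a y" for y by simp
    show ?thesis
    proof (rule closed_form_exact[of "nu a" j mu l "E a" a "k a"])
      show "endo (nu a)" by (rule alt_bilinearD[OF nu_alt])
      show "nu a (mu x y) = mu (nu a x) y + mu x (nu a y)" for x y
        by (simp add: na E_mu mu.brk mu.ad_derivation[of a x y])
      show "l (nu a x) = 0" for x using l nu_N by (simp add: vanishing_char_def)
      show "E a (nu a y) = nu a (E a y)" for y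
        by (simp add: E_nu' E_on_aa[OF a(1)] alt_bilinearD[OF nu_alt])
      show "P k w \<in> closed_forms mu l p" by (rule P_closed_mu[OF l w])
    qed (use j endo_E ma la der_P in auto)
  qed
  note sub = subspace_exact_forms[of mu l p]
  have "w - P l w = (\<Sum>k\<in>wsums wt B p - {l}. P k w)"
  proof (cases "l \<in> wsums wt B p")
    case True
    then show ?thesis
      using sum_P[OF wf] sum.remove[OF finite_wsums[OF B] True, of "\<lambda>k. P k w"] by (simp add:
          algebra_simps)
  next
    case False
    then show ?thesis using sum_P[OF wf] P_outside[OF wf False] by simp
  qed
  also have "\<dots> \<in> exact_forms mu l p" by (rule F.subspace_sum[OF sub]) (use ex in auto)
  finally show ?thesis .
qed

text \<open>Some basis vector \<open>b\<close> in \<open>N\<close> has \<open>l b\<close> nonzero.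
  Its weight must be 0, hence \<open>mu b = nu b\<close> is nilpotent and Cartan's formula for
  \<open>b\<close> contracts the complex, with zero in the role of the semisimple map.\<close>

lemma closed_exact_nonvanishing:
  assumes l: "linear_char l" "\<And>x y. l (mu x y) = 0" and x: "x \<in> N" "l x \<noteq> 0"
  shows "closed_forms mu l p \<subseteq> exact_forms mu l p"
proof
  fix w assume w: "w \<in> closed_forms mu l p"
  have "\<exists>b\<in>B \<inter> N. l b \<noteq> 0"
  proof (rule ccontr)
    assume c: "\<not> ?thesis"
    have "span (B \<inter> N) \<subseteq> {x. l x = 0}"
      using c by (intro span_minimal subspaceI) (auto simp: linear_charD[OF l(1)])
    then show False using x N_span by blast
  qed
  then obtain b where b: "b \<in> B" "b \<in> N" "l b \<noteq> 0" by blast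
  have "E y b = 0" for y
  proof (rule ccontr)
    assume "E y b \<noteq> 0"
    obtain a n where a: "a \<in> aa" "n \<in> N" "y = a + n" using decomp by blast
    define c where "c = wt b a"
    have "wt b y = c" using a b wt_N by (simp add: wt_add c_def)
    then have c: "c \<noteq> 0" using \<open>E y b \<noteq> 0\<close> b(1) by (auto simp: E_basis)
    \<comment> \<open>The iterates of \<open>b\<close> under \<open>nu a\<close> share its weight
      \<open>c\<close>. Since \<open>l\<close> kills brackets, each iteration multiplies
      \<open>l\<close> by \<open>- c\<close>, so \<open>l\<close> never reaches 0 although the
      iterates do.\<close>
    have Eb: "E a ((nu a ^^ i) b) = c *s (nu a ^^ i) b" for i
      by (induction i)
         (use b(1) in \<open>simp_all add: E_basis c_def E_nu' E_on_aa[OF a(1)] alt_bilinearD[OF nu_alt]\<close>)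
    have "l ((nu a ^^ Suc i) b) = - c * l ((nu a ^^ i) b)" for i
      using l(2)[of a "(nu a ^^ i) b"] a(1)
      by (simp add: mu E_on_aa Eb linear_charD[OF l(1)] eq_neg_iff_add_eq_0)
    then have li: "l ((nu a ^^ i) b) = (- c) ^ i * l b" for i
      by (induction i) (simp_all add: mult.assoc)
    obtain j where "(nu a ^^ j) b = 0" using nu_nilpotent a(1) by blast
    then show False using li[of j] c b(3) by (simp add: linear_charD[OF l(1)])
  qed
  then have mb: "mu b = nu b" using b(2) by (auto simp: mu E_of_N)
  obtain j where j: "\<And>y. (nu b ^^ j) y = 0" using nu_nilpotent b(2) by blast
  have "mlin w" using w by (simp add: closed_forms_def forms_def)
  show "w \<in> exact_forms mu l p"
    by (rule closed_form_exact[of "mu b" j mu l "\<lambda>_. 0" b 0])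
       (use w j b l \<open>mlin w\<close> in \<open>auto simp: mb[symmetric] mu.brk mu.ad_derivation[of b]
           der_fun_0 intro: endoI\<close>)
qed

text \<open>Exactness for \<open>nu\<close> can be tested on weight components, where it agrees with
  exactness for \<open>mu\<close> with coefficients \<open>l\<close>. For an \<open>l\<close>
  without cohomology the test is passed automatically, since the component is closed.\<close>

lemma exact_nu_iff:
  assumes w: "w \<in> closed_forms nu (\<lambda>_. 0) p"
  shows "w \<in> exact_forms nu (\<lambda>_. 0) p \<longleftrightarrow>
    (\<forall>l. vanishing_char l \<longrightarrow> \<not> closed_forms mu l p \<subseteq> exact_forms mu l p \<longrightarrow> P l w \<in> exact_forms mu
        l p)"
    (is "_ \<longleftrightarrow> ?R")
proof
  assume R: ?R
  have wf: "w \<in> forms p" using w by (simp add: closed_forms_def)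
  have "P l w \<in> exact_forms nu (\<lambda>_. 0) p" if l: "l \<in> wsums wt B p" for l
  proof -
    have lv: "vanishing_char l" using l by (rule wsums_vanishing)
    have "P l w \<in> closed_forms mu l p" using w wf by (simp add: P_closed_iff P_closed_nu)
    then have "P l w \<in> exact_forms mu l p" using R lv by blast
    then show ?thesis using P_exact_mu_to_nu[OF lv] P_P[of l l w] by fastforce
  qed
  then show "w \<in> exact_forms nu (\<lambda>_. 0) p"
    by (subst sum_P[OF wf]) (rule F.subspace_sum[OF subspace_exact_forms])
qed (use P_exact_nu_to_mu in blast)

end

section \<open>Total cohomology as a quotient of the closed forms of the nilshadow\<close>

context torus_twist
begin

interpretation F: vector_space "form_scale :: 'k \<Rightarrow> ('v list \<Rightarrow> 'k) \<Rightarrow> 'v list \<Rightarrow> 'k"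
  by (intro vector_space_fscale vector_space_mult)

definition char_class :: "('v \<Rightarrow> 'k) \<Rightarrow> ('k, 'v) std_module set" where
  "char_class l = {M \<in> irreps scale mu. \<exists>v. is_char M v l}"

lemma char_unique:
  "M \<in> irreps scale mu \<Longrightarrow> is_char M v l \<Longrightarrow> is_char M v' l' \<Longrightarrow> l = l'"
proof -
  assume a: "M \<in> irreps scale mu" "is_char M v l" "is_char M v' l'"
  have "module_iso std_scale std_scale M M" using iso_iff_char_eq[OF a(1,2) a(1,2)] by simp
  then show "l = l'" using iso_iff_char_eq[OF a(1,2) a(1,3)] by simp
qed

lemma equiv_class_char:
  assumes M: "M \<in> irreps scale mu" "is_char M v l"
  shows "irrep_equiv scale mu `` {M} = char_class l"
proof -
  have "(M, M') \<in> irrep_equiv scale mu \<longleftrightarrow> M' \<in> char_class l" for M'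
  proof (cases "M' \<in> irreps scale mu")
    case True
    then obtain v' l' where c: "is_char M' v' l'" using irrep_has_char[OF mu.brk_alt mu_chain]
        by blast
    then have "M' \<in> char_class l \<longleftrightarrow> l = l'" using True char_unique[OF True] by (auto simp:
        char_class_def)
    then show ?thesis using iso_iff_char_eq[OF M True c] M(1) True by (auto simp: irrep_equiv_def)
  qed (auto simp: irrep_equiv_def char_class_def)
  then show ?thesis by blast
qed

lemma cohomology_irreps_char:
  "C \<in> cohomology_irreps scale mu p \<longleftrightarrow>
    (\<exists>l. C = char_class l \<and> vanishing_char l \<and> \<not> closed_forms mu l p \<subseteq> exact_forms mu l p)"
proof
  assume "C \<in> cohomology_irreps scale mu p"
  then obtain M M0 where C: "C = irrep_equiv scale mu `` {M0}" "M0 \<in> irreps scale mu" "M \<in> C"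
    and nt: "carrier (cohomology scale mu std_scale M p) \<noteq> {\<zero>\<^bsub>cohomology scale mu std_scale M p\<^esub>}"
    unfolding cohomology_irreps_def quotient_def by blast
  obtain v0 l where "is_char M0 v0 l" using irrep_has_char[OF mu.brk_alt mu_chain C(2)] by blast
  then have Cl: "C = char_class l" using equiv_class_char C by blast
  then obtain v where M: "M \<in> irreps scale mu" "is_char M v l" using C(3) by (auto simp:
      char_class_def)
  have n: "\<not> closed_forms mu l p \<subseteq> exact_forms mu l p" using cohomology_nontrivial[OF M] nt by blast
  have lin: "linear_char l" using char_linear[OF M] by (simp add: linear_char_def)
  then have "vanishing_char l"
    using closed_exact_nonvanishing[OF lin char_linear(3)[OF M]] n by (auto simp:
        vanishing_char_def)
  then show "\<exists>l. C = char_class l \<and> vanishing_char l \<and> \<not> closed_forms mu l p \<subseteq> exact_forms mu l p"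
    using Cl n by blast
next
  assume "\<exists>l. C = char_class l \<and> vanishing_char l \<and> \<not> closed_forms mu l p \<subseteq> exact_forms mu l p"
  then obtain l where l: "C = char_class l" "vanishing_char l" "\<not> closed_forms mu l p \<subseteq>
      exact_forms mu l p"
    by blast
  have "l (mu x y) = 0" for x y
    using l(2) nu_N E_in_N by (simp add: mu vanishing_char_def linear_charD)
  then obtain M v where M: "M \<in> irreps scale mu" "is_char M v l"
    using char_exists[OF mu.brk_alt, of l] l(2) by (auto simp: vanishing_char_def linear_charD)
  then have "C = irrep_equiv scale mu `` {M}" using equiv_class_char l(1) by blast
  moreover have "M \<in> C" using M l(1) by (auto simp: char_class_def)
  moreover have "carrier (cohomology scale mu std_scale M p) \<noteq> {\<zero>\<^bsub>cohomology scale mu std_scale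
      M p\<^esub>}"
    using cohomology_nontrivial[OF M] l(3) by blast
  ultimately show "C \<in> cohomology_irreps scale mu p"
    using M(1) by (auto simp: cohomology_irreps_def quotient_def)
qed

text \<open>A \<open>nu\<close>-closed form is sent to the family of classes of its weight
  components, one for each contributing character. Fibres are cosets of the exact forms by
  \<open>exact_nu_iff\<close>.\<close>

lemma total_cohomology_image:
  "\<exists>\<Phi>. module_image form_scale (closed_forms nu (\<lambda>_. 0) p) \<Phi> (total_cohomology scale mu p) \<and>
    (\<forall>y z. y \<in> closed_forms nu (\<lambda>_. 0) p \<longrightarrow> z \<in> closed_forms nu (\<lambda>_. 0) p \<longrightarrow>
      \<Phi> y = \<Phi> z \<longleftrightarrow> y - z \<in> exact_forms nu (\<lambda>_. 0) p)"
proof -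
  define I where "I = cohomology_irreps scale mu p"
  define R where "R = (\<lambda>C :: ('k, 'v) std_module set. SOME M. M \<in> C)"
  define coh where "coh = (\<lambda>C. cohomology scale mu std_scale (R C) p)"
  have "\<exists>l. C = char_class l \<and> vanishing_char l \<and> \<not> closed_forms mu l p \<subseteq> exact_forms mu l p" if
      "C \<in> I" for C
    using that unfolding I_def cohomology_irreps_char .
  then obtain lc where lc: "\<And>C. C \<in> I \<Longrightarrow> C = char_class (lc C)" "\<And>C. C \<in> I \<Longrightarrow> vanishing_char (lc C)"
    by metis
  have ne: "C \<noteq> {}" if "C \<in> I" for C using that by (auto simp: I_def cohomology_irreps_def)
  have "R C \<in> C" if "C \<in> I" for C unfolding R_def using ne[OF that] by (simp add: some_in_eq)
  then have "\<exists>v. R C \<in> irreps scale mu \<and> is_char (R C) v (lc C)" if "C \<in> I" for C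
    using lc(1)[OF that] that unfolding char_class_def by blast
  then obtain vc where vc: "\<And>C. C \<in> I \<Longrightarrow> R C \<in> irreps scale mu" "\<And>C. C \<in> I \<Longrightarrow> is_char (R C) (vc C)
      (lc C)"
    by metis
  have inj: "inj_on lc I" using lc(1) by (metis inj_onI)
  define q where "q = (\<lambda>C. coh_class mu (vc C) (lc C) p)"
  have im: "module_image form_scale (closed_forms mu (lc C) p) (q C) (coh C)" if "C \<in> I" for C
    unfolding q_def coh_def by (rule cohomology_image[OF vc(1)[OF that] vc(2)[OF that]])
  have q_eq: "q C w = q C w' \<longleftrightarrow> w - w' \<in> exact_forms mu (lc C) p" if "C \<in> I" for C w w'
    unfolding q_def by (rule coh_class_eq_iff[OF vc(1)[OF that] vc(2)[OF that]])
  define Z where "Z = closed_forms nu (\<lambda>_. 0) p"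
  have Zf: "w \<in> forms p" if "w \<in> Z" for w using that by (simp add: Z_def closed_forms_def)
  have Zs: "F.subspace Z" unfolding Z_def by (rule subspace_closed_forms)
  have PZ: "P l w \<in> closed_forms mu l p" if "w \<in> Z" for l w
    using that Zf[OF that] by (simp add: Z_def P_closed_iff P_closed_nu)
  \<comment> \<open>\<open>lc C\<close> is the character of the isomorphism class \<open>C\<close>,
    and the weight component with this weight is closed for the twisted differential.\<close>
  define \<Phi> where "\<Phi> = (\<lambda>w. \<lambda>C\<in>I. q C (P (lc C) w))"
  have T: "total_cohomology scale mu p = direct_sum_space I coh"
    by (simp add: total_cohomology_def I_def coh_def R_def)
  have "module_image form_scale Z \<Phi> (direct_sum_space I coh)"
  proof
    show "F.subspace Z" by (rule Zs)
    show "\<zero>\<^bsub>direct_sum_space I coh\<^esub> = \<Phi> 0"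
      by (auto simp: direct_sum_space_def \<Phi>_def P_0 module_image.zero[OF im] intro!: restrict_ext)
    show "\<Phi> y \<oplus>\<^bsub>direct_sum_space I coh\<^esub> \<Phi> z = \<Phi> (y + z)" if "y \<in> Z" "z \<in> Z" for y z
      using that by (auto simp: direct_sum_space_def \<Phi>_def P_add module_image.add[OF im] PZ
          intro!: restrict_ext)
    show "c \<odot>\<^bsub>direct_sum_space I coh\<^esub> \<Phi> z = \<Phi> (form_scale c z)" if "z \<in> Z" for c z
      using that by (auto simp: direct_sum_space_def \<Phi>_def P_scale module_image.smult[OF im] PZ
          intro!: restrict_ext)
    show "carrier (direct_sum_space I coh) = \<Phi> ` Z"
    proof (intro subset_antisym subsetI)
      fix f assume "f \<in> \<Phi> ` Z"
      then obtain w where w: "w \<in> Z" "f = \<Phi> w" by blast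
      have "q C (P (lc C) w) \<in> carrier (coh C)" if "C \<in> I" for C
        using PZ[OF w(1)] by (simp add: module_image.carrier[OF im[OF that]])
      \<comment> \<open>A nonzero entry occurs only at a weight of \<open>p\<close>-forms. There are
        finitely many, and distinct classes have distinct characters.\<close>
      moreover have "finite {C \<in> I. f C \<noteq> \<zero>\<^bsub>coh C\<^esub>}"
      proof (rule finite_imageD)
        show "inj_on lc {C \<in> I. f C \<noteq> \<zero>\<^bsub>coh C\<^esub>}" using inj by (rule inj_on_subset) blast
        have "lc C \<in> wsums wt B p" if "C \<in> I" "f C \<noteq> \<zero>\<^bsub>coh C\<^esub>" for C
        proof (rule ccontr)
          assume "lc C \<notin> wsums wt B p"
          then have "P (lc C) w = 0" using P_outside Zf w(1) by blast
          then show False using that w(2) by (simp add: \<Phi>_def module_image.zero[OF im[OF that(1)]])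
        qed
        then have "lc ` {C \<in> I. f C \<noteq> \<zero>\<^bsub>coh C\<^esub>} \<subseteq> wsums wt B p" by blast
        then show "finite (lc ` {C \<in> I. f C \<noteq> \<zero>\<^bsub>coh C\<^esub>})" by (rule finite_subset) (rule
            finite_wsums[OF B])
      qed
      ultimately show "f \<in> carrier (direct_sum_space I coh)"
        by (auto simp: direct_sum_space_def w(2) \<Phi>_def)
    next
      fix f assume "f \<in> carrier (direct_sum_space I coh)"
      then have f: "f \<in> (\<Pi>\<^sub>E C\<in>I. carrier (coh C))" and fin: "finite {C \<in> I. f C \<noteq> \<zero>\<^bsub>coh C\<^esub>}"
        by (auto simp: direct_sum_space_def)
      have "\<exists>z. z \<in> closed_forms mu (lc C) p \<and> f C = q C z" if "C \<in> I" for C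
        using PiE_mem[OF f that] unfolding module_image.carrier[OF im[OF that]] by blast
      then obtain z where z: "\<And>C. C \<in> I \<Longrightarrow> z C \<in> closed_forms mu (lc C) p" "\<And>C. C \<in> I \<Longrightarrow> f C = q C
          (z C)"
        by metis
      define J where "J = {C \<in> I. f C \<noteq> \<zero>\<^bsub>coh C\<^esub>}"
      \<comment> \<open>Surjectivity: each representative is cut down to the weight of its
        coefficients, which makes it \<open>nu\<close>-closed; the sum is finite because the support
        is.\<close>
      define w where "w = (\<Sum>C\<in>J. P (lc C) (z C))"
      have "P (lc C) (z C) \<in> Z" if "C \<in> I" for C
        using P_closed_mu[OF lc(2)[OF that] z(1)[OF that], of "lc C"] z(1)[OF that]
        unfolding Z_def by (subst P_closed_iff[symmetric]) (auto simp: closed_forms_def)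
      then have wZ: "w \<in> Z" unfolding w_def J_def by (intro F.subspace_sum[OF Zs]) auto
      have "\<Phi> w C = f C" if C: "C \<in> I" for C
      proof -
        have "P (lc C) w = (\<Sum>D\<in>J. if D = C then P (lc C) (z C) else 0)"
          unfolding w_def P_sum
          by (rule sum.cong) (use inj C in \<open>auto simp: P_P J_def dest: inj_onD\<close>)
        then have Pw: "P (lc C) w = (if C \<in> J then P (lc C) (z C) else 0)" using fin by (simp
            add: J_def)
        show ?thesis
        proof (cases "C \<in> J")
          case True
          \<comment> \<open>Cutting down did not change the class: the other weight components are
            exact.\<close>
          have "P (lc C) (z C) - z C \<in> exact_forms mu (lc C) p"
            using F.subspace_neg[OF subspace_exact_forms closed_minus_P_exact[OF lc(2)[OF C]
                z(1)[OF C]]]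
            by simp
          then show ?thesis using True C Pw z(2)[OF C] by (simp add: \<Phi>_def q_eq)
        next
          case False
          then have "f C = \<zero>\<^bsub>coh C\<^esub>" using C by (simp add: J_def)
          then show ?thesis using False C Pw by (simp add: \<Phi>_def module_image.zero[OF im])
        qed
      qed
      then have "\<Phi> w = f" using f by (intro PiE_ext[of _ I "\<lambda>_. UNIV"]) (auto simp: \<Phi>_def)
      then show "f \<in> \<Phi> ` Z" using wZ by blast
    qed
  qed
  moreover have "\<Phi> y = \<Phi> z \<longleftrightarrow> y - z \<in> exact_forms nu (\<lambda>_. 0) p" if yz: "y \<in> Z" "z \<in> Z" for y z
  proof -
    have "\<Phi> y = \<Phi> z \<longleftrightarrow> (\<forall>C\<in>I. q C (P (lc C) y) = q C (P (lc C) z))"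
      unfolding \<Phi>_def by (auto simp: fun_eq_iff restrict_def)
    also have "\<dots> \<longleftrightarrow> (\<forall>C\<in>I. P (lc C) (y - z) \<in> exact_forms mu (lc C) p)"
      by (simp add: q_eq P_diff)
    also have "\<dots> \<longleftrightarrow> (\<forall>l. vanishing_char l \<longrightarrow> \<not> closed_forms mu l p \<subseteq> exact_forms mu l p \<longrightarrow>
        P l (y - z) \<in> exact_forms mu l p)"
    proof (intro iffI allI impI ballI)
      fix l assume h: "\<forall>C\<in>I. P (lc C) (y - z) \<in> exact_forms mu (lc C) p"
        and l: "vanishing_char l" "\<not> closed_forms mu l p \<subseteq> exact_forms mu l p"
      have C: "char_class l \<in> I" using l unfolding I_def cohomology_irreps_char by blast
      then have "R (char_class l) \<in> char_class l" using ne[OF C] unfolding R_def by (simp add: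
          some_in_eq)
      then obtain v where "is_char (R (char_class l)) v l" unfolding char_class_def by blast
      then have "lc (char_class l) = l" using char_unique[OF vc(1,2)[OF C]] by blast
      then show "P l (y - z) \<in> exact_forms mu l p" using h C by force
    next
      fix C assume h: "\<forall>l. vanishing_char l \<longrightarrow> \<not> closed_forms mu l p \<subseteq> exact_forms mu l p \<longrightarrow>
        P l (y - z) \<in> exact_forms mu l p" and C: "C \<in> I"
      show "P (lc C) (y - z) \<in> exact_forms mu (lc C) p"
      proof (cases "closed_forms mu (lc C) p \<subseteq> exact_forms mu (lc C) p")
        case True
        then show ?thesis using PZ[OF F.subspace_diff[OF Zs yz]] by blast
      qed (use h lc(2)[OF C] in blast)
    qed
    also have "\<dots> \<longleftrightarrow> y - z \<in> exact_forms nu (\<lambda>_. 0) p"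
      using exact_nu_iff[of "y - z" p] F.subspace_diff[OF Zs yz] by (simp add: Z_def)
    finally show ?thesis .
  qed
  ultimately show ?thesis unfolding T Z_def by blast
qed

end

lemma rdim_total_cohomology_eq:
  assumes mu: "torus_twist sc Basis aa N B wt nu mu" and mu': "torus_twist sc Basis aa' N' B'
      wt' nu mu'"
  shows "rdim (total_cohomology sc mu p) = rdim (total_cohomology sc mu' p)"
proof -
  interpret A: torus_twist sc Basis aa N B wt nu mu by (rule mu)
  define Z X where "Z = A.closed_forms nu (\<lambda>_. 0) p" and "X = A.exact_forms nu (\<lambda>_. 0) p"
  obtain \<Phi> where a: "module_image form_scale Z \<Phi> (total_cohomology sc mu p) \<and>
      (\<forall>y z. y \<in> Z \<longrightarrow> z \<in> Z \<longrightarrow> \<Phi> y = \<Phi> z \<longleftrightarrow> y - z \<in> X)"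
    using A.total_cohomology_image[of p] unfolding Z_def X_def by (rule exE)
  obtain \<Phi>' where b: "module_image form_scale Z \<Phi>' (total_cohomology sc mu' p) \<and>
      (\<forall>y z. y \<in> Z \<longrightarrow> z \<in> Z \<longrightarrow> \<Phi>' y = \<Phi>' z \<longleftrightarrow> y - z \<in> X)"
    using torus_twist.total_cohomology_image[OF mu', of p] unfolding Z_def X_def by (rule exE)
  show ?thesis by (rule rdim_cong[OF conjunct1[OF a] conjunct1[OF b]]) (simp add: a b)
qed

subsection \<open>The family through the nilshadow\<close>

text \<open>\<open>B\<close> is adapted to the decomposition into \<open>aa\<close> and
  \<open>N\<close>, and \<open>w b A\<close> is the weight of \<open>ad A\<close> at
  \<open>b\<close>. Weight 0 on \<open>aa\<close> is consistent with \<open>w_geig\<close>, since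
  elements of the nilpotent algebra \<open>H\<close> act nilpotently on it.\<close>

locale nilshadow_setting = fd_lie scale Basis brk
  for scale :: "'k::{alg_closed_field, field_char_0} \<Rightarrow> 'v::ab_group_add \<Rightarrow> 'v" (infixr "*s" 75)
    and Basis and brk +
  fixes N aa H B :: "'v set" and w :: "'v \<Rightarrow> 'v \<Rightarrow> 'k"
  assumes solvable: "lie_solvable scale brk"
    and nilradical: "is_nilradical scale brk N"
    and H: "lie_subalgebra scale brk H" "lie_nilpotent scale brk H"
    and aa: "subspace aa" "aa \<subseteq> H"
    and compl: "vs_complement scale aa N"
    and B: "independent B" "span B = UNIV" "B \<subseteq> aa \<union> N" "N \<subseteq> span (B \<inter> N)"
    and w_geig: "\<And>b A. b \<in> B \<Longrightarrow> A \<in> H \<Longrightarrow> b \<in> geig (brk A) (w b A)"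
    and w_add: "\<And>b A A'. b \<in> B \<Longrightarrow> A \<in> H \<Longrightarrow> A' \<in> H \<Longrightarrow> w b (A + A') = w b A + w b A'"
    and w_scale: "\<And>b A c. b \<in> B \<Longrightarrow> A \<in> H \<Longrightarrow> w b (c *s A) = c * w b A"
    and w_aa: "\<And>b A. b \<in> B \<Longrightarrow> b \<in> aa \<Longrightarrow> w b A = 0"
begin

lemma N: "subspace N" "\<And>x y. y \<in> N \<Longrightarrow> brk x y \<in> N" "lie_nilpotent scale brk N"
  using nilradical by (auto simp: is_nilradical_def lie_ideal_def)

lemma aa_Int_N: "x \<in> aa \<Longrightarrow> x \<in> N \<Longrightarrow> x = 0"
  using compl by (auto simp: vs_complement_def)

lemma brk_N: "brk x y \<in> N"
  by (rule nilradical_contains[OF solvable nilradical])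

definition D :: "'v \<Rightarrow> 'v \<Rightarrow> 'v" where
  "D A = diag B (\<lambda>b. w b A)"

text \<open>The projection onto \<open>aa\<close> along \<open>N\<close>, written as a diagonal map
  so that its linearity is an instance of \<open>endo_diag\<close>.\<close>

definition pr :: "'v \<Rightarrow> 'v" where
  "pr = diag B (\<lambda>b. if b \<in> aa then 1 else 0)"

lemmas endo_D = endo_diag[OF B(1,2), of "\<lambda>b. w b A" for A, folded D_def]
lemmas endo_pr = endo_diag[OF B(1,2), of "\<lambda>b. if b \<in> aa then 1 else 0", folded pr_def]
lemmas D_lin = endoD[OF endo_D] and pr_lin = endoD[OF endo_pr]

lemma D_add: "A \<in> aa \<Longrightarrow> A' \<in> aa \<Longrightarrow> D (A + A') x = D A x + D A' x"
  unfolding D_def diag_add[OF B(1,2), symmetric]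
  by (rule diag_cong[OF B(1,2)]) (simp add: w_add subsetD[OF aa(2)])

lemma D_scale: "A \<in> aa \<Longrightarrow> D (c *s A) x = c *s D A x"
  unfolding D_def diag_scale[OF B(1,2), symmetric]
  by (rule diag_cong[OF B(1,2)]) (simp add: w_scale subsetD[OF aa(2)])

lemma D_basis: "b \<in> B \<Longrightarrow> D A b = w b A *s b"
  unfolding D_def by (rule diag_basis[OF B(1,2)])

lemma D_0: "D 0 x = 0"
  using D_scale[of 0 0 x] subspace_0[OF aa(1)] by simp

lemma D_diff: "A \<in> aa \<Longrightarrow> A' \<in> aa \<Longrightarrow> D (A - A') x = D A x - D A' x"
  using D_add[of "A - A'" A' x] subspace_diff[OF aa(1), of A A'] by simp

lemma D_sum: "(\<And>i. i \<in> I \<Longrightarrow> h i \<in> aa) \<Longrightarrow> D (\<Sum>i\<in>I. c i *s h i) x = (\<Sum>i\<in>I. c i *s D (h i) x)"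
proof (induction I rule: infinite_finite_induct)
  case (insert i I)
  have "(\<Sum>i\<in>I. c i *s h i) \<in> aa" by (rule subspace_sum[OF aa(1)]) (use insert subspace_scale[OF
      aa(1)] in auto)
  then show ?case using insert subspace_scale[OF aa(1)] by (simp add: D_add D_scale)
qed (simp_all add: D_0)

lemma D_in_N: "D A x \<in> N"
  unfolding D_def diag_def
  by (rule subspace_sum[OF N(1)])
     (use B(3) w_aa in \<open>auto simp: subset_iff intro: subspace_scale[OF N(1)] subspace_0[OF N(1)]\<close>,
      metis scale_zero_left mult_zero_right subspace_0[OF N(1)] subspace_scale[OF N(1)])

lemma pr_sum: "pr x = (\<Sum>i\<in>B \<inter> aa. representation B x i *s i)"
proof -
  have "(\<Sum>i\<in>B \<inter> aa. representation B x i *s i) =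
    (\<Sum>i\<in>B. if i \<in> aa then representation B x i *s i else 0)"
    by (rule sum.inter_restrict[OF finite_basis[OF B(1,2)]])
  also have "\<dots> = pr x" unfolding pr_def diag_def by (rule sum.cong) auto
  finally show ?thesis by simp
qed

lemma pr_in_aa: "pr x \<in> aa"
  unfolding pr_def diag_def
  by (rule subspace_sum[OF aa(1)]) (auto intro: subspace_scale[OF aa(1)] subspace_0[OF aa(1)])

lemma minus_pr_in_N: "x - pr x \<in> N"
proof -
  have "x - pr x = (\<Sum>b\<in>B. representation B x b *s b) - pr x" by (simp add: representation_sum[OF
      B(1,2)])
  also have "\<dots> = (\<Sum>b\<in>B. if b \<in> aa then 0 else representation B x b *s b)"
    unfolding pr_def diag_def sum_subtractf[symmetric] by (rule sum.cong) auto
  also have "\<dots> \<in> N"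
    by (rule subspace_sum[OF N(1)])
       (use B(3) subspace_0[OF N(1)] subspace_scale[OF N(1)] in auto)
  finally show ?thesis .
qed

lemma pr_unique: "a \<in> aa \<Longrightarrow> x - a \<in> N \<Longrightarrow> pr x = a"
  using aa_Int_N[of "pr x - a"] subspace_diff[OF aa(1) pr_in_aa, of a x]
    subspace_diff[OF N(1), of "x - a" "x - pr x"] minus_pr_in_N[of x] by simp

lemma pr_aa: "a \<in> aa \<Longrightarrow> pr a = a"
  by (rule pr_unique) (simp_all add: subspace_0 N)

lemma pr_N: "x \<in> N \<Longrightarrow> pr x = 0"
  by (rule pr_unique) (simp_all add: subspace_0 aa)

lemma comp_along_eq: "comp_along aa N x = pr x"
  unfolding comp_along_def
  by (rule the_equality) (auto simp: pr_in_aa minus_pr_in_N pr_unique)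

lemma D_on_aa:
  assumes "a \<in> aa"
  shows "D A a = 0"
proof -
  have "D A a = D A (pr a)" by (simp add: pr_aa assms)
  also have "pr a = (\<Sum>b\<in>B. (representation B a b * (if b \<in> aa then 1 else 0)) *s b)"
    by (simp add: pr_def diag_def)
  also have "D A \<dots> = 0"
    unfolding D_lin(6) D_lin(3) by (rule sum.neutral) (simp add: D_basis w_aa)
  finally show ?thesis .
qed

lemma D_comm: "D A (D A' x) = D A' (D A x)"
  unfolding D_def by (rule diag_comm[OF B(1,2)])

lemma D_brk:
  assumes "A \<in> aa"
  shows "D A (brk x y) = brk (D A x) y + brk x (D A y)"
  unfolding D_def
  by (rule diag_derivation[OF B(1,2) brk_alt brk(12) ad_derivation w_geig])
     (use assms aa(2) in auto)

lemma semisimple_part_ad: "A \<in> aa \<Longrightarrow> semisimple_part scale (brk A) = D A"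
  unfolding D_def by (rule semisimple_part_diag[OF B(1,2)]) (use aa(2) w_geig brk in auto)

lemma nilpotent_ad_minus_D:
  assumes "A \<in> aa"
  shows "\<exists>n. \<forall>x. ((\<lambda>x. brk A x - D A x) ^^ n) x = 0"
proof -
  have "nilpotent_endo scale (\<lambda>x. brk A x - diag B (\<lambda>b. w b A) x)"
    by (rule nilpotent_minus_diag[OF B(1,2)]) (use assms aa(2) w_geig brk in auto)
  then show ?thesis unfolding D_def nilpotent_endo_def by (rule conjunct2)
qed

lemma D_injective:
  assumes A: "A \<in> aa" and D: "\<And>x. D A x = 0"
  shows "A = 0"
proof -
  obtain n where "\<forall>x. ((\<lambda>x. brk A x - D A x) ^^ n) x = 0" using nilpotent_ad_minus_D[OF A] by blast
  then have "(brk A ^^ n) x = 0" for x by (simp add: D)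
  then have "A \<in> N" by (rule nilradical_contains(2)[OF solvable nilradical])
  then show ?thesis using aa_Int_N[OF A] by simp
qed

definition nu :: "'v \<Rightarrow> 'v \<Rightarrow> 'v" where
  "nu x y = brk x y - D (pr x) y + D (pr y) x"

lemma nilshadow_eq: "nilshadow scale brk aa N = nu"
  by (intro ext) (simp add: nilshadow_def nu_def comp_along_eq semisimple_part_ad pr_in_aa)

definition aa_maps :: "('v \<Rightarrow> 'v) set" where
  "aa_maps = {g. endo g \<and> range g \<subseteq> aa \<and> (\<forall>x\<in>N. g x = 0)}"

lemma aa_mapsD:
  assumes "g \<in> aa_maps"
  shows "endo g" "g x \<in> aa" "x \<in> N \<Longrightarrow> g x = 0"
  using assms by (auto simp: aa_maps_def)

definition twist :: "('v \<Rightarrow> 'v) \<Rightarrow> 'v \<Rightarrow> 'v \<Rightarrow> 'v" where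
  "twist g = (\<lambda>x y. D (g x) y - D (g y) x)"

lemma alt_bilinear_twist:
  assumes g: "g \<in> aa_maps" and m: "m \<in> alt_bilinear scale"
  shows "m + twist g \<in> alt_bilinear scale"
proof -
  note M = alt_bilinearD[OF m] and G = endoD[OF aa_mapsD(1)[OF g]] and ga = aa_mapsD(2)[OF g]
  have "endo ((m + twist g) x)" for x
    by (rule endoI) (simp_all add: twist_def M G D_lin D_add[OF ga ga] D_scale[OF ga] algebra_simps)
  moreover have "endo (\<lambda>x. (m + twist g) x y)" for y
    by (rule endoI) (simp_all add: twist_def M G D_lin D_add[OF ga ga] D_scale[OF ga] algebra_simps)
  moreover have "(m + twist g) x x = 0" for x by (simp add: twist_def M)
  ultimately show ?thesis by (simp only: alt_bilinear_def mem_Collect_eq simp_thms)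
qed

lemma pr_aa_maps: "(\<lambda>x. - pr x) \<in> aa_maps"
  unfolding aa_maps_def using pr_in_aa subspace_neg[OF aa(1)]
  by (auto intro!: endoI simp: pr_lin pr_N)

lemma nu_twist: "nu = brk + twist (\<lambda>x. - pr x)"
proof -
  have "D (- pr x) y = - D (pr x) y" for x y
    using D_scale[OF pr_in_aa, of "-1" x y] by simp
  then show ?thesis by (intro ext) (simp add: nu_def twist_def)
qed

lemma nu_alt: "nu \<in> alt_bilinear scale"
  unfolding nu_twist by (rule alt_bilinear_twist[OF pr_aa_maps brk_alt])

lemma nu_in_N: "nu x y \<in> N"
  unfolding nu_def by (intro subspace_add subspace_diff N D_in_N brk_N)

text \<open>For \<open>x\<close> in \<open>aa\<close> this is \<open>ad x\<close> minus its
  semisimple part. For \<open>x\<close> in \<open>N\<close> the first application lands in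
  \<open>N\<close>, and there \<open>nu x\<close> is \<open>ad x\<close>, nilpotent because
  \<open>N\<close> is.\<close>

lemma nu_nilpotent:
  assumes "x \<in> aa \<union> N"
  shows "\<exists>k. \<forall>y. (nu x ^^ k) y = 0"
proof (cases "x \<in> aa")
  case True
  then have "nu x = (\<lambda>y. brk x y - D x y)" by (auto simp: nu_def pr_aa D_on_aa)
  then show ?thesis using nilpotent_ad_minus_D[OF True] by simp
next
  case False
  then have x: "x \<in> N" using assms by blast
  obtain k where k: "lower_central_series scale brk N k = {0}" using N(3) by (auto simp:
      lie_nilpotent_def)
  have "(nu x ^^ i) y = (brk x ^^ i) y \<and> (brk x ^^ i) y \<in> N" if "y \<in> N" for i y
    using that by (induction i) (auto simp: nu_def pr_N x D_0 N)
  then have "(nu x ^^ Suc k) y = (brk x ^^ k) (nu x y)" for y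
    using nu_in_N by (simp only: funpow_Suc_right comp_apply)
  moreover have "(brk x ^^ k) (nu x y) = 0" for y
    using lower_central_funpow[OF x nu_in_N[of x y], of k] k by auto
  ultimately show ?thesis by metis
qed

text \<open>In the Jacobi sum the mixed terms cancel: the maps \<open>G x\<close> are commuting
  derivations, and \<open>G\<close> vanishes at brackets and at values of \<open>G\<close>, since
  both lie in \<open>N\<close>.\<close>

lemma twist_lie:
  assumes g: "g \<in> aa_maps"
  shows "lie_bracket scale (brk + twist g)"
proof -
  define G where "G = (\<lambda>x. D (g x))"
  have GN: "G x y = 0" if "x \<in> N" for x y using that by (simp add: G_def aa_mapsD(3)[OF g] D_0)
  have GG: "G (G x y) z = 0" for x y z by (rule GN) (simp add: G_def D_in_N)
  have Gb: "G (brk x y) z = 0" for x y z by (rule GN) (rule brk_N)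
  have G1: "G (x + y) z = G x z + G y z" "G (x - y) z = G x z - G y z" for x y z
    by (simp_all add: G_def endoD[OF aa_mapsD(1)[OF g]] D_add D_diff aa_mapsD(2)[OF g])
  have G2: "G x (y + z) = G x y + G x z" "G x (y - z) = G x y - G x z" for x y z
    by (simp_all add: G_def D_lin)
  have Gd: "G x (brk y z) = brk (G x y) z + brk y (G x z)" for x y z
    unfolding G_def by (rule D_brk) (rule aa_mapsD[OF g])
  have Gc: "G x (G y z) = G y (G x z)" for x y z unfolding G_def by (rule D_comm)
  have J: "brk x (brk y z) + brk y (brk z x) + brk z (brk x y) = 0" for x y z
    using lie by (simp add: lie_bracket_def)
  have e: "(brk + twist g) x y = brk x y + (G x y - G y x)" for x y by (simp add: twist_def G_def)
  have "(brk + twist g) x ((brk + twist g) y z) + (brk + twist g) y ((brk + twist g) z x)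
      + (brk + twist g) z ((brk + twist g) x y)
    = brk x (brk y z) + brk y (brk z x) + brk z (brk x y)" for x y z
    unfolding e
    by (simp add: brk G1 G2 GG Gb Gd brk_skew[of "G x y" z] brk_skew[of "G y z" x] brk_skew[of
        "G z x" y]
        Gc[of x y z] Gc[of y z x] Gc[of z x y])
  then show ?thesis
    using alt_bilinear_twist[OF g brk_alt] J unfolding lie_bracket_def by simp
qed

text \<open>The nilshadow has parameter \<open>- pr\<close>; measured from there, the member with
  parameter \<open>g\<close> is the twist of \<open>nu\<close> by
  \<open>D (pr x + g x)\<close>.\<close>

lemma torus_twist:
  assumes g: "g \<in> aa_maps"
  shows "torus_twist scale Basis aa N B (\<lambda>b x. w b (pr x + g x)) nu (brk + twist g)"
proof
  have psi: "pr x + g x \<in> aa" for x by (intro subspace_add aa pr_in_aa aa_mapsD(2)[OF g])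
  note gl = endoD[OF aa_mapsD(1)[OF g]]
  have E: "diag B (\<lambda>b. w b (pr x + g x)) = D (pr x + g x)" for x by (simp add: D_def)
  show "independent B" "span B = UNIV" by (rule B)+
  show "w b (pr (x + y) + g (x + y)) = w b (pr x + g x) + w b (pr y + g y)" if "b \<in> B" for b x y
    using w_add[OF that, of "pr x + g x" "pr y + g y"] psi aa(2)
    by (simp add: pr_lin gl subset_iff algebra_simps)
  show "w b (pr (c *s x) + g (c *s x)) = c * w b (pr x + g x)" if "b \<in> B" for b c x
    using w_scale[OF that, of "pr x + g x" c] psi aa(2)
    by (simp add: pr_lin gl subset_iff scale_right_distrib)
  show "w b (pr x + g x) = 0" if "b \<in> B" "x \<in> N" for b x
    using w_scale[OF that(1), of 0 0] subspace_0[OF aa(1)] aa(2) that(2)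
    by (simp add: pr_N aa_mapsD(3)[OF g] subset_iff)
  show "diag B (\<lambda>b. w b (pr x + g x)) a = 0" if "a \<in> aa" for x a
    unfolding E by (rule D_on_aa[OF that])
  show "diag B (\<lambda>b. w b (pr x + g x)) y \<in> N" for x y unfolding E by (rule D_in_N)
  have D_nu: "D A (nu y z) = nu (D A y) z + nu y (D A z)" if "A \<in> aa" for A y z
    using that by (simp add: nu_def D_lin D_brk pr_N D_in_N D_0 D_comm[of A] algebra_simps)
  show "diag B (\<lambda>b. w b (pr x + g x)) (nu y z) =
      nu (diag B (\<lambda>b. w b (pr x + g x)) y) z + nu y (diag B (\<lambda>b. w b (pr x + g x)) z)" for x y z
    unfolding E by (rule D_nu[OF psi])
  show "\<exists>a\<in>aa. \<exists>n\<in>N. x = a + n" for x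
    using pr_in_aa[of x] minus_pr_in_N[of x] by (intro bexI[of _ "pr x"] bexI[of _ "x - pr x"]) auto
  show "N \<subseteq> span (B \<inter> N)" by (rule B)
  show "nu \<in> alt_bilinear scale" by (rule nu_alt)
  show "nu x y \<in> N" for x y by (rule nu_in_N)
  show "\<exists>k. \<forall>y. (nu x ^^ k) y = 0" if "x \<in> aa \<union> N" for x by (rule nu_nilpotent[OF that])
  show "(brk + twist g) x y = nu x y + diag B (\<lambda>b. w b (pr x + g x)) y - diag B (\<lambda>b. w b (pr y +
      g y)) x" for x y
    unfolding E by (simp add: twist_def nu_def D_add pr_in_aa aa_mapsD(2)[OF g])
  show "lie_bracket scale (brk + twist g)" by (rule twist_lie[OF g])
  have "lie_chain scale brk N"
    by (rule solvable_lie_chain[OF solvable N(1)]) (rule N(2))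
  then have "lie_chain scale (brk + twist g) N"
    by (rule lie_chain_cong[of brk N N]) (auto simp: twist_def aa_mapsD(3)[OF g] D_0)
  then show "lie_chain scale (brk + twist g) UNIV"
  proof (rule lie_chain_extend)
    show "(brk + twist g) x y \<in> N" for x y
      unfolding twist_def plus_fun_apply by (intro subspace_add subspace_diff N D_in_N brk_N)
  qed auto
qed

section \<open>Dimension of the family\<close>

interpretation FF: vector_space "fscale (fscale scale) :: 'k \<Rightarrow> ('v \<Rightarrow> 'v \<Rightarrow> 'v) \<Rightarrow> _"
  by (intro vector_space_fscale vector_space_axioms)

lemma twist_sum:
  assumes "\<And>i. i \<in> I \<Longrightarrow> g i \<in> aa_maps"
  shows "twist (\<lambda>x. \<Sum>i\<in>I. c i *s g i x) = (\<Sum>i\<in>I. fscale (fscale scale) (c i) (twist (g i)))"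
proof (intro ext)
  fix x y
  have s: "(\<Sum>i\<in>J. fscale (fscale scale) (c i) (twist (g i))) x y = (\<Sum>i\<in>J. c i *s twist (g i) x
      y)" for J
    by (induction J rule: infinite_finite_induct) (auto simp: fscale_def)
  have "D (\<Sum>i\<in>I. c i *s g i x) y = (\<Sum>i\<in>I. c i *s D (g i x) y)" for x y
    by (rule D_sum) (rule aa_mapsD(2)[OF assms])
  then show "twist (\<lambda>x. \<Sum>i\<in>I. c i *s g i x) x y = (\<Sum>i\<in>I. fscale (fscale scale) (c i) (twist (g
      i))) x y"
    unfolding s by (simp add: twist_def sum_subtractf scale_right_diff_distrib)
qed

lemma aa_maps_sum:
  assumes "\<And>i. i \<in> I \<Longrightarrow> g i \<in> aa_maps"
  shows "(\<lambda>x. \<Sum>i\<in>I. c i *s g i x) \<in> aa_maps"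
proof -
  have "endo (\<lambda>x. \<Sum>i\<in>I. c i *s g i x)"
    by (rule endoI)
       (simp_all add: endoD[OF aa_mapsD(1)[OF assms]] scale_right_distrib sum.distrib
         scale_sum_right mult.commute)
  then show ?thesis
    using aa_mapsD[OF assms]
    by (auto simp: aa_maps_def intro!: subspace_sum[OF aa(1)] subspace_scale[OF aa(1)])
qed

text \<open>With first argument \<open>pr x\<close> the second term of the twist drops out, because
  \<open>D\<close> kills \<open>aa\<close>; then \<open>D_injective\<close> applies.\<close>

lemma twist_eq_0:
  assumes g: "g \<in> aa_maps" and 0: "twist g = 0"
  shows "g x = 0"
proof -
  have "D (g (pr x)) y = 0" for y
    using fun_cong[OF fun_cong[OF 0, of "pr x"], of y] by (simp add: twist_def D_on_aa pr_in_aa)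
  then have "g (pr x) = 0" by (rule D_injective[OF aa_mapsD(2)[OF g]])
  moreover have "g (x - pr x) = 0" by (rule aa_mapsD(3)[OF g minus_pr_in_N])
  ultimately show ?thesis by (simp add: endoD[OF aa_mapsD(1)[OF g]])
qed

lemma subspace_twists: "FF.subspace (twist ` aa_maps)"
proof (rule FF.subspaceI)
  have z: "twist (\<lambda>x. 0) = 0" "(\<lambda>x. 0) \<in> aa_maps"
    using twist_sum[of "{} :: nat set"] aa_maps_sum[of "{} :: nat set"] by auto
  show "0 \<in> twist ` aa_maps" using z by force
  show "u + v \<in> twist ` aa_maps" if uv: "u \<in> twist ` aa_maps" "v \<in> twist ` aa_maps" for u v
  proof -
    obtain g h where gh: "g \<in> aa_maps" "h \<in> aa_maps" "u = twist g" "v = twist h" using uv by blast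
    \<comment> \<open>Addition is treated as a sum over a two-element index set, so that
      \<open>twist_sum\<close> and \<open>aa_maps_sum\<close> cover it.\<close>
    define k where "k = (\<lambda>i::bool. if i then g else h)"
    have "k i \<in> aa_maps" for i using gh by (simp add: k_def)
    then have "u + v = twist (\<lambda>x. \<Sum>i\<in>{True, False}. 1 *s k i x)"
      by (subst twist_sum) (auto simp: gh k_def)
    moreover have "(\<lambda>x. \<Sum>i\<in>{True, False}. 1 *s k i x) \<in> aa_maps"
      by (rule aa_maps_sum) (use gh k_def in auto)
    ultimately show ?thesis by blast
  qed
  show "fscale (fscale scale) c u \<in> twist ` aa_maps" if u: "u \<in> twist ` aa_maps" for c u
  proof -
    obtain g where g: "g \<in> aa_maps" "u = twist g" using u by blast
    have "fscale (fscale scale) c u = twist (\<lambda>x. \<Sum>i\<in>{()}. c *s g x)"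
      by (subst twist_sum) (auto simp: g)
    moreover have "(\<lambda>x. \<Sum>i\<in>{()}. c *s g x) \<in> aa_maps" by (rule aa_maps_sum) (use g in auto)
    ultimately show ?thesis by blast
  qed
qed

text \<open>The matrix units of \<open>aa\<close> with respect to \<open>B \<inter> aa\<close>,
  extended by 0 to \<open>N\<close>, map under \<open>twist\<close> to a basis.\<close>

lemma dim_twists: "FF.dim (twist ` aa_maps) = (card (B \<inter> aa))\<^sup>2"
proof -
  let ?I = "(B \<inter> aa) \<times> (B \<inter> aa)"
  have fB: "finite B" by (rule finite_basis[OF B(1,2)])
  have indep: "independent (B \<inter> aa)" by (rule independent_mono[OF B(1)]) blast
  \<comment> \<open>For \<open>p = (i, j)\<close> the matrix unit that sends \<open>i\<close> to
    \<open>j\<close> and the other basis vectors to 0.\<close>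
  define u where "u = (\<lambda>p x. representation B x (fst p) *s snd p)"
  have rep: "representation B i k = (if k = i then 1 else 0)" if "i \<in> B" for i k
    using representation_basis[OF B(1) that] by simp
  have u_maps: "u p \<in> aa_maps" if "p \<in> ?I" for p
  proof -
    have "representation B x (fst p) = 0" if "x \<in> N" for x
    proof -
      have "x \<in> span (B \<inter> N)" using that B(4) by blast
      then have "representation B x = representation (B \<inter> N) x" by (rule
          representation_extend[OF B(1)]) blast
      moreover have "fst p \<notin> N"
        using \<open>p \<in> ?I\<close> aa_Int_N[of "fst p"] B(1) dependent_zero[of B] by auto
      ultimately show ?thesis using representation_ne_zero[of "B \<inter> N" x "fst p"] by auto
    qed
    then show ?thesis
      using that unfolding aa_maps_def u_def
      by (auto intro!: endoI subspace_scale[OF aa(1)]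
          simp: representation_add[OF B(1)] representation_scale[OF B(1)] B(2) scale_left_distrib)
  qed
  have u_indep: "c p = 0" if h: "twist (\<lambda>x. \<Sum>p\<in>?I. c p *s u p x) = 0" "p \<in> ?I" for c p
  proof -
    obtain i j where p: "p = (i, j)" "i \<in> B" "i \<in> aa" "j \<in> B \<inter> aa" using h(2) by auto
    have "(\<Sum>p\<in>?I. c p *s u p i) = 0"
      by (rule twist_eq_0[OF aa_maps_sum h(1)]) (rule u_maps)
    also have "(\<Sum>p\<in>?I. c p *s u p i) = (\<Sum>k\<in>B \<inter> aa. \<Sum>j\<in>B \<inter> aa. if k = i then c (i, j) *s j else 0)"
      unfolding sum.cartesian_product
      by (rule sum.cong) (auto simp: u_def rep p)
    also have "\<dots> = (\<Sum>j\<in>B \<inter> aa. c (i, j) *s j)"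
      using p fB by (subst sum.swap) simp
    finally show ?thesis
      using independentD[OF indep _ subset_refl, of "\<lambda>j. c (i, j)" j] p fB by simp
  qed
  have inj: "inj_on (\<lambda>p. twist (u p)) ?I"
  proof (rule inj_onI)
    fix p q assume pq: "p \<in> ?I" "q \<in> ?I" "twist (u p) = twist (u q)"
    show "p = q"
    proof (rule ccontr)
      assume "p \<noteq> q"
      define c :: "'v \<times> 'v \<Rightarrow> 'k" where "c = (\<lambda>r. if r = p then 1 else if r = q then -1 else 0)"
      have "twist (\<lambda>x. \<Sum>r\<in>?I. c r *s u r x) = (\<Sum>r\<in>?I. fscale (fscale scale) (c r) (twist (u r)))"
        by (rule twist_sum) (rule u_maps)
      also have "\<dots> = (\<Sum>r\<in>{p, q}. fscale (fscale scale) (c r) (twist (u r)))"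
        using pq fB by (intro sum.mono_neutral_right) (auto simp: c_def)
      also have "\<dots> = 0" using \<open>p \<noteq> q\<close> pq(3) by (simp add: c_def)
      finally have "c p = 0" by (rule u_indep[OF _ pq(1)])
      then show False by (simp add: c_def)
    qed
  qed
  define S where "S = (\<lambda>p. twist (u p)) ` ?I"
  have "S \<subseteq> twist ` aa_maps" unfolding S_def using u_maps by blast
  moreover have "card S = (card (B \<inter> aa))\<^sup>2"
    unfolding S_def card_image[OF inj] by (simp add: card_cartesian_product power2_eq_square)
  moreover have "FF.independent S"
  proof
    have fin: "finite S" using fB by (simp add: S_def)
    assume "FF.dependent S"
    then obtain f t where t: "t \<in> S" "f t \<noteq> 0"
      and f: "(\<Sum>t\<in>S. fscale (fscale scale) (f t) t) = 0"
      unfolding FF.dependent_finite[OF fin] by (elim exE conjE bexE)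
    obtain p where p: "t = twist (u p)" "p \<in> ?I" using t(1) unfolding S_def by (rule imageE)
    have "twist (\<lambda>x. \<Sum>p\<in>?I. f (twist (u p)) *s u p x) = 0"
      using f unfolding S_def sum.reindex[OF inj] by (subst twist_sum) (auto simp: u_maps)
    then have "f (twist (u p)) = 0" by (rule u_indep[OF _ p(2)])
    then show False using t(2) p(1) by simp
  qed
  moreover have "twist ` aa_maps \<subseteq> FF.span S"
  proof (rule image_subsetI)
    fix g assume g: "g \<in> aa_maps"
    define c where "c = (\<lambda>p. representation B (g (fst p)) (snd p))"
    have g_eq: "g x = (\<Sum>p\<in>?I. c p *s u p x)" for x
    proof -
      have gi: "g i = (\<Sum>j\<in>B \<inter> aa. representation B (g i) j *s j)" for i
        using pr_sum[of "g i"] by (simp add: pr_aa aa_mapsD(2)[OF g])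
      have "g x = g (pr x)"
        using aa_mapsD(3)[OF g minus_pr_in_N, of x] by (simp add: endoD[OF aa_mapsD(1)[OF g]])
      also have "pr x = (\<Sum>i\<in>B \<inter> aa. representation B x i *s i)" by (rule pr_sum)
      also have "g \<dots> = (\<Sum>i\<in>B \<inter> aa. representation B x i *s g i)"
        by (simp add: endoD[OF aa_mapsD(1)[OF g]])
      also have "\<dots> = (\<Sum>i\<in>B \<inter> aa. \<Sum>j\<in>B \<inter> aa. c (i, j) *s u (i, j) x)"
        by (rule sum.cong[OF refl], subst gi) (simp add: scale_sum_right c_def u_def mult.commute)
      finally show ?thesis by (simp add: sum.cartesian_product)
    qed
    have "twist g = twist (\<lambda>x. \<Sum>p\<in>?I. c p *s u p x)"
      by (intro arg_cong[where f = twist] ext g_eq)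
    also have "\<dots> = (\<Sum>p\<in>?I. fscale (fscale scale) (c p) (twist (u p)))"
      by (rule twist_sum) (rule u_maps)
    also have "\<dots> \<in> FF.span S"
      by (intro FF.span_sum FF.span_scale FF.span_base) (simp add: S_def)
    finally show "twist g \<in> FF.span S" .
  qed
  ultimately show ?thesis by (intro FF.dim_unique)
qed

text \<open>The quotient is presented a second time, as the image of \<open>aa\<close>; the coset
  map is injective there, so the dimension is that of \<open>aa\<close>.\<close>

lemma rdim_quotient: "rdim (quot_space scale UNIV N) = card (B \<inter> aa)"
proof -
  interpret Q: module_image scale UNIV "\<lambda>z. {z + b | b. b \<in> N}" "quot_space scale UNIV N"
    by (rule quot_space_image) (simp_all add: N)
  have eq: "{y + b | b. b \<in> N} = {z + b | b. b \<in> N} \<longleftrightarrow> y - z \<in> N" for y z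
    by (rule coset_eq_iff[OF N(1)])
  interpret A: module_image scale aa "\<lambda>z. {z + b | b. b \<in> N}" "quot_space scale UNIV N"
  proof
    have "{x + b | b. b \<in> N} = {pr x + b | b. b \<in> N}" for x unfolding eq by (rule minus_pr_in_N)
    then show "carrier (quot_space scale UNIV N) = (\<lambda>z. {z + b | b. b \<in> N}) ` aa"
      unfolding Q.carrier using pr_in_aa by blast
  qed (simp_all only: aa(1) Q.zero Q.add Q.smult UNIV_I)
  have "rdim (quot_space scale UNIV N) = dim aa"
  proof (rule A.rdim_inj[OF _ finite_Basis])
    show "inj_on (\<lambda>z. {z + b | b. b \<in> N}) aa"
    proof (rule inj_onI)
      fix y z assume "y \<in> aa" "z \<in> aa" "{y + b | b. b \<in> N} = {z + b | b. b \<in> N}"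
      then have "y - z = 0" by (intro aa_Int_N subspace_diff[OF aa(1)]) (simp_all only: eq)
      then show "y = z" by simp
    qed
  qed (simp add: span_Basis)
  also have "\<dots> = card (B \<inter> aa)"
  proof (rule dim_unique)
    show "independent (B \<inter> aa)" by (rule independent_mono[OF B(1)]) blast
    show "aa \<subseteq> span (B \<inter> aa)"
    proof
      fix a assume "a \<in> aa"
      then have "a = (\<Sum>b\<in>B. (representation B a b * (if b \<in> aa then 1 else 0)) *s b)"
        using pr_aa[of a] by (simp add: pr_def diag_def)
      also have "\<dots> \<in> span (B \<inter> aa)"
        by (rule span_sum) (auto intro: span_scale span_base span_zero)
      finally show "a \<in> span (B \<inter> aa)" .
    qed
  qed auto
  finally show ?thesis .
qed

end

theorem mainTheorem6:
  fixes scale :: "'k::{alg_closed_field, field_char_0} \<Rightarrow> 's::ab_group_add \<Rightarrow> 's"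
    and brk :: "'s \<Rightarrow> 's \<Rightarrow> 's"
    and N \<aa> H :: "'s set"
    and r :: nat
  assumes "fd_lie_algebra scale brk"
    and "lie_solvable scale brk"
    and "is_nilradical scale brk N"
    and "r = rdim (quot_space scale UNIV N)"
    and "cartan_subalgebra scale brk H"
    and "subsp scale \<aa>" and "\<aa> \<subseteq> H"
    and "vs_complement scale \<aa> N"
  shows "\<exists>A. A \<subseteq> alt_bilinear scale \<and>
             affine_subspace (fscale (fscale scale)) A \<and>
             affine_dim (fscale (fscale scale)) A \<ge> r ^ 2 \<and>
             (\<forall>\<mu>\<in>A. lie_bracket scale \<mu>) \<and>
             brk \<in> A \<and>
             nilshadow scale brk \<aa> N \<in> A \<and>
             (\<forall>\<mu>\<in>A. \<forall>p \<le> ldim scale UNIV.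
                rdim (total_cohomology scale \<mu> p) = rdim (total_cohomology scale brk p))"
proof -
  obtain Basis where fd: "finite_dimensional_vector_space scale Basis" and lie: "lie_bracket
      scale brk"
    using assms(1) by (auto simp: fd_lie_algebra_def)
  interpret V: finite_dimensional_vector_space scale Basis by (rule fd)
  interpret L: fd_lie scale Basis brk by unfold_locales (rule lie)
  have H: "lie_subalgebra scale brk H" "lie_nilpotent scale brk H"
    using assms(5) by (auto simp: cartan_subalgebra_def)
  have N: "lie_ideal scale brk N" using assms(3) by (simp add: is_nilradical_def)
  have compl: "\<aa> \<inter> N = {0}" "{u + v | u v. u \<in> \<aa> \<and> v \<in> N} = UNIV"
    using assms(8) by (auto simp: vs_complement_def)
  obtain BN al where BN: "V.independent BN" "V.span BN = N"
    and al: "\<And>b A. b \<in> BN \<Longrightarrow> A \<in> H \<Longrightarrow> b \<in> L.geig (brk A) (al b A)"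
      "\<And>b A A'. b \<in> BN \<Longrightarrow> A \<in> H \<Longrightarrow> A' \<in> H \<Longrightarrow> al b (A + A') = al b A + al b A'"
      "\<And>b A c. b \<in> BN \<Longrightarrow> A \<in> H \<Longrightarrow> al b (scale c A) = c * al b A"
    using L.nilpotent_subalgebra_weights[OF assms(2) N H] by blast
  have BN_N: "BN \<subseteq> N" using BN(2) V.span_superset by blast
  \<comment> \<open>The weight basis of \<open>N\<close> is completed by vectors of
    \<open>\<aa>\<close>, which gives a basis adapted to both summands.\<close>
  obtain B where B: "BN \<subseteq> B" "B \<subseteq> BN \<union> \<aa>" "V.independent B" "BN \<union> \<aa> \<subseteq> V.span B"
    using V.maximal_independent_subset_extend[of BN "BN \<union> \<aa>"] BN(1) by blast
  have "N \<subseteq> V.span B" using BN(2) V.span_mono[OF B(1)] by simp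
  then have sum_in_span: "u + v \<in> V.span B" if "u \<in> \<aa>" "v \<in> N" for u v
    using that B(4) by (intro V.span_add) auto
  have "x \<in> V.span B" for x
  proof -
    have "x \<in> {u + v | u v. u \<in> \<aa> \<and> v \<in> N}" unfolding compl(2) by simp
    then show ?thesis using sum_in_span by blast
  qed
  then have B_span: "V.span B = UNIV" by blast
  \<comment> \<open>The vectors outside \<open>BN\<close> lie in \<open>\<aa>\<close>, hence in the
    nilpotent algebra \<open>H\<close>, where 0 is the only generalized eigenvalue.\<close>
  define w where "w = (\<lambda>b A. if b \<in> BN then al b A else 0)"
  interpret S: nilshadow_setting scale Basis brk N \<aa> H B w
  proof
    show "B \<subseteq> \<aa> \<union> N" using B(2) BN_N by blast
    show "N \<subseteq> V.span (B \<inter> N)" using BN(2) V.span_mono[of BN "B \<inter> N"] B(1) BN_N by blast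
    show "b \<in> L.geig (brk A) (w b A)" if "b \<in> B" "A \<in> H" for b A
      using that B(2) al(1) L.nilpotent_geig_0[OF H(2)] assms(7) by (auto simp: w_def)
    show "w b (A + A') = w b A + w b A'" if "A \<in> H" "A' \<in> H" for b A A'
      using that al(2) by (simp add: w_def)
    show "w b (scale c A) = c * w b A" if "A \<in> H" for b A c
      using that al(3) by (simp add: w_def)
    show "w b A = 0" if "b \<in> B" "b \<in> \<aa>" for b A
    proof -
      have "b \<noteq> 0" using that(1) B(3) V.dependent_zero by blast
      then have "b \<notin> BN" using that(2) BN_N compl(1) by blast
      then show ?thesis by (simp add: w_def)
    qed
  qed (use assms B B_span H in auto)
  define A where "A = {brk + d | d. d \<in> S.twist ` S.aa_maps}"
  have "\<mu> \<in> A \<Longrightarrow> \<exists>g\<in>S.aa_maps. \<mu> = brk + S.twist g" for \<mu> by (auto simp: A_def)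
  note A_cases = this
  have zero: "(\<lambda>x. 0) \<in> S.aa_maps" "brk + S.twist (\<lambda>x. 0) = brk"
    using V.subspace_0[OF assms(6)] by (auto simp: S.aa_maps_def S.twist_def S.D_0 fun_eq_iff
        intro!: L.endoI)
  have "{x - y | x y. x \<in> A \<and> y \<in> A} = S.twist ` S.aa_maps"
  proof -
    interpret FF: vector_space "fscale (fscale scale)"
      by (intro vector_space_fscale V.vector_space_axioms)
    note sub = S.subspace_twists
    have "d \<in> {x - y | x y. x \<in> A \<and> y \<in> A}" if "d \<in> S.twist ` S.aa_maps" for d
      using that FF.subspace_0[OF sub]
      by (intro CollectI exI[of _ "brk + d"] exI[of _ "brk + 0"]) (auto simp: A_def)
    then show ?thesis using FF.subspace_diff[OF sub] by (auto simp: A_def)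
  qed
  then have dim: "affine_dim (fscale (fscale scale)) A = r\<^sup>2"
    using S.dim_twists S.rdim_quotient assms(4) by (simp add: affine_dim_def)
  have lieA: "lie_bracket scale \<mu>" if "\<mu> \<in> A" for \<mu>
    using A_cases[OF that] S.twist_lie by blast
  \<comment> \<open>The given bracket is itself the member with parameter 0, so any other member is
    compared with it through the common nilshadow.\<close>
  have coh: "rdim (total_cohomology scale \<mu> p) = rdim (total_cohomology scale brk p)" if "\<mu> \<in> A"
      for \<mu> p
    using A_cases[OF that] rdim_total_cohomology_eq S.torus_twist S.torus_twist[OF zero(1),
        unfolded zero(2)]
    by blast
  show ?thesis
  proof (intro exI[of _ A] conjI)
    show "A \<subseteq> alt_bilinear scale" using lieA by (auto simp: lie_bracket_def)
    show "affine_subspace (fscale (fscale scale)) A"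
      unfolding affine_subspace_def A_def using S.subspace_twists by blast
    show "r\<^sup>2 \<le> affine_dim (fscale (fscale scale)) A" using dim by simp
    show "brk \<in> A" unfolding A_def using zero by (intro CollectI exI[of _ "S.twist (\<lambda>x. 0)"]) auto
    show "nilshadow scale brk \<aa> N \<in> A"
      unfolding A_def S.nilshadow_eq S.nu_twist using S.pr_aa_maps by blast
  qed (use lieA coh in auto)
qed

end
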